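(* Let $\Bbbk$ be a field. Let $M$ (resp. $\mathcal M$) be a simple supersolvable matroid (resp. simple supersolvable oriented matroid) of rank $r$ on $E=\{1,\dots,n\}$, and let $(E_1,\dots,E_r)$ be an ordered set partition of $E$ such that whenever $j\neq k$ lie in the same block $E_q$, there exist $p<q$ and $i\in E_p$ with $\{i,j,k\}$ a circuit. Let $A=\mathrm{OS}(M)$ or $A=\mathrm{VG}(\mathcal M)$ (these are Koszul), with Koszul dual $A^!=\Bbbk\langle y_1,\dots,y_n\rangle/J$. Then there exists a monomial ordering $\prec$ on $\Bbbk\langle y_1,\dots,y_n\rangle$ such that: (i) for $A=\mathrm{OS}(M)$, the set $\{r(j,F): F \text{ a rank-two flat},\ j\in F\}$ is a Gröbner basis for $J$, and $\{r(j,i): (j,i)\text{ a retrograde pair}\}$ is a reduced Gröbner basis for $J$, the $\prec$-initial term of $r(j,i)$ being $y_jy_i$; (ii) for $A=\mathrm{VG}(\mathcal M)$, the set $\{r^\pm(j,F): F\text{ a rank-two flat},\ j\in F\}$ is a Gröbner basis for $J$, and $\{r^\pm(j,i): (j,i)\text{ a retrograde pair}\}$ is a reduced Gröbner basis for $J$, the $\prec$-initial term of $r^\pm(j,i)$ being $y_jy_i$; (iii) in both cases the initial ideal of $J$ is generated by $\{y_jy_i: (j,i)\text{ a retrograde pair}\}$; (iv) hence in both cases the standard monomials form a $\Bbbk$-basis of $A^!$ consisting of all products $m_1m_2\cdots m_r$ where each $m_p$ is any noncommutative monomial in the variables $\{y_j\}_{j\in E_p}$; (v) $\operatorname{Hilb}(\mathrm{OS}(M)^!,t)=\operatorname{Hilb}(\mathrm{VG}(\mathcal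 M)^!,t)=\dfrac{1}{(1-e_1t)(1-e_2t)\cdots(1-e_rt)}$ where $e_p=|E_p|$.
   Context: Matroids: a matroid on $E$ is given by its circuits; simple means no circuits of size $\le 2$; flats are subsets $F$ such that every circuit $C$ with $|C\cap F|=|C|-1$ lies in $F$; they form a lattice with rank $r$ and join $\vee$. A flat $F$ is modular if $r(F\vee F')+r(F\wedge F')=r(F)+r(F')$ for all flats $F'$; supersolvable means there is a complete flag of modular flats. An oriented matroid $\mathcal M$ on $E$ is given by signed circuits $(C_+,C_-)$ (disjoint pairs satisfying the signed circuit axioms); its underlying matroid has circuits $C_+\cup C_-$, and "simple", "supersolvable", "flat" refer to it. For a rank-two flat $F$, the restriction $\mathcal M|_F$ is a rank-two oriented matroid, realizable by vectors $v_k\in\mathbb R^2$ ($k\in F$); fix one of its two chirotopes $\chi_F:F\times F\to\{0,\pm1\}$, $\chi_F(j,k)=\mathrm{sign}\det(v_j,v_k)$ (determined up to a global sign). Algebras: $\mathrm{OS}(M)=\bigwedge(x_1,\dots,x_n)/I$ with $I$ generated by $\partial x_C=\sum_{j=1}^k(-1)^{j-1}x_{c_1}\wedge\cdots\widehat{x_{c_j}}\cdots\wedge x_{c_k}$ for circuits $C=\{c_1<\dots<c_k\}$. $\mathrm{VG}(\mathcal M)=\Bbbk[x_1,\dots,x_n]/I$ with $I$ generated by all $x_i^2$ and, for each circuit $C$ with a chosen signed circuit $(C_+,C_-)$, $\partial^\pm x_C=\sum_{c\in C}\epsilon_C(c)\prod_{c'\in C\setminus\{c\}}x_{c'}$, $\epsilon_C(c)=+1$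 if $c\in C_+$ and $-1$ if $c\in C_-$. Viewing either as a quadratic quotient $\Bbbk\langle x_1,\dots,x_n\rangle/I'$ of the free associative algebra, the Koszul dual is $A^!=\Bbbk\langle y_1,\dots,y_n\rangle/J$ with $J$ generated by $I_2'^\perp$ under the pairing $(y_iy_j,x_kx_\ell)=\delta_{ik}\delta_{j\ell}$. A monomial ordering on $\Bbbk\langle y\rangle$ is a well-ordering of noncommutative monomials compatible with two-sided multiplication. Relations: for a rank-two flat $F$ and $j\in F$, $r(j,F)=\sum_{k\in F\setminus\{j\}}(y_jy_k-y_ky_j)$ and $r^\pm(j,F)=\sum_{k\in F\setminus\{j\}}\chi_F(j,k)(y_jy_k+y_ky_j)$. A pair $(j,i)\in E^2$ is retrograde if $i\in E_p$, $j\in E_q$ with $p<q$; then with $F=\{j\}\vee\{i\}$: $r(j,i)=y_jy_i-y_iy_j+\sum_{k\in F\setminus\{i,j\}}(y_jy_k-y_ky_j)$ and $r^\pm(j,i)=y_jy_i+y_iy_j+\chi_F(j,i)\sum_{k\in F\setminus\{i,j\}}\chi_F(j,k)(y_jy_k+y_ky_j)$. *)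

theory Defs
  imports Main "HOL-Library.Function_Algebras" "HOL-Computational_Algebra.Formal_Power_Series"
begin

definition matroid :: "nat set \<Rightarrow> nat set set \<Rightarrow> bool" where
  "matroid E \<C> \<longleftrightarrow> finite E \<and> (\<forall>C\<in>\<C>. C \<subseteq> E) \<and> {} \<notin> \<C> \<and>
     (\<forall>C1\<in>\<C>. \<forall>C2\<in>\<C>. C1 \<subseteq> C2 \<longrightarrow> C1 = C2) \<and>
     (\<forall>C1\<in>\<C>. \<forall>C2\<in>\<C>. \<forall>e. C1 \<noteq> C2 \<and> e \<in> C1 \<inter> C2 \<longrightarrow> (\<exists>C3\<in>\<C>. C3 \<subseteq> (C1 \<union> C2) - {e}))"

definition simple_matroid :: "nat set set \<Rightarrow> bool" where
  "simple_matroid \<C> \<longleftrightarrow> (\<forall>C\<in>\<C>. \<not> card C \<le> 2)"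

definition indep :: "nat set set \<Rightarrow> nat set \<Rightarrow> bool" where
  "indep \<C> X \<longleftrightarrow> \<not> (\<exists>C\<in>\<C>. C \<subseteq> X)"

definition mrank :: "nat set set \<Rightarrow> nat set \<Rightarrow> nat" where
  "mrank \<C> X = Max (card ` {I. I \<subseteq> X \<and> indep \<C> I})"

definition flat :: "nat set \<Rightarrow> nat set set \<Rightarrow> nat set \<Rightarrow> bool" where
  "flat E \<C> F \<longleftrightarrow> F \<subseteq> E \<and> (\<forall>C\<in>\<C>. card (C \<inter> F) = card C - 1 \<longrightarrow> C \<subseteq> F)"

definition fjoin :: "nat set \<Rightarrow> nat set set \<Rightarrow> nat set \<Rightarrow> nat set \<Rightarrow> nat set" where
  "fjoin E \<C> F G = \<Inter> {X. flat E \<C> X \<and> F \<union> G \<subseteq> X}"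

definition modular_flat :: "nat set \<Rightarrow> nat set set \<Rightarrow> nat set \<Rightarrow> bool" where
  "modular_flat E \<C> F \<longleftrightarrow> flat E \<C> F \<and>
     (\<forall>F'. flat E \<C> F' \<longrightarrow>
        mrank \<C> (fjoin E \<C> F F') + mrank \<C> (F \<inter> F') = mrank \<C> F + mrank \<C> F')"

definition supersolvable :: "nat set \<Rightarrow> nat set set \<Rightarrow> bool" where
  "supersolvable E \<C> \<longleftrightarrow> (\<exists>X :: nat \<Rightarrow> nat set.
     (\<forall>p\<le>mrank \<C> E. modular_flat E \<C> (X p) \<and> mrank \<C> (X p) = p) \<and>
     (\<forall>p<mrank \<C> E. X p \<subset> X (Suc p)) \<and> X (mrank \<C> E) = E)"

definition oriented_matroid :: "nat set \<Rightarrow> (nat set \<times> nat set) set \<Rightarrow> bool" where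
  "oriented_matroid E \<O> \<longleftrightarrow> finite E \<and>
     (\<forall>(P,N)\<in>\<O>. P \<subseteq> E \<and> N \<subseteq> E \<and> P \<inter> N = {}) \<and>
     ({},{}) \<notin> \<O> \<and>
     (\<forall>(P,N)\<in>\<O>. (N,P) \<in> \<O>) \<and>
     (\<forall>(P,N)\<in>\<O>. \<forall>(P',N')\<in>\<O>. P \<union> N \<subseteq> P' \<union> N' \<longrightarrow> (P,N) = (P',N') \<or> (P,N) = (N',P')) \<and>
     (\<forall>(P,N)\<in>\<O>. \<forall>(P',N')\<in>\<O>. \<forall>e. (P,N) \<noteq> (N',P') \<and> e \<in> P \<inter> N' \<longrightarrow>
        (\<exists>(Q,R)\<in>\<O>. Q \<subseteq> (P \<union> P') - {e} \<and> R \<subseteq> (N \<union> N') - {e}))"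

definition underlying :: "(nat set \<times> nat set) set \<Rightarrow> nat set set" where
  "underlying \<O> = {P \<union> N | P N. (P,N) \<in> \<O>}"

definition restr_om :: "(nat set \<times> nat set) set \<Rightarrow> nat set \<Rightarrow> (nat set \<times> nat set) set" where
  "restr_om \<O> F = {(P,N). (P,N) \<in> \<O> \<and> P \<union> N \<subseteq> F}"

definition vec_dep :: "nat set \<Rightarrow> (nat \<Rightarrow> real \<times> real) \<Rightarrow> (nat \<Rightarrow> real) \<Rightarrow> bool" where
  "vec_dep F v l \<longleftrightarrow> (\<Sum>k\<in>F. l k * fst (v k)) = 0 \<and> (\<Sum>k\<in>F. l k * snd (v k)) = 0 \<and> (\<exists>k\<in>F. l k \<noteq> 0)"

definition vec_circuits :: "nat set \<Rightarrow> (nat \<Rightarrow> real \<times> real) \<Rightarrow> (nat set \<times> nat set) set" where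
  "vec_circuits F v = {({k\<in>F. l k > 0}, {k\<in>F. l k < 0}) | l. vec_dep F v l \<and>
      (\<forall>m. vec_dep F v m \<and> {k\<in>F. m k \<noteq> 0} \<subseteq> {k\<in>F. l k \<noteq> 0} \<longrightarrow>
            {k\<in>F. m k \<noteq> 0} = {k\<in>F. l k \<noteq> 0})}"

definition chirotope_of :: "(nat set \<times> nat set) set \<Rightarrow> nat set \<Rightarrow> (nat \<Rightarrow> nat \<Rightarrow> int) \<Rightarrow> bool" where
  "chirotope_of \<O> F chi \<longleftrightarrow> (\<exists>v. vec_circuits F v = restr_om \<O> F \<and>
     (\<forall>j\<in>F. \<forall>k\<in>F. real_of_int (chi j k) = sgn (fst (v j) * snd (v k) - snd (v j) * fst (v k))))"

definition ordered_partition :: "nat set \<Rightarrow> nat \<Rightarrow> (nat \<Rightarrow> nat set) \<Rightarrow> bool" where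
  "ordered_partition E r Eb \<longleftrightarrow> (\<forall>p\<in>{1..r}. Eb p \<noteq> {}) \<and>
     (\<forall>p\<in>{1..r}. \<forall>q\<in>{1..r}. p \<noteq> q \<longrightarrow> Eb p \<inter> Eb q = {}) \<and> (\<Union>p\<in>{1..r}. Eb p) = E"

definition good_partition :: "nat set set \<Rightarrow> nat \<Rightarrow> (nat \<Rightarrow> nat set) \<Rightarrow> bool" where
  "good_partition \<C> r Eb \<longleftrightarrow> (\<forall>q\<in>{1..r}. \<forall>j\<in>Eb q. \<forall>k\<in>Eb q. j \<noteq> k \<longrightarrow>
     (\<exists>p. 1 \<le> p \<and> p < q \<and> (\<exists>i\<in>Eb p. {i,j,k} \<in> \<C>)))"

definition retrograde :: "nat \<Rightarrow> (nat \<Rightarrow> nat set) \<Rightarrow> nat \<Rightarrow> nat \<Rightarrow> bool" where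
  "retrograde r Eb j i \<longleftrightarrow> (\<exists>p q. 1 \<le> p \<and> p < q \<and> q \<le> r \<and> i \<in> Eb p \<and> j \<in> Eb q)"

section \<open>Free associative algebra k<x_1..x_n>: finitely supported functions on words\<close>

type_synonym 'k ncpoly = "nat list \<Rightarrow> 'k"

definition ncp :: "nat set \<Rightarrow> ('k::zero) ncpoly \<Rightarrow> bool" where
  "ncp E f \<longleftrightarrow> finite {w. f w \<noteq> 0} \<and> (\<forall>w. f w \<noteq> 0 \<longrightarrow> set w \<subseteq> E)"

definition mono :: "nat list \<Rightarrow> ('k::{zero,one}) ncpoly" where
  "mono u = (\<lambda>w. if w = u then 1 else 0)"

definition smult :: "'k::times \<Rightarrow> 'k ncpoly \<Rightarrow> 'k ncpoly" where
  "smult c f = (\<lambda>w. c * f w)"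

definition ncmult :: "('k::comm_semiring_1) ncpoly \<Rightarrow> 'k ncpoly \<Rightarrow> 'k ncpoly" where
  "ncmult f g = (\<lambda>w. \<Sum>i\<le>length w. f (take i w) * g (drop i w))"

definition homog :: "nat \<Rightarrow> ('k::zero) ncpoly \<Rightarrow> bool" where
  "homog d f \<longleftrightarrow> (\<forall>w. f w \<noteq> 0 \<longrightarrow> length w = d)"

definition words :: "nat set \<Rightarrow> nat \<Rightarrow> nat list set" where
  "words E d = {w. set w \<subseteq> E \<and> length w = d}"

inductive_set ideal_gen :: "nat set \<Rightarrow> ('k::field) ncpoly set \<Rightarrow> 'k ncpoly set"
  for E :: "nat set" and G :: "'k ncpoly set" where
  zero: "0 \<in> ideal_gen E G"
| gen: "g \<in> G \<Longrightarrow> g \<in> ideal_gen E G"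
| add: "f \<in> ideal_gen E G \<Longrightarrow> h \<in> ideal_gen E G \<Longrightarrow> f + h \<in> ideal_gen E G"
| mult: "f \<in> ideal_gen E G \<Longrightarrow> ncp E a \<Longrightarrow> ncp E b \<Longrightarrow> ncmult (ncmult a f) b \<in> ideal_gen E G"

definition remove_nth :: "nat \<Rightarrow> 'a list \<Rightarrow> 'a list" where
  "remove_nth j xs = take j xs @ drop (Suc j) xs"

text \<open>lift of \<partial>x_C for C = {c_1 < ... < c_k}\<close>
definition os_bd :: "nat set \<Rightarrow> ('k::field) ncpoly" where
  "os_bd C = (\<Sum>j<card C. smult ((-1) ^ j) (mono (remove_nth j (sorted_list_of_set C))))"

definition OS_gens :: "nat set \<Rightarrow> nat set set \<Rightarrow> ('k::field) ncpoly set" where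
  "OS_gens E \<C> = {mono [i,j] + mono [j,i] | i j. i \<in> E \<and> j \<in> E} \<union> {mono [i,i] | i. i \<in> E}
     \<union> {os_bd C | C. C \<in> \<C>}"

text \<open>lift of \<partial>^\<pm> x_C for a signed circuit (P,N) = (C+,C-)\<close>
definition vg_bd :: "nat set \<Rightarrow> nat set \<Rightarrow> ('k::field) ncpoly" where
  "vg_bd P N = (\<Sum>c\<in>P \<union> N. smult (if c \<in> P then 1 else -1) (mono (sorted_list_of_set ((P \<union> N) - {c}))))"

text \<open>relations of VG(M): commutativity, squares, \<partial>^\<pm> x_C (both signings of each circuit,
  which generate the same ideal)\<close>
definition VG_gens :: "nat set \<Rightarrow> (nat set \<times> nat set) set \<Rightarrow> ('k::field) ncpoly set" where
  "VG_gens E \<O> = {mono [i,j] - mono [j,i] | i j. i \<in> E \<and> j \<in> E} \<union> {mono [i,i] | i. i \<in> E}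
     \<union> {vg_bd P N | P N. (P,N) \<in> \<O>}"

definition pairing :: "nat set \<Rightarrow> ('k::field) ncpoly \<Rightarrow> 'k ncpoly \<Rightarrow> 'k" where
  "pairing E g f = (\<Sum>w\<in>words E 2. g w * f w)"

text \<open>J = ideal generated by (I'_2)^perp, where I' is the defining ideal of A\<close>
definition koszul_dual_ideal :: "nat set \<Rightarrow> ('k::field) ncpoly set \<Rightarrow> 'k ncpoly set" where
  "koszul_dual_ideal E I = ideal_gen E {g. ncp E g \<and> homog 2 g \<and>
       (\<forall>f\<in>I. homog 2 f \<longrightarrow> pairing E g f = 0)}"

definition monomial_order :: "nat set \<Rightarrow> (nat list \<Rightarrow> nat list \<Rightarrow> bool) \<Rightarrow> bool" where
  "monomial_order E prec \<longleftrightarrow>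
     (\<forall>u\<in>lists E. \<not> prec u u) \<and>
     (\<forall>u\<in>lists E. \<forall>v\<in>lists E. \<forall>w\<in>lists E. prec u v \<longrightarrow> prec v w \<longrightarrow> prec u w) \<and>
     (\<forall>u\<in>lists E. \<forall>v\<in>lists E. u \<noteq> v \<longrightarrow> prec u v \<or> prec v u) \<and>
     wf {(u,v). u \<in> lists E \<and> v \<in> lists E \<and> prec u v} \<and>
     (\<forall>a\<in>lists E. \<forall>b\<in>lists E. \<forall>u\<in>lists E. \<forall>v\<in>lists E. prec u v \<longrightarrow> prec (a @ u @ b) (a @ v @ b))"

definition lm :: "(nat list \<Rightarrow> nat list \<Rightarrow> bool) \<Rightarrow> ('k::zero) ncpoly \<Rightarrow> nat list" where
  "lm prec f = (THE u. f u \<noteq> 0 \<and> (\<forall>v. f v \<noteq> 0 \<longrightarrow> v \<noteq> u \<longrightarrow> prec v u))"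

definition divides :: "nat list \<Rightarrow> nat list \<Rightarrow> bool" where
  "divides u w \<longleftrightarrow> (\<exists>a b. w = a @ u @ b)"

definition groebner_basis :: "(nat list \<Rightarrow> nat list \<Rightarrow> bool) \<Rightarrow> ('k::field) ncpoly set \<Rightarrow> 'k ncpoly set \<Rightarrow> bool" where
  "groebner_basis prec G J \<longleftrightarrow> G \<subseteq> J \<and>
     (\<forall>f\<in>J. f \<noteq> 0 \<longrightarrow> (\<exists>g\<in>G. g \<noteq> 0 \<and> divides (lm prec g) (lm prec f)))"

definition reduced_groebner_basis :: "(nat list \<Rightarrow> nat list \<Rightarrow> bool) \<Rightarrow> ('k::field) ncpoly set \<Rightarrow> 'k ncpoly set \<Rightarrow> bool" where
  "reduced_groebner_basis prec G J \<longleftrightarrow> groebner_basis prec G J \<and>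
     (\<forall>g\<in>G. g \<noteq> 0 \<and> g (lm prec g) = 1 \<and>
        (\<forall>g'\<in>G. g' \<noteq> g \<longrightarrow> (\<forall>w. g w \<noteq> 0 \<longrightarrow> \<not> divides (lm prec g') w)))"

definition initial_ideal :: "nat set \<Rightarrow> (nat list \<Rightarrow> nat list \<Rightarrow> bool) \<Rightarrow> ('k::field) ncpoly set \<Rightarrow> 'k ncpoly set" where
  "initial_ideal E prec J = ideal_gen E {mono (lm prec f) | f. f \<in> J \<and> f \<noteq> 0}"

definition standard_monomials :: "nat set \<Rightarrow> (nat list \<Rightarrow> nat list \<Rightarrow> bool) \<Rightarrow> ('k::field) ncpoly set \<Rightarrow> nat list set" where
  "standard_monomials E prec J = {w \<in> lists E. \<not> (\<exists>f\<in>J. f \<noteq> 0 \<and> divides (lm prec f) w)}"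

definition quotient_basis :: "nat set \<Rightarrow> ('k::field) ncpoly set \<Rightarrow> nat list set \<Rightarrow> bool" where
  "quotient_basis E J S \<longleftrightarrow>
     (\<forall>f. ncp E f \<longrightarrow> (\<exists>T c. T \<subseteq> S \<and> finite T \<and> f - (\<Sum>w\<in>T. smult (c w) (mono w)) \<in> J)) \<and>
     (\<forall>T c. T \<subseteq> S \<and> finite T \<and> (\<Sum>w\<in>T. smult (c w) (mono w)) \<in> J \<longrightarrow> (\<forall>w\<in>T. c w = 0))"

text \<open>dimension of the degree-d component of k<y>/J (J homogeneous)\<close>
definition hilb_coeff :: "nat set \<Rightarrow> ('k::field) ncpoly set \<Rightarrow> nat \<Rightarrow> nat" where
  "hilb_coeff E J d =
     vector_space.dim (smult :: 'k \<Rightarrow> 'k ncpoly \<Rightarrow> 'k ncpoly) {f. ncp E f \<and> homog d f}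
   - vector_space.dim (smult :: 'k \<Rightarrow> 'k ncpoly \<Rightarrow> 'k ncpoly) {f \<in> J. ncp E f \<and> homog d f}"

definition hilb_series :: "nat set \<Rightarrow> ('k::field) ncpoly set \<Rightarrow> rat fps" where
  "hilb_series E J = Abs_fps (\<lambda>d. of_nat (hilb_coeff E J d))"

definition rF :: "nat \<Rightarrow> nat set \<Rightarrow> ('k::field) ncpoly" where
  "rF j F = (\<Sum>k\<in>F - {j}. mono [j,k] - mono [k,j])"

definition rpmF :: "(nat \<Rightarrow> nat \<Rightarrow> int) \<Rightarrow> nat \<Rightarrow> nat set \<Rightarrow> ('k::field) ncpoly" where
  "rpmF chi j F = (\<Sum>k\<in>F - {j}. smult (of_int (chi j k)) (mono [j,k] + mono [k,j]))"

definition r_retro :: "nat set \<Rightarrow> nat set set \<Rightarrow> nat \<Rightarrow> nat \<Rightarrow> ('k::field) ncpoly" where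
  "r_retro E \<C> j i = (let F = fjoin E \<C> {j} {i} in
     mono [j,i] - mono [i,j] + (\<Sum>k\<in>F - {i,j}. mono [j,k] - mono [k,j]))"

definition rpm_retro :: "nat set \<Rightarrow> nat set set \<Rightarrow> (nat set \<Rightarrow> nat \<Rightarrow> nat \<Rightarrow> int) \<Rightarrow> nat \<Rightarrow> nat \<Rightarrow> ('k::field) ncpoly" where
  "rpm_retro E \<C> chi j i = (let F = fjoin E \<C> {j} {i} in
     mono [j,i] + mono [i,j] + smult (of_int (chi F j i))
       (\<Sum>k\<in>F - {i,j}. smult (of_int (chi F j k)) (mono [j,k] + mono [k,j])))"

definition block_products :: "nat \<Rightarrow> (nat \<Rightarrow> nat set) \<Rightarrow> nat list set" where
  "block_products r Eb = {concat ms | ms. length ms = r \<and> (\<forall>p<r. ms ! p \<in> lists (Eb (Suc p)))}"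

end

theory Submission
  imports Defs
begin

text \<open>The relations spanning the quadratic dual live on the lines (rank-two flats): on a line F a
  relation is a twisted commutator whose coefficients form a coboundary on F.  Every line has exactly one
  point i in a lower block and all its other points in one higher block, so the relation attached to a
  retrograde pair (j,i) moves i to the left of j at the cost of a quadratic expression in the block of j.
  Rewriting with these relations reduces every word to sorted words.

  Linear independence of the sorted words, which replaces the Koszulness of A and all overlap computations,
  comes from an explicit module: the letters of lower blocks act on the words of a higher block by twisted
  derivations, and the relations hold on the module as soon as they hold for these derivations on a single
  letter.  There the combination belonging to a line F and a point j of F acts on each class of points
  collinear with j as an inner derivation by an element killed by the derivation of j, whence the required
  commutation.  In the oriented case the signs needed for this come from the Menelaus configuration of six
  points on four lines, whose signed circuits are determined up to reorientation.\<close>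

section \<open>Matroids with a good block partition\<close>

text \<open>That a line has only one low point is a matter of counting: \<open>good\<close> lets a
  block raise the rank by at most one, and there are exactly \<open>r\<close> blocks, so each raises
  it by exactly one and no circuit has a single element in its highest block. The derivations of the
  module are forced. Solving the relation of (j,i) for the word ji gives s times ij plus terms with
  coefficients -(c j i)(c j k) in the brackets jk - s kj, and these are the values of the derivation
  of i on the letter j. The obstacle is that derivations of letters on one line F must satisfy the
  relations of F. On a letter l this is an identity between words of length three in the block of l;
  term by term it concerns a triangle of points in that block whose sides meet the lower flat in
  three points of F. Signs enter only through the products c, and \<open>menelaus\<close> is exactly
  what they have to satisfy. The action lengthens words, so functionals on all words take the place
  of finite combinations. The coefficient of a sorted word is recovered by letting an element of J
  act on the empty word.\<close>

lemma matroid_elim: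
  assumes "matroid E \<C>" "C1 \<in> \<C>" "C2 \<in> \<C>" "C1 \<noteq> C2" "e \<in> C1" "e \<in> C2"
  shows "\<exists>C3\<in>\<C>. C3 \<subseteq> C1 \<union> C2 - {e}"
  using assms(1) unfolding matroid_def using assms(2-) by (metis IntI)

lemma matroid_finite: "matroid E \<C> \<Longrightarrow> finite E"
  and matroid_circuit_subset: "matroid E \<C> \<Longrightarrow> C \<in> \<C> \<Longrightarrow> C \<subseteq> E"
  and matroid_incomparable: "matroid E \<C> \<Longrightarrow> C \<in> \<C> \<Longrightarrow> C' \<in> \<C> \<Longrightarrow> C \<subseteq> C' \<Longrightarrow> C = C'"
  and matroid_indep_empty: "matroid E \<C> \<Longrightarrow> indep \<C> {}"
  unfolding matroid_def indep_def by auto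

lemma indep_subset: "indep \<C> X \<Longrightarrow> Y \<subseteq> X \<Longrightarrow> indep \<C> Y"
  unfolding indep_def by blast

lemma indepD: "indep \<C> X \<Longrightarrow> C \<in> \<C> \<Longrightarrow> \<not> C \<subseteq> X"
  unfolding indep_def by blast

lemma not_indepD: "\<not> indep \<C> X \<Longrightarrow> \<exists>C\<in>\<C>. C \<subseteq> X"
  unfolding indep_def by blast

text \<open>Among the independent sets in I1 \<union> I2 larger than I1, one that misses as few
  elements of I1 as possible must contain I1: otherwise two circuits through a missing element e
  combine to a circuit avoiding e, inside the independent set.\<close>

lemma matroid_augment:
  assumes M: "matroid E \<C>" and I1: "indep \<C> I1" and I2: "indep \<C> I2"
    and sub: "I1 \<subseteq> E" "I2 \<subseteq> E" and lt: "card I1 < card I2"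
  shows "\<exists>e\<in>I2 - I1. indep \<C> (insert e I1)"
proof -
  have fin: "finite E" using matroid_finite[OF M]  .
  have finI: "finite I1" "finite I2" using fin sub finite_subset by blast+
  let ?P = "\<lambda>I. indep \<C> I \<and> I \<subseteq> I1 \<union> I2 \<and> card I1 < card I"
  have "?P I2" using I2 lt by blast
  then have "\<exists>I. ?P I \<and> (\<forall>J. ?P J \<longrightarrow> card (I1 - I) \<le> card (I1 - J))"
    by (rule ex_has_least_nat)
  then obtain I3 where I3: "?P I3" and min: "\<forall>J. ?P J \<longrightarrow> card (I1 - I3) \<le> card (I1 - J)"
    by (elim exE conjE) blast
  have finI3: "finite I3" using I3 finI finite_subset by blast
  have "I1 \<subseteq> I3"
  proof (rule ccontr)
    assume "\<not> I1 \<subseteq> I3"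
    then obtain e where e: "e \<in> I1" "e \<notin> I3" by blast
    \<comment> \<open>Swapping f for e keeps the size and misses fewer elements of I1, so minimality
      makes the swapped set dependent.\<close>
    have circ: "\<exists>C\<in>\<C>. C \<subseteq> insert e I3 - {f} \<and> e \<in> C" if f: "f \<in> I3 - I1" for f
    proof -
      let ?T = "insert e I3 - {f}"
      have "card ?T = card I3" using f e finI3 by (simp add: card_insert_if)
      moreover have "?T \<subseteq> I1 \<union> I2" using I3 e by blast
      moreover have "card (I1 - ?T) < card (I1 - I3)"
        using e f by (intro psubset_card_mono[OF finite_Diff[OF finI(1)]]) blast
      ultimately have "\<not> indep \<C> ?T" using min[rule_format, of ?T] I3 by linarith
      then obtain C where "C \<in> \<C>" "C \<subseteq> ?T" unfolding indep_def by blast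
      moreover have "e \<in> C"
      proof (rule ccontr)
        assume "e \<notin> C"
        then have "C \<subseteq> I3" using \<open>C \<subseteq> ?T\<close> by blast
        then show False using I3 \<open>C \<in> \<C>\<close> unfolding indep_def by blast
      qed
      ultimately show ?thesis by blast
    qed
    have "\<not> I3 \<subseteq> I1" using I3 finI card_mono[of I1 I3] by auto
    then obtain g where g: "g \<in> I3 - I1" by blast
    obtain Cg where Cg: "Cg \<in> \<C>" "Cg \<subseteq> insert e I3 - {g}" "e \<in> Cg" using circ[OF g] by blast
    have "\<not> Cg \<subseteq> I1" using Cg I1 unfolding indep_def by blast
    then obtain h where h: "h \<in> Cg" "h \<in> I3 - I1" using Cg e by blast
    obtain Ch where Ch: "Ch \<in> \<C>" "Ch \<subseteq> insert e I3 - {h}" "e \<in> Ch" using circ[OF h(2)] by blast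
    have "Cg \<noteq> Ch" using h Ch by blast
    then obtain C where "C \<in> \<C>" "C \<subseteq> Cg \<union> Ch - {e}"
      using matroid_elim[OF M Cg(1) Ch(1)] Cg Ch by blast
    moreover have "Cg \<union> Ch - {e} \<subseteq> I3" using Cg Ch by blast
    ultimately show False using I3 unfolding indep_def by blast
  qed
  moreover have "I1 \<noteq> I3" using I3 by auto
  ultimately obtain x where x: "x \<in> I3" "x \<notin> I1" by blast
  have "x \<in> I2 - I1" using x I3 by blast
  moreover have "indep \<C> (insert x I1)" using indep_subset[of \<C> I3] I3 \<open>I1 \<subseteq> I3\<close> x by blast
  ultimately show ?thesis by blast
qed

lemma maximal_indep_extension:
  assumes "finite X" "indep \<C> B0" "B0 \<subseteq> X"
  shows "\<exists>B. B0 \<subseteq> B \<and> B \<subseteq> X \<and> indep \<C> B \<and> (\<forall>x\<in>X - B. \<not> indep \<C> (insert x B))"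
proof -
  define S where "S = {B. B0 \<subseteq> B \<and> B \<subseteq> X \<and> indep \<C> B}"
  have "S \<subseteq> Pow X" unfolding S_def by auto
  then have fin: "finite S" using assms(1) finite_subset by auto
  have ne: "S \<noteq> {}" using assms unfolding S_def by auto
  have "Max (card ` S) \<in> card ` S" using fin ne by (intro Max_in) auto
  then obtain B where B: "B \<in> S" "card B = Max (card ` S)" by force
  have "\<not> indep \<C> (insert x B)" if x: "x \<in> X - B" for x
  proof
    assume "indep \<C> (insert x B)"
    then have "insert x B \<in> S" using B(1) x unfolding S_def by auto
    then have "card (insert x B) \<le> card B" unfolding B(2) using fin by simp
    moreover have "finite B" using B(1) assms(1) unfolding S_def by (auto intro: finite_subset)
    ultimately show False using x by simp
  qed
  then show ?thesis using B(1) unfolding S_def by auto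
qed

section \<open>Collinear triples and block indices\<close>

locale blocked_matroid =
  fixes E :: "nat set" and \<C> :: "nat set set" and r :: nat and Eb :: "nat \<Rightarrow> nat set"
  assumes matroid: "matroid E \<C>" and simple: "simple_matroid \<C>" and rank: "mrank \<C> E = r"
    and partition: "ordered_partition E r Eb" and good: "good_partition \<C> r Eb"
begin

lemma finite_E: "finite E" using matroid_finite[OF matroid] .

lemma card_circuit: "C \<in> \<C> \<Longrightarrow> 3 \<le> card C"
  using simple unfolding simple_matroid_def by fastforce

lemma finite_circuit: "C \<in> \<C> \<Longrightarrow> finite C"
  using matroid_circuit_subset[OF matroid] finite_E finite_subset by blast

lemma no_small_circuit: "C \<in> \<C> \<Longrightarrow> C \<subseteq> {a, b} \<Longrightarrow> False"
  using card_circuit[of C] card_mono[of "{a,b}" C] by (simp add: card_insert_if split: if_splits)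

lemma tri_distinct:
  assumes "{a,b,c} \<in> \<C>" shows "a \<noteq> b" "a \<noteq> c" "b \<noteq> c"
  using no_small_circuit[OF assms] by blast+

lemma tri_in_E:
  assumes "{a,b,c} \<in> \<C>" shows "a \<in> E" "b \<in> E" "c \<in> E"
  using matroid_circuit_subset[OF matroid assms] by blast+

lemma circuit_eq_tri:
  assumes "C \<in> \<C>" "C \<subseteq> {a,b,c}" shows "C = {a,b,c}"
proof (rule card_subset_eq)
  have "card {a,b,c} \<le> 3" by (simp add: card_insert_if)
  then show "card C = card {a,b,c}"
    using card_circuit[OF assms(1)] card_mono[of "{a,b,c}" C] assms by simp
qed (use assms in auto)

lemma tri_trans:
  assumes "{a,b,c} \<in> \<C>" "{a,b,d} \<in> \<C>" "c \<noteq> d" shows "{a,c,d} \<in> \<C>"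
proof -
  have "{a,b,c} \<noteq> {a,b,d}" using assms(3) tri_distinct[OF assms(1)] by auto
  then obtain C where "C \<in> \<C>" "C \<subseteq> {a,b,c} \<union> {a,b,d} - {b}"
    using matroid_elim[OF matroid assms(1,2), of b] by blast
  then show ?thesis using circuit_eq_tri[of C a c d] tri_distinct[OF assms(1)] by blast
qed

text \<open>The value 0 outside E keeps \<open>blk a\<close> at most r for every letter, so later
  case distinctions on blocks make sense for arbitrary words.\<close>

definition blk :: "nat \<Rightarrow> nat" where
  "blk a = (if a \<in> E then (THE p. p \<in> {1..r} \<and> a \<in> Eb p) else 0)"

lemma blk_eq:
  assumes "p \<in> {1..r}" "a \<in> Eb p" shows "blk a = p"
proof -
  have "a \<in> E" using assms partition unfolding ordered_partition_def by blast
  moreover have "(THE p. p \<in> {1..r} \<and> a \<in> Eb p) = p"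
    using assms partition unfolding ordered_partition_def by blast
  ultimately show ?thesis unfolding blk_def by simp
qed

lemma blk_props:
  assumes "a \<in> E" shows "1 \<le> blk a" "blk a \<le> r" "a \<in> Eb (blk a)"
proof -
  obtain p where "p \<in> {1..r}" "a \<in> Eb p"
    using assms partition unfolding ordered_partition_def by blast
  then show "1 \<le> blk a" "blk a \<le> r" "a \<in> Eb (blk a)" using blk_eq by auto
qed

lemma Eb_iff: "p \<in> {1..r} \<Longrightarrow> a \<in> Eb p \<longleftrightarrow> a \<in> E \<and> blk a = p"
  using blk_eq blk_props partition unfolding ordered_partition_def by blast

lemma blk_le_r: "blk a \<le> r"
  using blk_props[of a] unfolding blk_def by (cases "a \<in> E") auto

lemma retrograde_iff: "retrograde r Eb j i \<longleftrightarrow> i \<in> E \<and> j \<in> E \<and> blk i < blk j"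
proof
  assume "retrograde r Eb j i"
  then obtain p q where "1 \<le> p" "p < q" "q \<le> r" "i \<in> Eb p" "j \<in> Eb q"
    unfolding retrograde_def by blast
  then show "i \<in> E \<and> j \<in> E \<and> blk i < blk j" using Eb_iff[of p i] Eb_iff[of q j] by auto
next
  assume "i \<in> E \<and> j \<in> E \<and> blk i < blk j"
  then show "retrograde r Eb j i"
    unfolding retrograde_def using blk_props[of i] blk_props[of j] by blast
qed

lemma tri_meet:
  assumes "j \<in> E" "k \<in> E" "j \<noteq> k" "blk j = blk k"
  shows "\<exists>i\<in>E. blk i < blk j \<and> {i,j,k} \<in> \<C>"
proof -
  obtain p i where "1 \<le> p" "p < blk j" "i \<in> Eb p" "{i,j,k} \<in> \<C>"
    using good blk_props[OF assms(1)] blk_props[OF assms(2)] assms unfolding good_partition_def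
    by (metis atLeastAtMost_iff)
  moreover have "blk j \<le> r" by (rule blk_le_r)
  ultimately show ?thesis using blk_eq[of p i] tri_in_E[of i j k] by auto
qed

section \<open>Rank of the unions of initial blocks\<close>

definition ini :: "nat \<Rightarrow> nat set" where "ini q = {a\<in>E. blk a \<le> q}"

text \<open>One block adds at most one to the rank. Two new points j, k independent over a basis B
  of the lower blocks have a low point i on their line, and i depends on B; eliminating i from the
  two circuits leaves a circuit inside B together with j and k.\<close>

lemma card_indep_step:
  assumes le: "\<And>I. I \<subseteq> ini q \<Longrightarrow> indep \<C> I \<Longrightarrow> card I \<le> p"
    and I: "I \<subseteq> ini (Suc q)" "indep \<C> I"
  shows "card I \<le> Suc p"
proof (rule ccontr)
  assume gt: "\<not> card I \<le> Suc p"
  have sE: "ini t \<subseteq> E" for t unfolding ini_def by blast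
  have finX: "finite (ini q)" using sE finite_E finite_subset by blast
  have "indep \<C> {}" by (rule matroid_indep_empty[OF matroid])
  then obtain B where B: "B \<subseteq> ini q" "indep \<C> B"
      "\<And>x. x \<in> ini q \<Longrightarrow> x \<notin> B \<Longrightarrow> \<not> indep \<C> (insert x B)"
    using maximal_indep_extension[OF finX, of \<C> "{}"] by auto
  have finB: "finite B" using B finX finite_subset by blast
  have cB: "card B \<le> p" using le B by blast
  have BE: "B \<subseteq> E" "I \<subseteq> E" using B I sE by blast+
  obtain j where j: "j \<in> I - B" "indep \<C> (insert j B)"
    using matroid_augment[OF matroid B(2) I(2) BE] cB gt by auto
  have "card (insert j B) < card I" using cB gt j finB by auto
  then obtain k where k: "k \<in> I - insert j B" "indep \<C> (insert k (insert j B))"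
    using matroid_augment[OF matroid j(2) I(2)] BE j by auto
  have "indep \<C> (insert k B)" using k indep_subset by blast
  then have "j \<notin> ini q" "k \<notin> ini q" using B(3) j k by blast+
  then have "blk j = Suc q" "blk k = Suc q" "j \<in> E" "k \<in> E"
    using j k I unfolding ini_def by fastforce+
  then obtain i where i: "i \<in> E" "blk i < Suc q" "{i,j,k} \<in> \<C>"
    using tri_meet[of j k] k by auto
  have iX: "i \<in> ini q" using i unfolding ini_def by simp
  have "i \<notin> B" using indepD[OF k(2) i(3)] by auto
  then obtain D where D: "D \<in> \<C>" "D \<subseteq> insert i B" using B(3)[OF iX] not_indepD by blast
  have iD: "i \<in> D" using D indepD[OF B(2) D(1)] by blast
  have "D \<noteq> {i,j,k}" using D j \<open>j \<notin> ini q\<close> iX by blast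
  then obtain C where "C \<in> \<C>" "C \<subseteq> D \<union> {i,j,k} - {i}"
    using matroid_elim[OF matroid D(1) i(3)] iD by blast
  then show False using D indepD[OF k(2), of C] by blast
qed

lemma card_indep_le: "I \<subseteq> ini q \<Longrightarrow> indep \<C> I \<Longrightarrow> card I \<le> q"
proof (induction q arbitrary: I)
  case 0
  have "ini 0 = {}" unfolding ini_def using blk_props by fastforce
  then show ?case using 0 by simp
next
  case (Suc q)
  then show ?case using card_indep_step[of q q I] by blast
qed

text \<open>A rank deficit at one initial union is never made up, because each later block
  contributes at most one.\<close>

lemma card_indep_le_drop:
  assumes "\<And>I. I \<subseteq> ini t \<Longrightarrow> indep \<C> I \<Longrightarrow> card I < t"
  shows "I \<subseteq> ini (t + d) \<Longrightarrow> indep \<C> I \<Longrightarrow> card I < t + d"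
proof (induction d arbitrary: I)
  case 0 then show ?case using assms by simp
next
  case (Suc d)
  have "0 < t" using assms[of "{}"] matroid_indep_empty[OF matroid] by simp
  have "card I \<le> Suc (t + d - 1)"
  proof (rule card_indep_step)
    show "card I' \<le> t + d - 1" if "I' \<subseteq> ini (t + d)" "indep \<C> I'" for I'
      using Suc.IH[OF that] by simp
  qed (use Suc.prems in auto)
  then show ?case using \<open>0 < t\<close> by simp
qed

text \<open>The rank hypothesis says that every block raises the rank, hence the unions of initial blocks
  are flats.\<close>

lemma no_lone_top:
  assumes C: "C \<in> \<C>" "c \<in> C" and low: "\<And>x. x \<in> C \<Longrightarrow> x \<noteq> c \<Longrightarrow> blk x < blk c"
  shows False
proof -
  define t where "t = blk c"
  have cE: "c \<in> E" and CE: "C \<subseteq> E" using C matroid_circuit_subset[OF matroid] by blast+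
  have t: "1 \<le> t" "t \<le> r" using blk_props[OF cE] t_def by auto
  have sE: "ini t \<subseteq> E" for t unfolding ini_def by blast
  have finX: "finite (ini t)" for t using sE finite_E finite_subset by blast
  let ?Y = "ini (t - 1)"
  have CY: "C - {c} \<subseteq> ?Y" using low CE t unfolding ini_def t_def by fastforce
  have "indep \<C> (C - {c})"
    unfolding indep_def using C matroid_incomparable[OF matroid _ C(1)] by blast
  then obtain B where B: "C - {c} \<subseteq> B" "B \<subseteq> ?Y" "indep \<C> B"
      "\<And>x. x \<in> ?Y \<Longrightarrow> x \<notin> B \<Longrightarrow> \<not> indep \<C> (insert x B)"
    using maximal_indep_extension[OF finX _ CY, of \<C>] by auto
  have cB: "card B \<le> t - 1" using card_indep_le B by blast
  \<comment> \<open>B is a basis of the lower blocks and C puts c into its span, so adding c does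
    not raise the rank.\<close>
  have le1: "card I \<le> card B" if I: "I \<subseteq> insert c ?Y" "indep \<C> I" for I
  proof (rule ccontr)
    assume "\<not> card I \<le> card B"
    then obtain e where e: "e \<in> I - B" "indep \<C> (insert e B)"
      using matroid_augment[OF matroid B(3) I(2)] B(2) I(1) sE cE
      by (meson insert_subset not_le subset_trans)
    then have "e = c" using B(4) I(1) by blast
    then show False using B(1) indepD[OF e(2) C(1)] by blast
  qed
  \<comment> \<open>The remaining points of the block are spanned as well: the line through such a
    point j and c contains a low point i. So block t does not raise the rank.\<close>
  have "card I < t" if I: "I \<subseteq> ini t" "indep \<C> I" for I
  proof (rule ccontr)
    assume gt: "\<not> card I < t"
    have "indep \<C> {c}" using no_small_circuit[of _ c c] unfolding indep_def by auto
    then obtain B' where B': "{c} \<subseteq> B'" "B' \<subseteq> insert c ?Y" "indep \<C> B'"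
        "\<And>x. x \<in> insert c ?Y \<Longrightarrow> x \<notin> B' \<Longrightarrow> \<not> indep \<C> (insert x B')"
      using maximal_indep_extension[of "insert c ?Y" \<C> "{c}"] finX by auto
    have "card B' < card I" using le1[OF B'(2,3)] cB gt t by linarith
    then obtain j where j: "j \<in> I - B'" "indep \<C> (insert j B')"
      using matroid_augment[OF matroid B'(3) I(2)] B'(2) I(1) sE cE
      by (meson insert_subset subset_trans)
    then have "j \<notin> insert c ?Y" using B'(4) by blast
    then have jj: "blk j = blk c" "j \<in> E" "j \<noteq> c" using j I t unfolding ini_def t_def by fastforce+
    then obtain i where i: "i \<in> E" "blk i < blk j" "{i,j,c} \<in> \<C>" using tri_meet[of j c] cE by auto
    have iY: "i \<in> ?Y" using i jj unfolding ini_def t_def by simp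
    have "i \<notin> B'" using indepD[OF j(2) i(3)] B'(1) by auto
    then obtain D where D: "D \<in> \<C>" "D \<subseteq> insert i B'" using B'(4)[of i] iY not_indepD by blast
    have iD: "i \<in> D" using D indepD[OF B'(3) D(1)] by blast
    have "j \<noteq> i" using i by blast
    then have "D \<noteq> {i,j,c}" using D j by blast
    then obtain C' where "C' \<in> \<C>" "C' \<subseteq> D \<union> {i,j,c} - {i}"
      using matroid_elim[OF matroid D(1) i(3)] iD by blast
    then show False using D B'(1) indepD[OF j(2), of C'] by blast
  qed
  \<comment> \<open>The deficit persists up to the last block and contradicts the rank of E.\<close>
  then have small: "card I < r" if "I \<subseteq> ini r" "indep \<C> I" for I
    using card_indep_le_drop[of t I "r - t"] that t by simp
  have ini_r: "ini r = E" unfolding ini_def using blk_le_r by auto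
  have "r \<in> card ` {I. I \<subseteq> E \<and> indep \<C> I}"
  proof -
    have "indep \<C> {}" by (rule matroid_indep_empty[OF matroid])
    then have "card ` {I. I \<subseteq> E \<and> indep \<C> I} \<noteq> {}" by blast
    moreover have "finite {I. I \<subseteq> E \<and> indep \<C> I}" using finite_E by simp
    ultimately show ?thesis using rank Max_in[of "card ` {I. I \<subseteq> E \<and> indep \<C> I}"]
      unfolding mrank_def by simp
  qed
  then obtain I where "I \<subseteq> E" "indep \<C> I" "r = card I" by auto
  then show False using small[of I] ini_r by simp
qed

lemma tri_top:
  assumes "{i,j,k} \<in> \<C>" "blk i < blk j" shows "blk k = blk j"
proof (rule ccontr)
  assume "blk k \<noteq> blk j"
  then consider "blk k < blk j" | "blk j < blk k" by linarith
  then show False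
  proof cases
    case 1 then show False by (intro no_lone_top[OF assms(1), of j]) (use assms(2) in auto)
  next
    case 2 then show False by (intro no_lone_top[OF assms(1), of k]) (use assms(2) in auto)
  qed
qed

text \<open>Two low points on one line would leave j as the only top element of the circuit
  {j,i,i'}.\<close>

lemma tri_meet_unique:
  assumes "{i,j,k} \<in> \<C>" "{i',j,k} \<in> \<C>" "blk i < blk j" "blk i' < blk j"
  shows "i = i'"
proof (rule ccontr)
  assume "i \<noteq> i'"
  then have "{j,i,i'} \<in> \<C>" using tri_trans[of j k i i'] assms by (simp add: insert_commute)
  then show False by (rule no_lone_top[of _ j]) (use assms in auto)
qed

text \<open>The low points lie in a flat avoiding m, and the sides of the triangle l, l', m meet it
  in collinear points. Eliminating l and then l' leaves a circuit in {j,k,k',m}, from which m drops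
  out because it would be alone on top.\<close>

lemma pasch:
  assumes t: "{j,l,l'} \<in> \<C>" "{k,l,m} \<in> \<C>" "{k',l',m} \<in> \<C>"
    and d: "j \<noteq> k" "j \<noteq> k'" "k \<noteq> k'"
    and b: "blk j < blk m" "blk k < blk m" "blk k' < blk m"
    and lm: "l \<noteq> k'" "l' \<noteq> k"
  shows "{j,k,k'} \<in> \<C>"
proof -
  have "{j,l,l'} \<noteq> {k,l,m}" using d(1) t(2) b tri_distinct[OF t(1)] lm by blast
  then obtain C3 where C3: "C3 \<in> \<C>" "C3 \<subseteq> {j,l,l'} \<union> {k,l,m} - {l}"
    using matroid_elim[OF matroid t(1,2), of l] by blast
  have "l' \<in> C3"
  proof (rule ccontr)
    assume "l' \<notin> C3"
    then have sub: "C3 \<subseteq> {j,k,m}" using C3 by blast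
    then have "C3 = {j,k,m}" by (rule circuit_eq_tri[OF C3(1)])
    then show False using no_lone_top[OF C3(1), of m] b by auto
  qed
  moreover have "C3 \<noteq> {k',l',m}" using C3 d tri_distinct[OF t(3)] lm by blast
  ultimately obtain C4 where C4: "C4 \<in> \<C>" "C4 \<subseteq> C3 \<union> {k',l',m} - {l'}"
    using matroid_elim[OF matroid C3(1) t(3), of l'] by blast
  have sub4: "C4 \<subseteq> {j,k,k',m}" using C4 C3 by blast
  have "m \<notin> C4"
  proof
    assume "m \<in> C4"
    then show False using no_lone_top[OF C4(1), of m] sub4 b by blast
  qed
  then have "C4 \<subseteq> {j,k,k'}" using sub4 by blast
  then show ?thesis using circuit_eq_tri[OF C4(1), of j k k'] C4(1) by simp
qed

section \<open>Lines as rank-two flats and as joins of points\<close>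

definition line :: "nat \<Rightarrow> nat \<Rightarrow> nat set" where
  "line a b = {a,b} \<union> {k. {a,b,k} \<in> \<C>}"

lemma line_commute: "line a b = line b a"
  unfolding line_def by (simp add: insert_commute)

lemma line_subset: "a \<in> E \<Longrightarrow> b \<in> E \<Longrightarrow> line a b \<subseteq> E"
  unfolding line_def using tri_in_E by blast

lemma line_tri:
  assumes "x \<in> line a b" "y \<in> line a b" "z \<in> line a b" "x \<noteq> y" "x \<noteq> z" "y \<noteq> z" "a \<noteq> b"
  shows "{x,y,z} \<in> \<C>"
proof -
  have through: "{a,x,y} \<in> \<C>" if "x \<in> line a b" "y \<in> line a b" "x \<noteq> y" "x \<noteq> a" "y \<noteq> a" for x y
    using that tri_trans[of a b x y] unfolding line_def by (auto simp: insert_commute)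
  consider "x = a" | "y = a" | "z = a" | "x \<noteq> a" "y \<noteq> a" "z \<noteq> a" by blast
  then show ?thesis
  proof cases
    case 1 then show ?thesis using through[of y z] assms by auto
  next
    case 2 then show ?thesis using through[of x z] assms by (auto simp: insert_commute)
  next
    case 3 then show ?thesis using through[of x y] assms by (auto simp: insert_commute)
  next
    case 4
    have "{x,a,y} \<in> \<C>" "{x,a,z} \<in> \<C>"
      using through[of x y] through[of x z] 4 assms by (auto simp: insert_commute)
    then show ?thesis using tri_trans assms by blast
  qed
qed

lemma line_eq:
  assumes "x \<in> line a b" "y \<in> line a b" "x \<noteq> y" "a \<noteq> b" shows "line x y = line a b"
proof
  show "line a b \<subseteq> line x y"
    using line_tri[OF assms(1,2)] assms unfolding line_def[of x y] by blast
  then have "a \<in> line x y" "b \<in> line x y" unfolding line_def[of a b] by blast+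
  then show "line x y \<subseteq> line a b"
    using line_tri[of a x y b] assms unfolding line_def[of a b] by blast
qed

lemma finite_card_image_indep: "F \<subseteq> E \<Longrightarrow> finite (card ` {I. I \<subseteq> F \<and> indep \<C> I})"
  using finite_subset[OF _ finite_E] by simp

lemma rank_two_flat_eq_line:
  assumes F: "flat E \<C> F" "mrank \<C> F = 2" and ab: "a \<in> F" "b \<in> F" "a \<noteq> b"
  shows "F = line a b"
proof
  have FE: "F \<subseteq> E" using F unfolding flat_def by blast
  show "F \<subseteq> line a b"
  proof
    fix k assume k: "k \<in> F"
    show "k \<in> line a b"
    proof (rule ccontr)
      assume n: "k \<notin> line a b"
      then have "k \<noteq> a" "k \<noteq> b" "{a,b,k} \<notin> \<C>" unfolding line_def by auto
      then have "indep \<C> {a,b,k}" unfolding indep_def using circuit_eq_tri by metis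
      then have "card {a,b,k} \<in> card ` {I. I \<subseteq> F \<and> indep \<C> I}" using k ab by blast
      then have "card {a,b,k} \<le> 2"
        using F(2) Max_ge[OF finite_card_image_indep[OF FE]] unfolding mrank_def by metis
      then show False using ab \<open>k \<noteq> a\<close> \<open>k \<noteq> b\<close> by simp
    qed
  qed
  show "line a b \<subseteq> F"
  proof
    fix k assume k: "k \<in> line a b"
    show "k \<in> F"
    proof (rule ccontr)
      assume n: "k \<notin> F"
      then have c: "{a,b,k} \<in> \<C>" using k ab unfolding line_def by auto
      have "{a,b,k} \<inter> F = {a,b}" using ab n by blast
      then have "card ({a,b,k} \<inter> F) = card {a,b,k} - 1" using tri_distinct[OF c] by simp
      then have "{a,b,k} \<subseteq> F" using F(1) c unfolding flat_def by blast
      then show False using n by blast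
    qed
  qed
qed

text \<open>A circuit with all but one element on the line has at least two points there. A third
  would give a collinear triple inside the circuit, so the circuit has three elements and lies on
  the line through two of them.\<close>

lemma flat_line:
  assumes "a \<in> E" "b \<in> E" "a \<noteq> b" shows "flat E \<C> (line a b)"
  unfolding flat_def
proof (intro conjI ballI impI)
  show LE: "line a b \<subseteq> E" using line_subset assms by blast
  fix C assume C: "C \<in> \<C>" "card (C \<inter> line a b) = card C - 1"
  show "C \<subseteq> line a b"
  proof (rule ccontr)
    assume n: "\<not> C \<subseteq> line a b"
    let ?D = "C \<inter> line a b"
    have finD: "finite ?D" using finite_circuit[OF C(1)] by blast
    have "2 \<le> card ?D" using C card_circuit[OF C(1)] by simp
    then obtain D2 where "D2 \<subseteq> ?D" "card D2 = 2" by (meson obtain_subset_with_card_n)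
    then obtain x y where xy: "x \<in> ?D" "y \<in> ?D" "x \<noteq> y" by (auto simp: card_2_iff)
    have "\<not> (\<exists>z\<in>?D. z \<noteq> x \<and> z \<noteq> y)"
    proof
      assume "\<exists>z\<in>?D. z \<noteq> x \<and> z \<noteq> y"
      then obtain z where z: "z \<in> ?D" "z \<noteq> x" "z \<noteq> y" by blast
      then have "{x,y,z} \<in> \<C>" using line_tri[of x a b y z] xy assms by blast
      moreover have "{x,y,z} \<subseteq> C" using z xy by blast
      ultimately have "{x,y,z} = C" using C matroid_incomparable[OF matroid] by blast
      then show False using n z xy by blast
    qed
    then have D: "?D = {x,y}" using xy by blast
    then have "card C = 3" using C card_circuit[OF C(1)] xy by auto
    obtain z where z: "z \<in> C" "z \<notin> line a b" using n by blast
    then have "x \<noteq> z" "y \<noteq> z" using xy by auto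
    then have "{x,y,z} \<subseteq> C" "card {x,y,z} = 3" using z xy by auto
    then have "{x,y,z} = C" using \<open>card C = 3\<close> finite_circuit[OF C(1)] card_subset_eq by metis
    then have "z \<in> line x y" using C unfolding line_def by blast
    then show False using z line_eq[of x a b y] xy assms by blast
  qed
qed

lemma mrank_line:
  assumes "a \<in> E" "b \<in> E" "a \<noteq> b" shows "mrank \<C> (line a b) = 2"
  unfolding mrank_def
proof (rule Max_eqI)
  show "finite (card ` {I. I \<subseteq> line a b \<and> indep \<C> I})"
    using finite_card_image_indep line_subset assms by blast
  have "indep \<C> {a,b}" unfolding indep_def using no_small_circuit by blast
  then show "2 \<in> card ` {I. I \<subseteq> line a b \<and> indep \<C> I}"
    using assms(3) unfolding line_def by (intro image_eqI[of _ _ "{a,b}"]) auto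
  fix y assume "y \<in> card ` {I. I \<subseteq> line a b \<and> indep \<C> I}"
  then obtain I where I: "I \<subseteq> line a b" "indep \<C> I" "y = card I" by blast
  show "y \<le> 2"
  proof (rule ccontr)
    assume "\<not> y \<le> 2"
    then obtain I' where "I' \<subseteq> I" "card I' = 3"
      using I(3) by (metis not_less_eq_eq obtain_subset_with_card_n numeral_2_eq_2 numeral_3_eq_3)
    then obtain x y z where xyz: "x \<in> I" "y \<in> I" "z \<in> I" "x \<noteq> y" "x \<noteq> z" "y \<noteq> z"
      by (auto simp: card_3_iff)
    then have "{x,y,z} \<in> \<C>" using line_tri[of x a b y z] I(1) assms(3) by auto
    then show False using indepD[OF I(2)] xyz by auto
  qed
qed

lemma fjoin_eq_line:
  assumes "a \<in> E" "b \<in> E" "a \<noteq> b" shows "fjoin E \<C> {a} {b} = line a b"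
  unfolding fjoin_def
proof
  have "line a b \<in> {X. flat E \<C> X \<and> {a} \<union> {b} \<subseteq> X}"
    using flat_line[OF assms] unfolding line_def by blast
  then show "\<Inter> {X. flat E \<C> X \<and> {a} \<union> {b} \<subseteq> X} \<subseteq> line a b" by blast
  show "line a b \<subseteq> \<Inter> {X. flat E \<C> X \<and> {a} \<union> {b} \<subseteq> X}"
  proof
    fix k assume k: "k \<in> line a b"
    have "k \<in> X" if X: "flat E \<C> X" "{a} \<union> {b} \<subseteq> X" for X
    proof (rule ccontr)
      assume n: "k \<notin> X"
      then have c: "{a,b,k} \<in> \<C>" using k X unfolding line_def by auto
      have "{a,b,k} \<inter> X = {a,b}" using X n by blast
      then have "card ({a,b,k} \<inter> X) = card {a,b,k} - 1" using tri_distinct[OF c] by simp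
      then have "{a,b,k} \<subseteq> X" using X(1) c unfolding flat_def by blast
      then show False using n by blast
    qed
    then show "k \<in> \<Inter> {X. flat E \<C> X \<and> {a} \<union> {b} \<subseteq> X}" by blast
  qed
qed

text \<open>This makes ji the leading word of its relation: every other word of the relation ends in
  the block of j.\<close>

lemma retro_line:
  assumes "i \<in> E" "j \<in> E" "blk i < blk j" "k \<in> line j i" "k \<noteq> i"
  shows "blk k = blk j" "k \<in> E"
  using assms tri_top[of i j k] tri_in_E[of j i k] unfolding line_def by (auto simp: insert_commute)

end

section \<open>The free associative algebra\<close>

lemma sum_fun_apply: "(\<Sum>x\<in>A. f x) w = (\<Sum>x\<in>A. f x w)"
  by (induction A rule: infinite_finite_induct) auto

lemma smult_apply [simp]: "smult a f w = a * f w"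
  by (simp add: smult_def)

lemma mono_apply: "mono u w = (if w = u then 1 else 0)"
  by (simp add: mono_def)

lemma mono_self [simp]: "mono u u = 1"
  by (simp add: mono_def)

lemma ncp_0: "ncp E (0 :: 'k::zero ncpoly)"
  by (simp add: ncp_def)

lemma ncp_add:
  fixes f g :: "'k::field ncpoly"
  assumes "ncp E f" "ncp E g" shows "ncp E (f + g)"
proof -
  have "{w. (f + g) w \<noteq> 0} \<subseteq> {w. f w \<noteq> 0} \<union> {w. g w \<noteq> 0}" by auto
  then show ?thesis using assms unfolding ncp_def by (auto intro: finite_subset)
qed

lemma ncp_smult:
  fixes f :: "'k::field ncpoly"
  assumes "ncp E f" shows "ncp E (smult a f)"
proof -
  have "{w. (smult a f) w \<noteq> 0} \<subseteq> {w. f w \<noteq> 0}" by auto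
  then show ?thesis using assms unfolding ncp_def by (auto intro: finite_subset)
qed

lemma ncp_diff:
  fixes f g :: "'k::field ncpoly"
  assumes "ncp E f" "ncp E g" shows "ncp E (f - g)"
proof -
  have "{w. (f - g) w \<noteq> 0} \<subseteq> {w. f w \<noteq> 0} \<union> {w. g w \<noteq> 0}" by auto
  then show ?thesis using assms unfolding ncp_def by (auto intro: finite_subset)
qed

lemma ncp_mono: "set u \<subseteq> E \<Longrightarrow> ncp E (mono u :: 'k::field ncpoly)"
  unfolding ncp_def mono_def by auto

lemma ncp_sum:
  fixes f :: "'a \<Rightarrow> 'k::field ncpoly"
  shows "(\<And>x. x \<in> A \<Longrightarrow> ncp E (f x)) \<Longrightarrow> ncp E (\<Sum>x\<in>A. f x)"
  by (induction A rule: infinite_finite_induct) (auto simp: ncp_0 ncp_add)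

lemma ncmult_nonzero_split:
  fixes f g :: "'k::field ncpoly"
  assumes "ncmult f g w \<noteq> 0"
  obtains u v where "w = u @ v" "f u \<noteq> 0" "g v \<noteq> 0"
proof -
  obtain i where "f (take i w) * g (drop i w) \<noteq> 0"
    using assms unfolding ncmult_def by (meson sum.not_neutral_contains_not_neutral)
  then show ?thesis using that[of "take i w" "drop i w"] by auto
qed

lemma ncp_ncmult:
  fixes f g :: "'k::field ncpoly"
  assumes "ncp E f" "ncp E g" shows "ncp E (ncmult f g)"
proof -
  have sub: "{w. ncmult f g w \<noteq> 0} \<subseteq> (\<lambda>(u,v). u @ v) ` ({w. f w \<noteq> 0} \<times> {w. g w \<noteq> 0})"
  proof
    fix w assume "w \<in> {w. ncmult f g w \<noteq> 0}"
    then have "ncmult f g w \<noteq> 0" by simp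
    then obtain u v where "w = u @ v" "f u \<noteq> 0" "g v \<noteq> 0" by (rule ncmult_nonzero_split)
    then show "w \<in> (\<lambda>(u,v). u @ v) ` ({w. f w \<noteq> 0} \<times> {w. g w \<noteq> 0})" by auto
  qed
  have "finite {w. ncmult f g w \<noteq> 0}"
    by (rule finite_subset[OF sub]) (use assms in \<open>auto simp: ncp_def\<close>)
  moreover have "set w \<subseteq> E" if "ncmult f g w \<noteq> 0" for w
    using that by (rule ncmult_nonzero_split) (use assms in \<open>auto simp: ncp_def\<close>)
  ultimately show ?thesis unfolding ncp_def by blast
qed

section \<open>Linear functionals given by their values on words\<close>

definition deval :: "('a list \<Rightarrow> 'k) \<Rightarrow> ('a list \<Rightarrow> 'k) \<Rightarrow> 'k::field" where
  "deval \<phi> f = (\<Sum>w | f w \<noteq> 0. f w * \<phi> w)"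

lemma deval_superset: "finite S \<Longrightarrow> {w. f w \<noteq> 0} \<subseteq> S \<Longrightarrow> deval \<phi> f = (\<Sum>w\<in>S. f w * \<phi> w)"
  unfolding deval_def by (rule sum.mono_neutral_left) auto

lemma deval_add:
  assumes "ncp E f" "ncp E g" shows "deval \<phi> (f + g) = deval \<phi> f + deval \<phi> g"
proof -
  let ?S = "{w. f w \<noteq> 0} \<union> {w. g w \<noteq> 0}"
  have S: "finite ?S" using assms unfolding ncp_def by blast
  have "deval \<phi> (f + g) = (\<Sum>w\<in>?S. (f + g) w * \<phi> w)" "deval \<phi> f = (\<Sum>w\<in>?S. f w * \<phi> w)"
    "deval \<phi> g = (\<Sum>w\<in>?S. g w * \<phi> w)"
    by (rule deval_superset[OF S]; force)+
  then show ?thesis by (simp add: sum.distrib ring_distribs)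
qed

text \<open>A word with a chosen cut point is the same as the pair of its pieces, so the sum over
  words and cuts becomes a sum over pairs.\<close>

lemma deval_ncmult:
  fixes f g :: "'k::field ncpoly"
  assumes "ncp E f" "ncp E g"
  shows "deval \<phi> (ncmult f g) = deval (\<lambda>u. deval (\<lambda>v. \<phi> (u @ v)) g) f"
proof -
  let ?F = "{w. f w \<noteq> 0}" and ?G = "{w. g w \<noteq> 0}"
  have fin: "finite ?F" "finite ?G" using assms unfolding ncp_def by auto
  let ?S = "(\<lambda>(u,v). u @ v) ` (?F \<times> ?G)"
  let ?P = "SIGMA w:?S. {..length w}"
  let ?h = "\<lambda>(u,v). f u * g v * \<phi> (u @ v)"
  have "deval \<phi> (ncmult f g) = (\<Sum>w\<in>?S. ncmult f g w * \<phi> w)"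
  proof (rule deval_superset)
    show "{w. ncmult f g w \<noteq> 0} \<subseteq> ?S"
    proof
      fix w assume "w \<in> {w. ncmult f g w \<noteq> 0}"
      then have "ncmult f g w \<noteq> 0" by simp
      then obtain u v where "w = u @ v" "f u \<noteq> 0" "g v \<noteq> 0" by (rule ncmult_nonzero_split)
      then show "w \<in> ?S" by auto
    qed
  qed (use fin in simp)
  also have "\<dots> = (\<Sum>w\<in>?S. \<Sum>i\<le>length w. ?h (take i w, drop i w))"
    by (simp add: ncmult_def sum_distrib_right)
  also have "\<dots> = (\<Sum>(w,i)\<in>?P. ?h (take i w, drop i w))"
    by (rule sum.Sigma) (use fin in auto)
  also have "\<dots> = (\<Sum>p\<in>(\<lambda>(w,i). (take i w, drop i w)) ` ?P. ?h p)"
  proof (subst sum.reindex)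
    show "inj_on (\<lambda>(w,i). (take i w, drop i w)) ?P"
    proof (rule inj_onI)
      fix p p' assume "p \<in> ?P" "p' \<in> ?P"
        and eq: "(\<lambda>(w,i). (take i w, drop i w)) p = (\<lambda>(w,i). (take i w, drop i w)) p'"
      then obtain w i w' i' where p: "p = (w,i)" "p' = (w',i')" "i \<le> length w" "i' \<le> length w'"
        by auto
      have "take i w = take i' w'" "drop i w = drop i' w'" using eq p by auto
      then show "p = p'"
        unfolding p using p(3,4) by (metis append_take_drop_id length_take min.absorb2)
    qed
    show "(\<Sum>(w,i)\<in>?P. ?h (take i w, drop i w)) = sum (?h \<circ> (\<lambda>(w,i). (take i w, drop i w))) ?P"
      by (rule sum.cong) (simp_all only: comp_def split_beta)
  qed
  \<comment> \<open>A product of two support words may also be cut elsewhere; pieces outside the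
    supports contribute zero.\<close>
  also have "\<dots> = (\<Sum>p\<in>?F \<times> ?G. ?h p)"
  proof (rule sum.mono_neutral_right)
    show "finite ((\<lambda>(w,i). (take i w, drop i w)) ` ?P)" using fin by auto
    show "?F \<times> ?G \<subseteq> (\<lambda>(w,i). (take i w, drop i w)) ` ?P"
    proof clarify
      fix u v assume "f u \<noteq> 0" "g v \<noteq> 0"
      then have "(u @ v, length u) \<in> ?P" by auto
      then show "(u, v) \<in> (\<lambda>(w,i). (take i w, drop i w)) ` ?P" by (rule rev_image_eqI) simp
    qed
  qed auto
  also have "\<dots> = (\<Sum>u\<in>?F. \<Sum>v\<in>?G. f u * g v * \<phi> (u @ v))"
    by (simp add: sum.cartesian_product)
  also have "\<dots> = deval (\<lambda>u. deval (\<lambda>v. \<phi> (u @ v)) g) f"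
    by (simp add: deval_def sum_distrib_left mult.assoc)
  finally show ?thesis .
qed

lemma ideal_gen_ncp:
  assumes "\<And>g. g \<in> G \<Longrightarrow> ncp E g" "f \<in> ideal_gen E G" shows "ncp E f"
  using assms(2) by induction (assumption | rule ncp_0 assms(1) ncp_add ncp_ncmult)+

text \<open>The induction carries all contexts u, v at once, since multiplication by a and b becomes
  a sum over enlarged contexts.\<close>

lemma deval_ideal_gen:
  fixes G :: "'k::field ncpoly set"
  assumes G: "\<And>g. g \<in> G \<Longrightarrow> ncp E g"
    and van: "\<And>u v g. g \<in> G \<Longrightarrow> deval (\<lambda>w. \<phi> (u @ w @ v)) g = 0"
    and f: "f \<in> ideal_gen E G"
  shows "deval \<phi> f = 0"
proof -
  have "\<forall>u v. deval (\<lambda>w. \<phi> (u @ w @ v)) f = 0"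
    using f
  proof induction
    case zero then show ?case by (simp add: deval_def)
  next
    case (gen g) then show ?case using van by simp
  next
    case (add f h)
    then show ?case
      by (simp only: deval_add[OF ideal_gen_ncp[OF G add.hyps(1)] ideal_gen_ncp[OF G add.hyps(2)]] add_0 simp_thms)
  next
    case (mult f a b)
    have f: "ncp E f" using ideal_gen_ncp[OF G mult.hyps(1)] .
    show ?case
    proof (intro allI)
      fix u v
      have inner: "deval (\<lambda>y. deval (\<lambda>z. \<phi> (u @ (x @ y) @ z @ v)) b) f = 0" for x
      proof -
        have "deval (\<lambda>y. deval (\<lambda>z. \<phi> (u @ (x @ y) @ z @ v)) b) f
            = (\<Sum>z | b z \<noteq> 0. b z * deval (\<lambda>y. \<phi> ((u @ x) @ y @ (z @ v))) f)"
          unfolding deval_def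
          by (simp add: sum_distrib_left sum.swap[of _ _ "{w. f w \<noteq> 0}"] mult_ac)
        then show ?thesis using mult.IH by (simp only: mult_zero_right sum.neutral_const)
      qed
      have "deval (\<lambda>w. \<phi> (u @ w @ v)) (ncmult (ncmult a f) b)
        = deval (\<lambda>x. deval (\<lambda>y. deval (\<lambda>z. \<phi> (u @ (x @ y) @ z @ v)) b) f) a"
        using mult.hyps(2,3) f by (simp add: deval_ncmult[of E] ncp_ncmult)
      also have "\<dots> = 0" unfolding inner by (simp add: deval_def)
      finally show "deval (\<lambda>w. \<phi> (u @ w @ v)) (ncmult (ncmult a f) b) = 0" .
    qed
  qed
  then have "deval (\<lambda>w. \<phi> ([] @ w @ [])) f = 0" by blast
  then show ?thesis by simp
qed

lemma ncmult_mono: "ncmult (mono u) (mono v) = (mono (u @ v) :: 'k::field ncpoly)"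
proof
  fix w
  have "ncmult (mono u) (mono v) w = (\<Sum>i\<le>length w. if take i w = u \<and> drop i w = v then 1 else (0::'k))"
    unfolding ncmult_def mono_def by (intro sum.cong) auto
  also have "\<dots> = (\<Sum>i\<le>length w. if i = length u then (if w = u @ v then 1 else (0::'k)) else 0)"
  proof (intro sum.cong refl)
    fix i assume "i \<in> {..length w}"
    then have "take i w = u \<and> drop i w = v \<longleftrightarrow> i = length u \<and> w = u @ v"
      by (metis append_eq_conv_conj append_take_drop_id atMost_iff length_take min.absorb2)
    then show "(if take i w = u \<and> drop i w = v then 1 else (0::'k))
        = (if i = length u then (if w = u @ v then 1 else 0) else 0)" by auto
  qed
  also have "\<dots> = mono (u @ v) w" by (auto simp: mono_def)
  finally show "ncmult (mono u) (mono v) w = (mono (u @ v) w :: 'k)" .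
qed

lemma ncmult_sum_left:
  fixes f :: "'a \<Rightarrow> 'k::field ncpoly"
  shows "ncmult (\<Sum>x\<in>A. f x) g = (\<Sum>x\<in>A. ncmult (f x) g)"
  unfolding ncmult_def by (rule ext) (simp add: sum_fun_apply sum_distrib_right sum.swap[of _ A])

lemma ncmult_sum_right:
  fixes f :: "'a \<Rightarrow> 'k::field ncpoly"
  shows "ncmult g (\<Sum>x\<in>A. f x) = (\<Sum>x\<in>A. ncmult g (f x))"
  unfolding ncmult_def by (rule ext) (simp add: sum_fun_apply sum_distrib_left sum.swap[of _ A])

lemma ncmult_smult_left: "ncmult (smult a f) (g :: 'k::field ncpoly) = smult a (ncmult f g)"
  unfolding ncmult_def by (rule ext) (simp add: sum_distrib_left mult_ac)

lemma ncmult_smult_right: "ncmult g (smult a f) = smult a (ncmult g (f :: 'k::field ncpoly))"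
  unfolding ncmult_def by (rule ext) (simp add: sum_distrib_left mult_ac)

lemma ncmult_mono_Nil: "ncmult (mono []) f = (f :: 'k::field ncpoly)" "ncmult f (mono []) = f"
proof -
  have "(\<Sum>i\<le>length w. mono [] (take i w) * f (drop i w)) = (\<Sum>i\<le>length w. if i = 0 then f w else 0)" for w
    by (intro sum.cong) (auto simp: mono_def)
  then show "ncmult (mono []) f = f" unfolding ncmult_def by (intro ext) simp
  have "(\<Sum>i\<le>length w. f (take i w) * mono [] (drop i w)) = (\<Sum>i\<le>length w. if i = length w then f w else 0)" for w
    by (intro sum.cong) (auto simp: mono_def)
  then show "ncmult f (mono []) = f" unfolding ncmult_def by (intro ext) simp
qed

text \<open>Scalars enter \<open>ideal_gen\<close> as multiples of the empty word.\<close>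

lemma ideal_gen_smult:
  fixes f :: "'k::field ncpoly"
  assumes "f \<in> ideal_gen E G" shows "smult a f \<in> ideal_gen E G"
proof -
  have "ncp E (smult a (mono []) :: 'k ncpoly)" "ncp E (mono [] :: 'k ncpoly)"
    by (auto intro!: ncp_smult ncp_mono)
  then have "ncmult (ncmult (smult a (mono [])) f) (mono []) \<in> ideal_gen E G"
    using assms by (intro ideal_gen.mult)
  then show ?thesis by (simp add: ncmult_smult_left ncmult_mono_Nil)
qed

lemma ideal_gen_diff:
  fixes f :: "'k::field ncpoly"
  assumes "f \<in> ideal_gen E G" "g \<in> ideal_gen E G" shows "f - g \<in> ideal_gen E G"
proof -
  have "f - g = f + smult (-1) g" by (rule ext) simp
  then show ?thesis using ideal_gen.add[OF assms(1) ideal_gen_smult[OF assms(2)]] by metis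
qed

lemma ideal_gen_sum:
  fixes f :: "'a \<Rightarrow> 'k::field ncpoly"
  shows "(\<And>x. x \<in> A \<Longrightarrow> f x \<in> ideal_gen E G) \<Longrightarrow> (\<Sum>x\<in>A. f x) \<in> ideal_gen E G"
  by (induction A rule: infinite_finite_induct) (auto intro: ideal_gen.zero ideal_gen.add)

lemma mono_decomp:
  fixes f :: "'k::field ncpoly"
  assumes "finite S" "{w. f w \<noteq> 0} \<subseteq> S"
  shows "f = (\<Sum>w\<in>S. smult (f w) (mono w))"
proof
  fix u
  have "(\<Sum>w\<in>S. smult (f w) (mono w)) u = (\<Sum>w\<in>S. if w = u then f u else 0)"
    unfolding sum_fun_apply by (intro sum.cong) (auto simp: mono_apply)
  then show "f u = (\<Sum>w\<in>S. smult (f w) (mono w)) u" using assms by auto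
qed

section \<open>Twisted derivations\<close>

text \<open>With the bracket lm - s ml, this is the bracket of l with the element sum of e l m * m,
  tested against the bilinear form \<beta>: a commutator for s = 1, an anticommutator for s =
  -1.\<close>

definition twisted_der :: "'k::field \<Rightarrow> nat set \<Rightarrow> (nat \<Rightarrow> nat \<Rightarrow> 'k) \<Rightarrow> nat \<Rightarrow> (nat \<Rightarrow> nat \<Rightarrow> 'k) \<Rightarrow> 'k" where
  "twisted_der s T e l \<beta> = (\<Sum>m\<in>T. e l m * (\<beta> l m - s * \<beta> m l))"

lemma twisted_der_linear:
  "twisted_der s T e l (\<lambda>x y. a * \<beta> x y + b * \<gamma> x y)
     = a * twisted_der s T e l \<beta> + b * twisted_der s T e l \<gamma>"
  unfolding twisted_der_def
  by (simp add: algebra_simps sum.distrib sum_distrib_left sum_subtractf)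

lemma twisted_der_cong:
  "(\<And>m. m \<in> T \<Longrightarrow> e l m \<noteq> 0 \<Longrightarrow> \<beta> l m = \<gamma> l m \<and> \<beta> m l = \<gamma> m l) \<Longrightarrow>
    twisted_der s T e l \<beta> = twisted_der s T e l \<gamma>"
  unfolding twisted_der_def by (intro sum.cong refl) (metis mult_zero_left)

lemma twisted_der_sum:
  "twisted_der s T (\<lambda>l m. \<Sum>k\<in>A. a k * e k l m) l \<beta> = (\<Sum>k\<in>A. a k * twisted_der s T (e k) l \<beta>)"
  unfolding twisted_der_def
  by (simp add: sum_distrib_left sum_distrib_right sum.swap[of _ T A] mult_ac)

text \<open>The twisted commutator of the derivations with coefficients e and w, evaluated on a letter,
  vanishes because w acts on each class of e as the inner derivation by a fixed element, which e kills.\<close>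

lemma twisted_der_commute:
  fixes s :: "'k::field" and \<theta> :: "nat \<Rightarrow> nat \<Rightarrow> nat \<Rightarrow> 'k"
  assumes s2: "s * s = 1"
    and inner: "\<And>m x. m \<in> T \<Longrightarrow> x \<in> T \<Longrightarrow> e l m \<noteq> 0 \<Longrightarrow> w m x = w l x"
    and kill: "\<And>x y. x \<in> T \<Longrightarrow> y \<in> T \<Longrightarrow> w l x * e x y = s * (w l y * e y x)"
  defines "dd \<equiv> \<lambda>e w. twisted_der s T e l (\<lambda>x y. s * twisted_der s T w x (\<lambda>u v. \<theta> u v y)
      + twisted_der s T w y (\<lambda>u v. \<theta> x u v))"
  shows "dd e w = s * dd w e"
proof -
  have s3: "s * (s * x) = x" for x using s2 by (metis mult.assoc mult_1)
  \<comment> \<open>With W the sum of w l x * x, this is the ordinary commutator of W with the value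
    of e on l: the twisted Leibniz rule gives x(yW - s Wy) + s(xW - s Wx)y = xyW - Wxy, the middle
    terms cancelling.\<close>
  define common where "common = (\<Sum>m\<in>T. \<Sum>x\<in>T. e l m * w l x *
     (\<theta> l m x - s * \<theta> m l x - \<theta> x l m + s * \<theta> x m l))"
  have "dd e w = (\<Sum>m\<in>T. e l m * (\<Sum>x\<in>T. w l x * (\<theta> l m x - s * \<theta> m l x - \<theta> x l m + s * \<theta> x m l)))"
    unfolding dd_def twisted_der_def[of s T e]
  proof (intro sum.cong refl)
    fix m assume m: "m \<in> T"
    show "e l m * (s * twisted_der s T w l (\<lambda>u v. \<theta> u v m) + twisted_der s T w m (\<theta> l)
        - s * (s * twisted_der s T w m (\<lambda>u v. \<theta> u v l) + twisted_der s T w l (\<theta> m)))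
      = e l m * (\<Sum>x\<in>T. w l x * (\<theta> l m x - s * \<theta> m l x - \<theta> x l m + s * \<theta> x m l))"
    proof (cases "e l m = 0")
      case False
      \<comment> \<open>By \<open>inner\<close> the same element W serves for l and for m.\<close>
      have w: "twisted_der s T w m \<beta> = (\<Sum>x\<in>T. w l x * (\<beta> m x - s * \<beta> x m))" for \<beta>
        unfolding twisted_der_def by (intro sum.cong) (use inner[OF m _ False] in auto)
      show ?thesis unfolding w unfolding twisted_der_def
        by (simp add: sum_distrib_left flip: sum.distrib sum_subtractf)
           (intro disjI2 sum.cong refl, simp add: algebra_simps s3)
    qed simp
  qed
  also have "\<dots> = common" unfolding common_def by (simp add: sum_distrib_left mult.assoc)
  finally have 1: "dd e w = common" .
  \<comment> \<open>The derivation e annihilates W: by \<open>kill\<close>, exchanging x and y turns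
    one half of the bracket into the other.\<close>
  have zero: "(\<Sum>x\<in>T. w l x * twisted_der s T e x \<beta>) = 0" for \<beta>
  proof -
    let ?f = "\<lambda>x y. w l x * e x y * \<beta> x y"
    have "(\<Sum>x\<in>T. w l x * twisted_der s T e x \<beta>)
      = (\<Sum>x\<in>T. \<Sum>y\<in>T. ?f x y) - (\<Sum>x\<in>T. \<Sum>y\<in>T. s * (w l x * e x y) * \<beta> y x)"
      unfolding twisted_der_def by (simp add: sum_distrib_left algebra_simps flip: sum_subtractf)
    also have "(\<Sum>x\<in>T. \<Sum>y\<in>T. s * (w l x * e x y) * \<beta> y x) = (\<Sum>x\<in>T. \<Sum>y\<in>T. ?f y x)"
      by (intro sum.cong refl) (subst kill, auto simp: s3)
    also have "\<dots> = (\<Sum>x\<in>T. \<Sum>y\<in>T. ?f x y)" by (rule sum.swap)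
    finally show ?thesis by simp
  qed
  have "dd w e = (\<Sum>x\<in>T. w l x * (s * twisted_der s T e l (\<lambda>u v. \<theta> u v x) - s * twisted_der s T e l (\<theta> x)))
       + (\<Sum>x\<in>T. w l x * twisted_der s T e x (\<theta> l))
       - (\<Sum>x\<in>T. w l x * twisted_der s T e x (\<lambda>u v. \<theta> u v l))"
    unfolding dd_def twisted_der_def[of s T w]
    by (simp add: algebra_simps s3 sum.distrib sum_subtractf)
  also have "\<dots> = (\<Sum>x\<in>T. w l x * (s * twisted_der s T e l (\<lambda>u v. \<theta> u v x) - s * twisted_der s T e l (\<theta> x)))"
    by (simp add: zero)
  finally have "s * dd w e = (\<Sum>x\<in>T. w l x * (twisted_der s T e l (\<lambda>u v. \<theta> u v x) - twisted_der s T e l (\<theta> x)))"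
    by (simp add: sum_distrib_left algebra_simps s3)
  also have "\<dots> = (\<Sum>x\<in>T. \<Sum>m\<in>T. e l m * w l x *
     (\<theta> l m x - s * \<theta> m l x - \<theta> x l m + s * \<theta> x m l))"
    unfolding twisted_der_def
    by (simp add: sum_distrib_left algebra_simps flip: sum_subtractf sum.distrib)
  also have "\<dots> = common" unfolding common_def by (rule sum.swap)
  finally show ?thesis using 1 by simp
qed

text \<open>The Orlik--Solomon case is s = 1 and c = 1, the Varchenko--Gelfand case is s = -1 and c the
  chirotope of the line through two points.  The last axiom is a multiplicative Menelaus theorem for the
  triangle X, Y, Z cut by the line through P, Q, R.\<close>

locale twisted_matroid = blocked_matroid E \<C> r Eb
  for E :: "nat set" and \<C> :: "nat set set" and r :: nat and Eb :: "nat \<Rightarrow> nat set" +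
  fixes s :: "'k::field" and c :: "nat \<Rightarrow> nat \<Rightarrow> 'k"
  assumes s_square: "s * s = 1"
    and c_square: "a \<in> E \<Longrightarrow> b \<in> E \<Longrightarrow> a \<noteq> b \<Longrightarrow> c a b * c a b = 1"
    and c_swap: "a \<in> E \<Longrightarrow> b \<in> E \<Longrightarrow> a \<noteq> b \<Longrightarrow> c b a = s * c a b"
    and menelaus: "{P,Y,Z} \<in> \<C> \<Longrightarrow> {Q,Z,X} \<in> \<C> \<Longrightarrow> {R,X,Y} \<in> \<C> \<Longrightarrow> {P,Q,R} \<in> \<C> \<Longrightarrow> {X,Y,Z} \<notin> \<C> \<Longrightarrow>
      c P Y * c P Z * (c Q Z * c Q X) * (c R X * c R Y) = 1"
begin

lemma s_cancel [simp]: "s * (s * x) = x"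
  using s_square by (metis mult.assoc mult_1)

text \<open>The relation of (l,i) solved for the word li reads li = s il - sum of c l i * c l m *
  (lm - s ml), with m running over the other points of the line, all in the block of l.\<close>

definition dcoef :: "nat \<Rightarrow> nat \<Rightarrow> nat \<Rightarrow> 'k" where
  "dcoef i l m = (if {i,l,m} \<in> \<C> \<and> blk l = blk m \<and> blk i < blk l then - (c l i * c l m) else 0)"

abbreviation dder :: "nat \<Rightarrow> nat \<Rightarrow> (nat \<Rightarrow> nat \<Rightarrow> 'k) \<Rightarrow> 'k" where
  "dder i \<equiv> twisted_der s E (dcoef i)"

text \<open>The points x, y, l form a proper triangle in one block: were they collinear, j and k
  would both be the low point of their line. The low points j, k, k' of the three sides are
  collinear by \<open>pasch\<close>.\<close>

lemma third_point:
  assumes t: "{j,x,y} \<in> \<C>" "{k,l,x} \<in> \<C>"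
    and b: "blk y = blk x" "blk l = blk x" "blk j < blk x" "blk k < blk x" and jk: "j \<noteq> k"
  shows "\<exists>k'. {k',l,y} \<in> \<C> \<and> blk k' < blk x \<and> {j,k,k'} \<in> \<C> \<and> l \<noteq> y \<and> {x,y,l} \<notin> \<C>"
proof -
  note d = tri_distinct[OF t(1)] tri_distinct[OF t(2)]
  have uniq: False if "{j,l,x} \<in> \<C>"
    using tri_meet_unique[OF that t(2)] b jk by simp
  have jl: "j \<noteq> l" using b by auto
  have ly: "l \<noteq> y" using uniq t(1) by (auto simp: insert_commute)
  have nt: "{x,y,l} \<notin> \<C>"
  proof
    assume "{x,y,l} \<in> \<C>"
    then have "{x,j,l} \<in> \<C>"
      using tri_trans[of x y j l] t(1) jl by (auto simp: insert_commute)
    then show False using uniq by (simp add: insert_commute)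
  qed
  obtain k' where k': "blk k' < blk l" "{k',l,y} \<in> \<C>"
    using tri_meet[of l y] ly b tri_in_E[OF t(1)] tri_in_E[OF t(2)] by auto
  have "k' \<noteq> j"
  proof
    assume "k' = j"
    then have "{j,l,x} \<in> \<C>"
      using tri_trans[of j y l x] k' t(1) d by (auto simp: insert_commute)
    then show False by (rule uniq)
  qed
  moreover have "k' \<noteq> k"
  proof
    assume "k' = k"
    then have "{l,x,y} \<in> \<C>"
      using tri_trans[of l k x y] k' t(2) d by (auto simp: insert_commute)
    then show False using nt by (simp add: insert_commute)
  qed
  ultimately have "{j,k,k'} \<in> \<C>"
    using k' t b jk by (intro pasch[of j x y k l k']) (auto simp: insert_commute)
  then show ?thesis using k' b ly nt by auto
qed

text \<open>The coefficients of the combination of derivations which, by the relation attached to j and F,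
  must twistedly commute with the derivation of j.\<close>

definition wcoef :: "nat \<Rightarrow> nat set \<Rightarrow> nat \<Rightarrow> nat \<Rightarrow> 'k" where
  "wcoef j F l m = (\<Sum>k\<in>F - {j}. c j k * dcoef k l m)"

text \<open>The line through l and m has only one low point, so a single term of the sum
  survives.\<close>

lemma wcoef_val:
  assumes "finite F" "k \<in> F - {j}" "{k,l,m} \<in> \<C>" "blk l = blk m" "blk k < blk l"
  shows "wcoef j F l m = - (c j k * c l k * c l m)"
proof -
  have "wcoef j F l m = (\<Sum>k'\<in>F - {j}. if k' = k then c j k * dcoef k l m else 0)"
    unfolding wcoef_def
  proof (intro sum.cong refl)
    fix k' assume "k' \<in> F - {j}"
    have "dcoef k' l m = 0" if "k' \<noteq> k"
      using tri_meet_unique[of k' l m k] that assms unfolding dcoef_def by auto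
    then show "c j k' * dcoef k' l m = (if k' = k then c j k * dcoef k l m else 0)" by auto
  qed
  also have "\<dots> = c j k * dcoef k l m" using assms(1,2) by simp
  finally show ?thesis using assms unfolding dcoef_def by simp
qed

lemma wcoef_nonzero:
  assumes "wcoef j F l m \<noteq> 0"
  shows "\<exists>k\<in>F - {j}. {k,l,m} \<in> \<C> \<and> blk l = blk m \<and> blk k < blk l"
proof -
  obtain k where "k \<in> F - {j}" "c j k * dcoef k l m \<noteq> 0"
    using assms unfolding wcoef_def by (meson sum.not_neutral_contains_not_neutral)
  then show ?thesis unfolding dcoef_def by (intro bexI[of _ k]) (auto split: if_splits)
qed

lemma unit_eqI:
  fixes x y :: 'k assumes "x * y = 1" "y * y = 1" shows "x = y"
  using assms by (metis mult.assoc mult.right_neutral mult_1)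

text \<open>This supplies \<open>inner\<close> in \<open>twisted_der_commute\<close>. With k, k' the
  low points of the lines xl and xm, the two values are products of signs that
  \<open>menelaus\<close> makes equal.\<close>

lemma wcoef_inner:
  assumes F: "F = line j i" "i \<in> E" "j \<in> E" "i \<noteq> j" and e: "dcoef j l m \<noteq> 0"
  shows "wcoef j F m x = wcoef j F l x"
proof -
  have finF: "finite F" using F line_subset finite_E finite_subset by metis
  have e: "{j,l,m} \<in> \<C>" "blk l = blk m" "blk j < blk l"
    using e unfolding dcoef_def by (auto split: if_splits)
  \<comment> \<open>A nonzero value provides the point k; the zero case follows by exchanging l and
    m.\<close>
  have main: "wcoef j F l x \<noteq> 0 \<Longrightarrow> wcoef j F m x = wcoef j F l x"
    if e: "{j,l,m} \<in> \<C>" "blk l = blk m" "blk j < blk l" for l m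
  proof -
    assume "wcoef j F l x \<noteq> 0"
    then obtain k where k: "k \<in> F - {j}" "{k,l,x} \<in> \<C>" "blk l = blk x" "blk k < blk l"
      using wcoef_nonzero by blast
    obtain k' where k': "{k',x,m} \<in> \<C>" "blk k' < blk l" "{j,k,k'} \<in> \<C>" "x \<noteq> m"
      using third_point[of j l m k x] e k by (auto simp: insert_commute)
    have "k' \<in> line j k" using k' unfolding line_def by blast
    then have k'F: "k' \<in> F - {j}"
      using line_eq[of j j i k] k k' F tri_distinct[OF k'(3)] unfolding F(1) line_def by auto
    have vals: "wcoef j F l x = - (c j k * c l k * c l x)" "wcoef j F m x = - (c j k' * c m k' * c m x)"
      using wcoef_val[OF finF k(1), of l x] wcoef_val[OF finF k'F, of m x] k k' e
      by (auto simp: insert_commute)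
    have nt: "{k,k',x} \<notin> \<C>"
      using no_lone_top[of "{k,k',x}" x] k k' by auto
    \<comment> \<open>The triangle k, k', x is cut by the line through m, l, j; it is proper because
      x alone lies in the highest block.\<close>
    have M: "c m k' * c m x * (c l x * c l k) * (c j k * c j k') = 1"
      by (rule menelaus[of m k' x l k j]) (use k k' e nt in \<open>auto simp: insert_commute\<close>)
    note inE = tri_in_E[OF k(2)] tri_in_E[OF k'(1)] tri_in_E[OF e(1)]
    note dis = tri_distinct[OF k(2)] tri_distinct[OF k'(1)] tri_distinct[OF k'(3)]
    have "c j k' * c m k' * c m x = c j k * c l k * c l x"
    proof (rule unit_eqI)
      show "c j k' * c m k' * c m x * (c j k * c l k * c l x) = 1" using M by (simp add: mult_ac)
      have "c j k * c l k * c l x * (c j k * c l k * c l x)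
        = (c j k * c j k) * (c l k * c l k) * (c l x * c l x)" by (simp only: mult_ac)
      then show "c j k * c l k * c l x * (c j k * c l k * c l x) = 1"
        using c_square[of j k] c_square[of l k] c_square[of l x] inE dis by auto
    qed
    then show ?thesis using vals by simp
  qed
  show ?thesis
  proof (cases "wcoef j F l x = 0")
    case True
    have "wcoef j F m x = 0"
    proof (rule ccontr)
      assume "wcoef j F m x \<noteq> 0"
      then show False using main[of m l] e True by (auto simp: insert_commute)
    qed
    then show ?thesis using True by simp
  qed (use main[OF e] in simp)
qed

text \<open>This supplies \<open>kill\<close> in \<open>twisted_der_commute\<close>. The points j,
  k, k', x, y, l lie on four lines, and any of these lines is a transversal of the triangle formed
  by the others; two such readings are multiplied.\<close>

lemma wcoef_kill:
  assumes F: "F = line j i" "i \<in> E" "j \<in> E" "i \<noteq> j"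
  shows "wcoef j F l x * dcoef j x y = s * (wcoef j F l y * dcoef j y x)"
proof (cases "{j,x,y} \<in> \<C> \<and> blk x = blk y \<and> blk j < blk x")
  case False
  then have "dcoef j x y = 0" "dcoef j y x = 0" unfolding dcoef_def by (auto simp: insert_commute)
  then show ?thesis by simp
next
  case True
  have finF: "finite F" using F line_subset finite_E finite_subset by metis
  have main: "wcoef j F l x * dcoef j x y = s * (wcoef j F l y * dcoef j y x)"
    if e: "{j,x,y} \<in> \<C>" "blk x = blk y" "blk j < blk x" and nz: "wcoef j F l x \<noteq> 0" for x y
  proof -
    obtain k where k: "k \<in> F - {j}" "{k,l,x} \<in> \<C>" "blk l = blk x" "blk k < blk l"
      using wcoef_nonzero[OF nz] by blast
    obtain k' where k': "{k',l,y} \<in> \<C>" "blk k' < blk x" "{j,k,k'} \<in> \<C>" "l \<noteq> y" "{x,y,l} \<notin> \<C>"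
      using third_point[of j x y k l] e k by auto
    have "k' \<in> line j k" using k' unfolding line_def by blast
    then have k'F: "k' \<in> F - {j}"
      using line_eq[of j j i k] k k' F tri_distinct[OF k'(3)] unfolding F(1) line_def by auto
    have vals: "wcoef j F l x = - (c j k * c l k * c l x)" "wcoef j F l y = - (c j k' * c l k' * c l y)"
      using wcoef_val[OF finF k(1), of l x] wcoef_val[OF finF k'F, of l y] k k' e by auto
    have nt: "{k,k',l} \<notin> \<C>"
      using no_lone_top[of "{k,k',l}" l] k k' by auto
    \<comment> \<open>First reading: triangle k, k', l with transversal y, x, j. Second reading:
      triangle l, x, y with transversal j, k', k.\<close>
    have M1: "c y k' * c y l * (c x l * c x k) * (c j k * c j k') = 1"
      by (rule menelaus[of y k' l x k j]) (use k k' e nt in \<open>auto simp: insert_commute\<close>)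
    have M2: "c j x * c j y * (c k' y * c k' l) * (c k l * c k x) = 1"
      by (rule menelaus[of j x y k' l k]) (use k k' e in \<open>auto simp: insert_commute\<close>)
    note inE = tri_in_E[OF k(2)] tri_in_E[OF k'(1)] tri_in_E[OF e(1)]
    note dis = tri_distinct[OF k(2)] tri_distinct[OF k'(1)] tri_distinct[OF k'(3)] tri_distinct[OF e(1)]
    note sw = c_swap[of l y] c_swap[of l x] c_swap[of x j] c_swap[of y j] c_swap[of y k']
      c_swap[of l k'] c_swap[of l k] c_swap[of x k]
    have M1': "c y k' * c l y * (c l x * c x k) * (c j k * c j k') = 1"
      using M1 sw(1,2) inE dis by (simp add: mult_ac)
    have M2': "c x j * c y j * (c y k' * c l k') * (c l k * c x k) = 1"
      using M2 sw(3-8) inE dis by (simp add: mult_ac)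
    have eq: "c j k * c l k * c l x * c x j = c j k' * c l k' * c l y * c y j"
    proof (rule unit_eqI)
      \<comment> \<open>The squares inserted on the left equal 1 and let the product split into the
        two Menelaus products.\<close>
      have "(c j k * c l k * c l x * c x j) * (c j k' * c l k' * c l y * c y j) * ((c y k' * c y k') * (c x k * c x k))
        = (c y k' * c l y * (c l x * c x k) * (c j k * c j k')) * (c x j * c y j * (c y k' * c l k') * (c l k * c x k))"
        by (simp only: mult_ac)
      then show "(c j k * c l k * c l x * c x j) * (c j k' * c l k' * c l y * c y j) = 1"
        using M1' M2' c_square[of y k'] c_square[of x k] inE dis by auto
      have "c j k' * c l k' * c l y * c y j * (c j k' * c l k' * c l y * c y j)
        = (c j k' * c j k') * (c l k' * c l k') * (c l y * c l y) * (c y j * c y j)" by (simp only: mult_ac)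
      then show "c j k' * c l k' * c l y * c y j * (c j k' * c l k' * c l y * c y j) = 1"
        using c_square[of j k'] c_square[of l k'] c_square[of l y] c_square[of y j] inE dis by auto
    qed
    have d: "dcoef j x y = - (c x j * c x y)" "dcoef j y x = - (c y j * (s * c x y))"
      using e c_swap[of x y] inE dis unfolding dcoef_def by (auto simp: insert_commute)
    have "wcoef j F l x * dcoef j x y = (c j k * c l k * c l x * c x j) * c x y"
      unfolding vals d by (simp add: mult_ac)
    also have "\<dots> = s * (wcoef j F l y * dcoef j y x)"
      unfolding vals d eq by (simp add: mult_ac)
    finally show ?thesis .
  qed
  show ?thesis
  proof (cases "wcoef j F l x = 0")
    case x0: True
    show ?thesis
    proof (cases "wcoef j F l y = 0")
      case False
      have "wcoef j F l y * dcoef j y x = s * (wcoef j F l x * dcoef j x y)"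
        by (rule main) (use True False in \<open>auto simp: insert_commute\<close>)
      then show ?thesis by simp
    qed (use x0 in simp)
  qed (use main True in blast)
qed

end

section \<open>The right action on words\<close>

context twisted_matroid
begin

text \<open>Words are read backwards here, and everything is transposed to functionals on words so that no
  finiteness conditions arise: psi i f is f composed with the right action of the letter i.  A letter of
  a higher block is passed by means of its derivation, as in an iterated Ore extension.\<close>

primrec psi :: "nat \<Rightarrow> (nat list \<Rightarrow> 'k) \<Rightarrow> nat list \<Rightarrow> 'k" where
  "psi i \<phi> [] = \<phi> [i]"
| "psi i \<phi> (l # w) = (if blk l \<le> blk i then \<phi> (i # l # w)
     else s * psi i (\<lambda>u. \<phi> (l # u)) w + dder i l (\<lambda>x y. \<phi> (y # x # w)))"

primrec psis :: "nat list \<Rightarrow> (nat list \<Rightarrow> 'k) \<Rightarrow> nat list \<Rightarrow> 'k" where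
  "psis [] \<phi> = \<phi>"
| "psis (i # u) \<phi> = psis u (psi i \<phi>)"

section \<open>Linearity of the action in the functional\<close>

lemma psi_linear: "psi i (\<lambda>w. a * \<phi> w + b * \<chi> w) w = a * psi i \<phi> w + b * psi i \<chi> w"
proof (induction w arbitrary: \<phi> \<chi>)
  case (Cons l w)
  show ?case by (simp add: Cons twisted_der_linear algebra_simps)
qed simp

lemma psi_zero: "psi i (\<lambda>w. 0) w = 0"
  using psi_linear[of i 0 "\<lambda>w. 0" 0 "\<lambda>w. 0" w] by simp

lemma psi_add: "psi i (\<lambda>w. \<phi> w + \<chi> w) w = psi i \<phi> w + psi i \<chi> w"
  using psi_linear[of i 1 \<phi> 1 \<chi> w] by simp

lemma psi_scale: "psi i (\<lambda>w. a * \<phi> w) w = a * psi i \<phi> w"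
  using psi_linear[of i a \<phi> 0 \<phi> w] by simp

lemma psi_sum: "psi i (\<lambda>w. \<Sum>x\<in>A. \<phi> x w) w = (\<Sum>x\<in>A. psi i (\<phi> x) w)"
  by (induction A rule: infinite_finite_induct) (simp_all add: psi_zero psi_add)

lemma psi_dder: "psi i (\<lambda>w. dder k l (\<lambda>x y. \<phi> x y w)) w = dder k l (\<lambda>x y. psi i (\<phi> x y) w)"
proof -
  have "psi i (\<lambda>w. \<Sum>m\<in>E. dcoef k l m * (\<phi> l m w - s * \<phi> m l w)) w
    = (\<Sum>m\<in>E. dcoef k l m * psi i (\<lambda>w. 1 * \<phi> l m w + (- s) * \<phi> m l w) w)"
    by (simp add: psi_sum psi_scale)
  also have "\<dots> = (\<Sum>m\<in>E. dcoef k l m * (psi i (\<phi> l m) w - s * psi i (\<phi> m l) w))"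
    unfolding psi_linear by simp
  finally show ?thesis unfolding twisted_der_def .
qed

lemma psis_zero: "psis u (\<lambda>w. 0) = (\<lambda>w. 0)"
proof (induction u)
  case (Cons i u)
  have "psi i (\<lambda>w. 0) = (\<lambda>w. 0)" by (rule ext) (rule psi_zero)
  then show ?case using Cons by simp
qed simp

lemma psis_linear: "psis u (\<lambda>w. a * \<phi> w + b * \<chi> w) = (\<lambda>w. a * psis u \<phi> w + b * psis u \<chi> w)"
proof (induction u arbitrary: \<phi> \<chi>)
  case (Cons i u)
  have "psi i (\<lambda>w. a * \<phi> w + b * \<chi> w) = (\<lambda>w. a * psi i \<phi> w + b * psi i \<chi> w)"
    by (rule ext) (rule psi_linear)
  then show ?case using Cons by simp
qed simp

lemma psis_scale: "psis u (\<lambda>w. a * \<phi> w) = (\<lambda>w. a * psis u \<phi> w)"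
  using psis_linear[of u a \<phi> 0 \<phi>] by simp

lemma psis_sum: "psis u (\<lambda>w. \<Sum>x\<in>A. \<phi> x w) = (\<lambda>w. \<Sum>x\<in>A. psis u (\<phi> x) w)"
proof (induction A rule: infinite_finite_induct)
  case (insert x A)
  have "psis u (\<lambda>w. \<phi> x w + (\<Sum>x\<in>A. \<phi> x w)) = (\<lambda>w. psis u (\<phi> x) w + psis u (\<lambda>w. \<Sum>x\<in>A. \<phi> x w) w)"
    using psis_linear[of u 1 "\<phi> x" 1 "\<lambda>w. \<Sum>x\<in>A. \<phi> x w"] by simp
  then show ?case using insert by simp
qed (simp_all add: psis_zero)

lemma psis_append: "psis (u @ v) \<phi> = psis v (psis u \<phi>)"
  by (induction u arbitrary: \<phi>) auto

text \<open>A derivation stays within a block, so starting from a head of block at most q the action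
  reads the functional only on words with such heads.\<close>

lemma psi_cong:
  assumes low: "w = [] \<or> blk (hd w) \<le> q" "blk i \<le> q"
    and eq: "\<And>l u. blk l \<le> q \<Longrightarrow> \<phi> (l # u) = \<chi> (l # u)"
  shows "psi i \<phi> w = psi i \<chi> w"
proof (cases w)
  case Nil then show ?thesis using eq low by simp
next
  case (Cons l w')
  have l: "blk l \<le> q" using low Cons by simp
  have "(\<lambda>u. \<phi> (l # u)) = (\<lambda>u. \<chi> (l # u))" using eq l by auto
  moreover have "dder i l (\<lambda>x y. \<phi> (y # x # w')) = dder i l (\<lambda>x y. \<chi> (y # x # w'))"
    by (rule twisted_der_cong) (use eq l in \<open>auto simp: dcoef_def split: if_splits\<close>)
  ultimately show ?thesis using Cons eq low by simp
qed

text \<open>The relation of j and F acting on a functional; it must vanish for the action to descend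
  to the quotient.\<close>

definition psi_rel :: "nat \<Rightarrow> nat set \<Rightarrow> (nat list \<Rightarrow> 'k) \<Rightarrow> nat list \<Rightarrow> 'k" where
  "psi_rel j F \<phi> w = (\<Sum>k\<in>F - {j}. c j k * (psi j (psi k \<phi>) w - s * psi k (psi j \<phi>) w))"

text \<open>Two derivations in succession on the letter l: first that of j, then that of k by the
  twisted Leibniz rule D(xy) = x D(y) + s D(x) y.\<close>

definition ddd :: "nat \<Rightarrow> nat \<Rightarrow> nat \<Rightarrow> (nat \<Rightarrow> nat \<Rightarrow> nat \<Rightarrow> 'k) \<Rightarrow> 'k" where
  "ddd j k l \<theta> = dder j l (\<lambda>x y. s * dder k x (\<lambda>u v. \<theta> u v y) + dder k y (\<lambda>u v. \<theta> x u v))"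

lemma psi_low:
  assumes "w = [] \<or> blk (hd w) \<le> blk j"
  shows "psi j \<phi> w = \<phi> (j # w)"
  using assms by (cases w) auto

text \<open>Passing l with two letters gives four terms. In the s-commutator of j and k the mixed
  terms cancel because s * s = 1, which leaves the relation on the shorter word and the s-commutator
  of the derivations on l.\<close>

lemma psi_psi_high:
  assumes hi: "blk j < blk l" "blk k < blk l"
  shows "psi j (psi k \<phi>) (l # w) = psi j (psi k (\<lambda>u. \<phi> (l # u))) w
    + s * dder k l (\<lambda>x y. psi j (\<lambda>u. \<phi> (y # x # u)) w)
    + dder j l (\<lambda>x y. psi k (\<lambda>u. \<phi> (y # x # u)) w)
    + ddd j k l (\<lambda>x y z. \<phi> (z # y # x # w))"
proof -
  have "psi j (\<lambda>u. psi k \<phi> (l # u)) w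
    = psi j (\<lambda>u. s * psi k (\<lambda>u. \<phi> (l # u)) u + 1 * dder k l (\<lambda>x y. \<phi> (y # x # u))) w"
    using hi by simp
  also have "\<dots> = s * psi j (psi k (\<lambda>u. \<phi> (l # u))) w + dder k l (\<lambda>x y. psi j (\<lambda>u. \<phi> (y # x # u)) w)"
    unfolding psi_linear psi_dder by simp
  finally have 1: "psi j (\<lambda>u. psi k \<phi> (l # u)) w
    = s * psi j (psi k (\<lambda>u. \<phi> (l # u))) w + dder k l (\<lambda>x y. psi j (\<lambda>u. \<phi> (y # x # u)) w)" .
  have 2: "psi k \<phi> (y # x # w) = psi k (\<lambda>u. \<phi> (y # x # u)) w
      + (s * dder k x (\<lambda>u v. \<phi> (y # v # u # w)) + dder k y (\<lambda>u v. \<phi> (v # u # x # w)))"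
    if "blk x = blk l" "blk y = blk l" for x y
    using that hi by (simp add: algebra_simps)
  have "dder j l (\<lambda>x y. psi k \<phi> (y # x # w))
    = dder j l (\<lambda>x y. 1 * psi k (\<lambda>u. \<phi> (y # x # u)) w
      + 1 * (s * dder k x (\<lambda>u v. \<phi> (y # v # u # w)) + dder k y (\<lambda>u v. \<phi> (v # u # x # w))))"
    by (rule twisted_der_cong) (use 2 in \<open>auto simp: dcoef_def split: if_splits\<close>)
  also have "\<dots> = dder j l (\<lambda>x y. psi k (\<lambda>u. \<phi> (y # x # u)) w) + ddd j k l (\<lambda>x y z. \<phi> (z # y # x # w))"
    unfolding twisted_der_linear ddd_def by simp
  finally show ?thesis using hi 1 by (simp add: algebra_simps)
qed

text \<open>Linearity turns the sum over k into the single derivation with coefficients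
  \<open>wcoef j F\<close>, to which \<open>twisted_der_commute\<close> applies.\<close>

lemma ddd_relation:
  assumes F: "F = line j i" "i \<in> E" "j \<in> E" "i \<noteq> j"
  shows "(\<Sum>k\<in>F - {j}. c j k * (ddd j k l \<theta> - s * ddd k j l \<theta>)) = 0"
proof -
  let ?w = "wcoef j F"
  have w: "twisted_der s E ?w x \<beta> = (\<Sum>k\<in>F - {j}. c j k * dder k x \<beta>)" for x \<beta>
    unfolding wcoef_def by (rule twisted_der_sum)
  have "(\<Sum>k\<in>F - {j}. c j k * ddd j k l \<theta>) = dder j l (\<lambda>x y. s * twisted_der s E ?w x (\<lambda>u v. \<theta> u v y)
      + twisted_der s E ?w y (\<lambda>u v. \<theta> x u v))"
    unfolding w ddd_def unfolding twisted_der_def[of s E "dcoef j"]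
    by (simp add: sum_distrib_left sum.swap[of _ "F - {j}" E] flip: sum.distrib sum_subtractf)
       (intro sum.cong refl, simp add: algebra_simps)
  moreover have "(\<Sum>k\<in>F - {j}. c j k * ddd k j l \<theta>) = twisted_der s E ?w l (\<lambda>x y. s * dder j x (\<lambda>u v. \<theta> u v y)
      + dder j y (\<lambda>u v. \<theta> x u v))"
    unfolding w ddd_def ..
  moreover have "dder j l (\<lambda>x y. s * twisted_der s E ?w x (\<lambda>u v. \<theta> u v y) + twisted_der s E ?w y (\<lambda>u v. \<theta> x u v))
    = s * twisted_der s E ?w l (\<lambda>x y. s * dder j x (\<lambda>u v. \<theta> u v y) + dder j y (\<lambda>u v. \<theta> x u v))"
    by (rule twisted_der_commute[OF s_square])
       (use wcoef_inner[OF F] wcoef_kill[OF F] in blast)+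
  moreover have "(\<Sum>k\<in>F - {j}. c j k * (ddd j k l \<theta> - s * ddd k j l \<theta>))
    = (\<Sum>k\<in>F - {j}. c j k * ddd j k l \<theta>) - s * (\<Sum>k\<in>F - {j}. c j k * ddd k j l \<theta>)"
    by (simp add: right_diff_distrib sum_subtractf sum_distrib_left mult.left_commute[of _ s])
  ultimately show ?thesis by simp
qed

text \<open>A head l above the block of j is stripped off by \<open>psi_psi_high\<close> and
  \<open>ddd_relation\<close>. Otherwise all points of the line except i act by prepending, and
  \<open>dcoef i j\<close> is made so that the term of i cancels theirs.\<close>

lemma psi_rel_zero:
  assumes i: "i \<in> E" and j: "j \<in> E" and ij: "blk i < blk j"
  shows "psi_rel j (line j i) \<phi> w = 0"
proof (induction w arbitrary: \<phi>)
  have low: "psi_rel j (line j i) \<phi> w = 0" if w: "w = [] \<or> blk (hd w) \<le> blk j" for w \<phi>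
  proof -
    let ?F = "line j i"
    have finF: "finite ?F" using line_subset[OF j i] finite_E finite_subset by blast
    have iF: "i \<in> ?F - {j}" using ij unfolding line_def by auto
    have k: "blk k = blk j"
      if "k \<in> ?F - {j} - {i}" for k using retro_line[OF i j ij, of k] that by blast
    have t: "c j k * (psi j (psi k \<phi>) w - s * psi k (psi j \<phi>) w)
        = c j k * (\<phi> (k # j # w) - s * \<phi> (j # k # w))" if "k \<in> ?F - {j} - {i}" for k
      using k[OF that] w psi_low[of w] psi_low[of "j # w" k] psi_low[of "k # w" j] by auto
    have "psi i (psi j \<phi>) w = psi i (\<lambda>u. \<phi> (j # u)) w"
      by (rule psi_cong[of _ "blk j"]) (use w ij psi_low in auto)
    moreover have "psi j (psi i \<phi>) w = s * psi i (\<lambda>u. \<phi> (j # u)) w + dder i j (\<lambda>x y. \<phi> (y # x # w))"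
      using w ij by (simp add: psi_low)
    ultimately have "c j i * (psi j (psi i \<phi>) w - s * psi i (psi j \<phi>) w) = c j i * dder i j (\<lambda>x y. \<phi> (y # x # w))"
      by simp
    also have "\<dots> = (\<Sum>m\<in>E. c j i * (dcoef i j m * (\<phi> (m # j # w) - s * \<phi> (j # m # w))))"
      unfolding twisted_der_def by (simp add: sum_distrib_left)
    also have "\<dots> = (\<Sum>m\<in>?F - {j} - {i}. c j i * (dcoef i j m * (\<phi> (m # j # w) - s * \<phi> (j # m # w))))"
    proof (rule sum.mono_neutral_right)
      show "?F - {j} - {i} \<subseteq> E" using line_subset[OF j i] by blast
      have "dcoef i j m = 0" if "m \<notin> ?F - {j} - {i}" for m
      proof (cases "{i,j,m} \<in> \<C>")
        case True then show ?thesis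
          using that tri_distinct[OF True] unfolding line_def by (auto simp: insert_commute)
      qed (simp add: dcoef_def)
      then show "\<forall>m\<in>E - (?F - {j} - {i}). c j i * (dcoef i j m * (\<phi> (m # j # w) - s * \<phi> (j # m # w))) = 0"
        by simp
    qed (rule finite_E)
    also have "\<dots> = (\<Sum>m\<in>?F - {j} - {i}. - (c j m * (\<phi> (m # j # w) - s * \<phi> (j # m # w))))"
    proof (rule sum.cong[OF refl])
      fix m assume m: "m \<in> ?F - {j} - {i}"
      have "{i,j,m} \<in> \<C>" using m unfolding line_def by (auto simp: insert_commute)
      then have "dcoef i j m = - (c j i * c j m)" using k[OF m] ij unfolding dcoef_def by simp
      moreover have "j \<noteq> i" using ij by auto
      ultimately show "c j i * (dcoef i j m * (\<phi> (m # j # w) - s * \<phi> (j # m # w)))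
          = - (c j m * (\<phi> (m # j # w) - s * \<phi> (j # m # w)))"
        using c_square[OF j i] by (simp add: mult.assoc)
    qed
    finally have "c j i * (psi j (psi i \<phi>) w - s * psi i (psi j \<phi>) w)
      = - (\<Sum>m\<in>?F - {j} - {i}. c j m * (\<phi> (m # j # w) - s * \<phi> (j # m # w)))" by (simp add: sum_negf)
    moreover have "psi_rel j ?F \<phi> w = c j i * (psi j (psi i \<phi>) w - s * psi i (psi j \<phi>) w)
      + (\<Sum>k\<in>?F - {j} - {i}. c j k * (psi j (psi k \<phi>) w - s * psi k (psi j \<phi>) w))"
      unfolding psi_rel_def using finF iF by (intro sum.remove) auto
    moreover have "(\<Sum>k\<in>?F - {j} - {i}. c j k * (psi j (psi k \<phi>) w - s * psi k (psi j \<phi>) w))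
       = (\<Sum>k\<in>?F - {j} - {i}. c j k * (\<phi> (k # j # w) - s * \<phi> (j # k # w)))"
      by (rule sum.cong[OF refl]) (rule t)
    ultimately show ?thesis by simp
  qed
  case Nil show ?case by (rule low) simp
  case (Cons l w)
  show ?case
  proof (cases "blk l \<le> blk j")
    case True then show ?thesis by (intro low) simp
  next
    case False
    let ?F = "line j i"
    have hi: "blk k < blk l" if "k \<in> ?F" for k
      using retro_line[OF i j ij that] False ij by (cases "k = i") auto
    have hj: "blk j < blk l" using False by simp
    have "psi_rel j ?F \<phi> (l # w) = (\<Sum>k\<in>?F - {j}. c j k *
        (psi j (psi k (\<lambda>u. \<phi> (l # u))) w - s * psi k (psi j (\<lambda>u. \<phi> (l # u))) w)
       + c j k * (ddd j k l (\<lambda>x y z. \<phi> (z # y # x # w)) - s * ddd k j l (\<lambda>x y z. \<phi> (z # y # x # w))))"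
      unfolding psi_rel_def
    proof (intro sum.cong refl)
      fix k assume k: "k \<in> ?F - {j}"
      then have "blk k < blk l" using hi by blast
      from psi_psi_high[OF hj this] psi_psi_high[OF this hj]
      show "c j k * (psi j (psi k \<phi>) (l # w) - s * psi k (psi j \<phi>) (l # w)) = c j k *
        (psi j (psi k (\<lambda>u. \<phi> (l # u))) w - s * psi k (psi j (\<lambda>u. \<phi> (l # u))) w)
       + c j k * (ddd j k l (\<lambda>x y z. \<phi> (z # y # x # w)) - s * ddd k j l (\<lambda>x y z. \<phi> (z # y # x # w)))"
        by (simp only:) (simp add: algebra_simps)
    qed
    also have "\<dots> = psi_rel j ?F (\<lambda>u. \<phi> (l # u)) w"
      using ddd_relation[OF refl i j, of l "\<lambda>x y z. \<phi> (z # y # x # w)"] ij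
      unfolding psi_rel_def by (auto simp: sum.distrib)
    finally show ?thesis using Cons by simp
  qed
qed

text \<open>Each letter meets a head in a block not above its own, so it is simply
  prepended.\<close>

lemma psis_sorted:
  "sorted_wrt (\<lambda>a b. blk a \<ge> blk b) w \<Longrightarrow> psis w \<phi> [] = \<phi> w"
proof (induction w arbitrary: \<phi>)
  case (Cons i w)
  then have "psis (i # w) \<phi> [] = psi i \<phi> w" by simp
  also have "\<dots> = \<phi> (i # w)" using Cons.prems by (intro psi_low) (cases w, auto)
  finally show ?case .
qed simp

end

section \<open>The quadratic relations\<close>

context twisted_matroid
begin

text \<open>The quadratic dual of both algebras in common terms: orthogonality to the
  (anti)commutators, the squares and the boundaries of three-element circuits. The function c a b *
  g [a,b] is alternating, and the last condition makes it a cocycle, hence a coboundary, on every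
  line.\<close>

definition rels :: "'k ncpoly set" where
  "rels = {g. ncp E g \<and> homog 2 g \<and> (\<forall>a\<in>E. g [a,a] = 0) \<and> (\<forall>a\<in>E. \<forall>b\<in>E. g [b,a] = - (s * g [a,b]))
     \<and> (\<forall>a b d. {a,b,d} \<in> \<C> \<longrightarrow> c a b * g [a,b] + c b d * g [b,d] + c d a * g [d,a] = 0)}"

lemma relsD:
  assumes "g \<in> rels"
  shows "ncp E g" "homog 2 g" "a \<in> E \<Longrightarrow> g [a,a] = 0"
    "a \<in> E \<Longrightarrow> b \<in> E \<Longrightarrow> g [b,a] = - (s * g [a,b])"
    "{a,b,d} \<in> \<C> \<Longrightarrow> c a b * g [a,b] + c b d * g [b,d] + c d a * g [d,a] = 0"
  using assms unfolding rels_def by blast+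

lemma relsI:
  assumes "ncp E g" "homog 2 g" "\<And>a. a \<in> E \<Longrightarrow> g [a,a] = 0"
    "\<And>a b. a \<in> E \<Longrightarrow> b \<in> E \<Longrightarrow> g [b,a] = - (s * g [a,b])"
    "\<And>a b d. {a,b,d} \<in> \<C> \<Longrightarrow> c a b * g [a,b] + c b d * g [b,d] + c d a * g [d,a] = 0"
  shows "g \<in> rels"
  using assms unfolding rels_def by blast

lemma rels_ncp: "g \<in> rels \<Longrightarrow> ncp E g"
  unfolding rels_def by blast

lemma rels_support:
  assumes "g \<in> rels" "g w \<noteq> 0" shows "\<exists>a\<in>E. \<exists>b\<in>E. w = [a,b]"
proof -
  have "length w = 2" "set w \<subseteq> E" using assms unfolding rels_def ncp_def homog_def by auto
  then show ?thesis by (cases w rule: remdups_adj.cases) auto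
qed

lemma deval_rels:
  assumes "g \<in> rels" shows "deval \<phi> g = (\<Sum>a\<in>E. \<Sum>b\<in>E. g [a,b] * \<phi> [a,b])"
proof -
  let ?S = "(\<lambda>(a,b). [a,b]) ` (E \<times> E)"
  have "deval \<phi> g = (\<Sum>w\<in>?S. g w * \<phi> w)"
  proof (rule deval_superset)
    show "{w. g w \<noteq> 0} \<subseteq> ?S" using rels_support[OF assms] by force
  qed (use finite_E in simp)
  also have "\<dots> = (\<Sum>p\<in>E \<times> E. g [fst p, snd p] * \<phi> [fst p, snd p])"
    by (subst sum.reindex) (auto simp: inj_on_def split_beta)
  finally show ?thesis by (simp add: sum.cartesian_product split_beta)
qed

text \<open>Retrograde coefficients determine a relation: two points a, b of one block have a low
  point i on their line, and the cocycle condition on {i,a,b} expresses the value at ab through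
  pairs from different blocks.\<close>

lemma rels_zero:
  assumes g: "g \<in> rels" and z: "\<And>i j. i \<in> E \<Longrightarrow> j \<in> E \<Longrightarrow> blk i < blk j \<Longrightarrow> g [j,i] = 0"
    and ab: "a \<in> E" "b \<in> E"
  shows "g [a,b] = 0"
proof -
  have anti: "g [b,a] = - (s * g [a,b])" if "a \<in> E" "b \<in> E" for a b
    using g that unfolding rels_def by blast
  have z': "g [a,b] = 0" if "a \<in> E" "b \<in> E" "blk a \<noteq> blk b" for a b
    using z[of a b] z[of b a] anti[of b a] that by (cases "blk a < blk b") auto
  consider "a = b" | "blk a \<noteq> blk b" | "a \<noteq> b" "blk a = blk b" by blast
  then show ?thesis
  proof cases
    case 1 then show ?thesis using g ab unfolding rels_def by blast
  next
    case 2 then show ?thesis using z' ab by blast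
  next
    case 3
    then obtain i where i: "i \<in> E" "blk i < blk a" "{i,a,b} \<in> \<C>" using tri_meet[of a b] ab by blast
    then have "c i a * g [i,a] + c a b * g [a,b] + c b i * g [b,i] = 0"
      using g unfolding rels_def by blast
    then have "c a b * g [a,b] = 0" using z'[of i a] z'[of b i] i ab 3 by simp
    then show ?thesis using c_square[OF ab 3(1)] by auto
  qed
qed

definition relF :: "nat \<Rightarrow> nat set \<Rightarrow> 'k ncpoly" where
  "relF j F = (\<Sum>k\<in>F - {j}. smult (c j k) (mono [j,k] - smult s (mono [k,j])))"

lemma relF_apply:
  assumes F: "F \<subseteq> E" and ab: "a \<noteq> b"
  shows "relF j F [a,b] = (if a = j \<and> b \<in> F then c j b else 0) - (if b = j \<and> a \<in> F then s * c j a else 0)"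
proof -
  have fin: "finite (F - {j})" using F finite_E finite_subset by blast
  have "relF j F [a,b] = (\<Sum>k\<in>F - {j}. (if k = b then if a = j then c j b else 0 else 0)
      - (if k = a then if b = j then s * c j a else 0 else 0))"
    unfolding relF_def sum_fun_apply by (intro sum.cong refl) (auto simp: mono_apply)
  also have "\<dots> = (if b \<in> F - {j} then if a = j then c j b else 0 else 0)
      - (if a \<in> F - {j} then if b = j then s * c j a else 0 else 0)"
    unfolding sum_subtractf using fin by simp
  finally show ?thesis using ab by auto
qed

lemma relF_support:
  assumes "relF j F w \<noteq> 0" shows "\<exists>k\<in>F - {j}. w = [j,k] \<or> w = [k,j]"
proof -
  obtain k where k: "k \<in> F - {j}" "smult (c j k) (mono [j,k] - smult s (mono [k,j])) w \<noteq> 0"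
    using assms unfolding relF_def sum_fun_apply by (meson sum.not_neutral_contains_not_neutral)
  then have "w = [j,k] \<or> w = [k,j]" by (auto simp: mono_apply split: if_splits)
  then show ?thesis using k(1) by blast
qed

lemma ncp_relF: "F \<subseteq> E \<Longrightarrow> j \<in> E \<Longrightarrow> ncp E (relF j F)"
proof -
  assume F: "F \<subseteq> E" "j \<in> E"
  have "ncp E (smult (c j k) (mono [j,k] - smult s (mono [k,j])))" if "k \<in> F - {j}" for k
    by (intro ncp_smult ncp_diff ncp_mono) (use F that in auto)
  then show "ncp E (relF j F)" unfolding relF_def by (rule ncp_sum)
qed

text \<open>Scaled by c, the relation is on F the coboundary of the indicator of j. A triple through
  j has its other two points both on F or both off F, so the cocycle condition holds off F
  too.\<close>

lemma relF_rels:
  assumes F: "F = line j i" "i \<in> E" "j \<in> E" "i \<noteq> j"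
  shows "relF j F \<in> rels"
proof -
  have FE: "F \<subseteq> E" using F line_subset by blast
  have jF: "j \<in> F" using F unfolding line_def by blast
  have h: "c a b * relF j F [a,b] = (if a = j \<and> b \<in> F then 1 else 0) - (if b = j \<and> a \<in> F then 1 else 0)"
    if "a \<in> E" "b \<in> E" "a \<noteq> b" for a b
    using that c_square[of a b] c_square[of b a] c_swap[of a b] by (auto simp: relF_apply[OF FE])
  have inF: "b \<in> F \<longleftrightarrow> d \<in> F" if "{j,b,d} \<in> \<C>" for b d
  proof -
    have *: "d \<in> F" if t: "{j,b,d} \<in> \<C>" and b: "b \<in> F" for b d
    proof -
      have "line j b = F" using line_eq[of j j i b] b jF tri_distinct[OF t] F by auto
      then show ?thesis using t unfolding line_def by blast
    qed
    have "{j,d,b} \<in> \<C>" using that by (simp add: insert_commute)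
    then show ?thesis using * that by blast
  qed
  have "ncp E (relF j F)" using ncp_relF FE F by blast
  moreover have "homog 2 (relF j F)"
    unfolding homog_def using relF_support[of j F] by fastforce
  moreover have "relF j F [a,a] = 0" for a
  proof (rule ccontr)
    assume "relF j F [a,a] \<noteq> 0"
    then show False using relF_support[of j F "[a,a]"] by auto
  qed
  moreover have "relF j F [b,a] = - (s * relF j F [a,b])" if "a \<in> E" "b \<in> E" for a b
  proof (cases "a = b")
    case True then show ?thesis using \<open>\<And>a. relF j F [a,a] = 0\<close> by simp
  next
    case False
    then show ?thesis by (simp add: relF_apply[OF FE] algebra_simps)
  qed
  moreover have "c a b * relF j F [a,b] + c b d * relF j F [b,d] + c d a * relF j F [d,a] = 0"
    if t: "{a,b,d} \<in> \<C>" for a b d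
  proof -
    have "c a b * relF j F [a,b] + c b d * relF j F [b,d] + c d a * relF j F [d,a]
      = (if a = j \<and> b \<in> F then 1 else 0) - (if b = j \<and> a \<in> F then 1 else 0)
       + ((if b = j \<and> d \<in> F then 1 else 0) - (if d = j \<and> b \<in> F then 1 else 0))
       + ((if d = j \<and> a \<in> F then 1 else 0) - (if a = j \<and> d \<in> F then 1 else 0))"
      using h tri_in_E[OF t] tri_distinct[OF t] by simp
    also have "\<dots> = 0"
    proof -
      consider "a = j" | "b = j" | "d = j" | "a \<noteq> j" "b \<noteq> j" "d \<noteq> j" by blast
      then show ?thesis
      proof cases
        case 1 then show ?thesis using inF[of b d] t tri_distinct[OF t] by auto
      next
        case 2 then show ?thesis
          using inF[of a d] t tri_distinct[OF t] by (auto simp: insert_commute)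
      next
        case 3 then show ?thesis
          using inF[of a b] t tri_distinct[OF t] by (auto simp: insert_commute)
      qed simp
    qed
    finally show ?thesis .
  qed
  ultimately show ?thesis unfolding rels_def by blast
qed

definition rretro :: "nat \<Rightarrow> nat \<Rightarrow> 'k ncpoly" where
  "rretro j i = smult (c j i) (relF j (line j i))"

lemma rels_smult:
  assumes g: "g \<in> rels" shows "smult a g \<in> rels"
proof (rule relsI)
  show "ncp E (smult a g)" by (intro ncp_smult relsD(1)[OF g])
  show "homog 2 (smult a g)" using relsD(2)[OF g] unfolding homog_def by simp
  show "smult a g [x,x] = 0" if "x \<in> E" for x using relsD(3)[OF g that] by simp
  show "smult a g [y,x] = - (s * smult a g [x,y])" if "x \<in> E" "y \<in> E" for x y
    using relsD(4)[OF g that] by (simp add: mult.left_commute)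
  fix x y z assume t: "{x,y,z} \<in> \<C>"
  have "c x y * smult a g [x,y] + c y z * smult a g [y,z] + c z x * smult a g [z,x]
    = a * (c x y * g [x,y] + c y z * g [y,z] + c z x * g [z,x])"
    by (simp add: algebra_simps)
  then show "c x y * smult a g [x,y] + c y z * smult a g [y,z] + c z x * smult a g [z,x] = 0"
    using relsD(5)[OF g t] by simp
qed

lemma rels_diff:
  assumes g: "g \<in> rels" and h: "h \<in> rels" shows "g - h \<in> rels"
proof (rule relsI)
  show "ncp E (g - h)" by (intro ncp_diff relsD(1)[OF g] relsD(1)[OF h])
  show "homog 2 (g - h)" unfolding homog_def
  proof (intro allI impI)
    fix w assume "(g - h) w \<noteq> 0"
    then have "g w \<noteq> 0 \<or> h w \<noteq> 0" by auto
    then show "length w = 2" using relsD(2)[OF g] relsD(2)[OF h] unfolding homog_def by blast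
  qed
  show "(g - h) [x,x] = 0" if "x \<in> E" for x using relsD(3)[OF g that] relsD(3)[OF h that] by simp
  show "(g - h) [y,x] = - (s * (g - h) [x,y])" if "x \<in> E" "y \<in> E" for x y
    using relsD(4)[OF g that] relsD(4)[OF h that] by (simp add: algebra_simps)
  fix x y z assume t: "{x,y,z} \<in> \<C>"
  have "c x y * (g - h) [x,y] + c y z * (g - h) [y,z] + c z x * (g - h) [z,x]
     = (c x y * g [x,y] + c y z * g [y,z] + c z x * g [z,x])
       - (c x y * h [x,y] + c y z * h [y,z] + c z x * h [z,x])" by (simp add: algebra_simps)
  then show "c x y * (g - h) [x,y] + c y z * (g - h) [y,z] + c z x * (g - h) [z,x] = 0"
    using relsD(5)[OF g t] relsD(5)[OF h t] by simp
qed

lemma rels_0: "0 \<in> rels"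
  unfolding rels_def homog_def using ncp_0 by auto

lemma rels_sum: "(\<And>x. x \<in> A \<Longrightarrow> f x \<in> rels) \<Longrightarrow> (\<Sum>x\<in>A. f x) \<in> rels"
proof (induction A rule: infinite_finite_induct)
  case (insert x A)
  have "f x - smult (-1) (\<Sum>x\<in>A. f x) \<in> rels"
    using insert by (intro rels_diff rels_smult) auto
  moreover have "f x - smult (-1) (\<Sum>x\<in>A. f x) = (\<Sum>x\<in>insert x A. f x)"
    using insert by (intro ext) (simp add: sum_fun_apply)
  ultimately show ?case by simp
next
  case (infinite A)
  have "(\<Sum>x\<in>A. f x) = 0" by (rule sum.infinite[OF infinite.hyps])
  then show ?case using rels_0 by metis
next
  case empty
  then show ?case using rels_0 by (metis sum.empty)
qed

definition retro_pairs :: "(nat \<times> nat) set" where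
  "retro_pairs = {(j,i). i \<in> E \<and> j \<in> E \<and> blk i < blk j}"

lemma finite_retro_pairs: "finite retro_pairs"
  by (rule finite_subset[of _ "E \<times> E"]) (use finite_E in \<open>auto simp: retro_pairs_def\<close>)

lemma rretro_rels: "(j,i) \<in> retro_pairs \<Longrightarrow> rretro j i \<in> rels"
  unfolding rretro_def retro_pairs_def by (intro rels_smult relF_rels[OF refl]) auto

text \<open>These relations are dual to the retrograde coefficients, which yields both the expansion
  of arbitrary relations and the reducedness of the Groebner basis.\<close>

lemma rretro_retro:
  assumes "(j,i) \<in> retro_pairs" "(j',i') \<in> retro_pairs"
  shows "rretro j i [j',i'] = (if j' = j \<and> i' = i then 1 else 0)"
proof -
  have e: "i \<in> E" "j \<in> E" "blk i < blk j" "i' \<in> E" "j' \<in> E" "blk i' < blk j'"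
    using assms unfolding retro_pairs_def by auto
  have FE: "line j i \<subseteq> E" using line_subset e by blast
  have b: "blk k = blk j" if "k \<in> line j i" "k \<noteq> i" for k using retro_line[OF e(1-3) that] by blast
  have iF: "i \<in> line j i" unfolding line_def by blast
  have "j' \<noteq> i'" using e by auto
  then have "rretro j i [j',i'] = c j i * ((if j' = j \<and> i' \<in> line j i then c j i' else 0) - (if i' = j \<and> j' \<in> line j i then s * c j j' else 0))"
    unfolding rretro_def by (simp add: relF_apply[OF FE])
  moreover have "j' = j \<and> i' \<in> line j i \<longleftrightarrow> j' = j \<and> i' = i"
    using b[of i'] e(6) iF by (metis less_irrefl)
  moreover have "\<not> (i' = j \<and> j' \<in> line j i)" using b[of j'] e by (cases "j' = i") auto
  ultimately show ?thesis using c_square[of j i] e by auto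
qed

lemma rels_expand:
  assumes g: "g \<in> rels" and ab: "a \<in> E" "b \<in> E"
  shows "g [a,b] = (\<Sum>p\<in>retro_pairs. g [fst p, snd p] * rretro (fst p) (snd p) [a,b])"
proof -
  let ?S = "\<Sum>p\<in>retro_pairs. smult (g [fst p, snd p]) (rretro (fst p) (snd p))"
  have "?S \<in> rels" by (intro rels_sum rels_smult rretro_rels) auto
  then have "g - ?S \<in> rels" by (rule rels_diff[OF g])
  then have "(g - ?S) [a,b] = 0"
  proof (rule rels_zero)
    fix i j assume "i \<in> E" "j \<in> E" "blk i < blk j"
    then have p: "(j,i) \<in> retro_pairs" unfolding retro_pairs_def by simp
    have "?S [j,i] = (\<Sum>p\<in>retro_pairs. if p = (j,i) then g [j,i] else 0)"
      unfolding sum_fun_apply using rretro_retro p by (intro sum.cong refl) (auto simp: prod_eq_iff)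
    also have "\<dots> = g [j,i]" using p finite_retro_pairs by simp
    finally show "(g - ?S) [j,i] = 0" by simp
  qed (use ab in auto)
  then show ?thesis by (simp add: sum_fun_apply)
qed

text \<open>By \<open>rels_expand\<close> only the relations of retrograde pairs matter, and for
  these \<open>psi_rel_zero\<close> applies.\<close>

lemma rels_psi_zero:
  assumes g: "g \<in> rels"
  shows "(\<Sum>a\<in>E. \<Sum>b\<in>E. g [a,b] * psi a (psi b \<phi>) w) = 0"
proof -
  let ?T = "\<lambda>a b. psi a (psi b \<phi>) w"
  have rel: "(\<Sum>a\<in>E. \<Sum>b\<in>E. rretro j i [a,b] * ?T a b) = 0" if p: "(j,i) \<in> retro_pairs" for j i
  proof -
    have e: "i \<in> E" "j \<in> E" "blk i < blk j" using p unfolding retro_pairs_def by auto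
    let ?F = "line j i"
    have FE: "?F \<subseteq> E" using line_subset e by blast
    have "(\<Sum>a\<in>E. \<Sum>b\<in>E. relF j ?F [a,b] * ?T a b)
      = (\<Sum>a\<in>E. \<Sum>b\<in>E. \<Sum>k\<in>?F - {j}. (if a = j \<and> b = k then c j k * ?T j k else 0)
            - (if b = j \<and> a = k then c j k * (s * ?T k j) else 0))"
      unfolding relF_def sum_fun_apply sum_distrib_right
      by (intro sum.cong refl) (auto simp: mono_apply)
    also have "\<dots> = (\<Sum>k\<in>?F - {j}. \<Sum>a\<in>E. \<Sum>b\<in>E. (if a = j \<and> b = k then c j k * ?T j k else 0)
            - (if b = j \<and> a = k then c j k * (s * ?T k j) else 0))"
      by (simp only: sum.swap[of _ _ "?F - {j}"] sum.swap[of _ E "?F - {j}"])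
    also have "\<dots> = (\<Sum>k\<in>?F - {j}. c j k * ?T j k - c j k * (s * ?T k j))"
    proof (intro sum.cong refl)
      fix k assume "k \<in> ?F - {j}"
      then have kE: "k \<in> E" using FE by blast
      have "(\<Sum>a\<in>E. \<Sum>b\<in>E. if a = j \<and> b = k then x else 0) = x" if "j \<in> E" "k \<in> E" for j k and x :: 'k
      proof -
        have "(\<Sum>a\<in>E. \<Sum>b\<in>E. if a = j \<and> b = k then x else 0) = (\<Sum>a\<in>E. if a = j then x else 0)"
          using that finite_E by (intro sum.cong refl) auto
        then show ?thesis using that finite_E by simp
      qed
      from this[OF e(2) kE, of "c j k * ?T j k"] this[OF kE e(2), of "c j k * (s * ?T k j)"]
      show "(\<Sum>a\<in>E. \<Sum>b\<in>E. (if a = j \<and> b = k then c j k * ?T j k else 0)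
            - (if b = j \<and> a = k then c j k * (s * ?T k j) else 0)) = c j k * ?T j k - c j k * (s * ?T k j)"
        by (simp add: sum_subtractf conj_commute)
    qed
    also have "\<dots> = psi_rel j ?F \<phi> w" unfolding psi_rel_def by (simp add: algebra_simps)
    also have "\<dots> = 0" using psi_rel_zero e by blast
    finally have "(\<Sum>a\<in>E. \<Sum>b\<in>E. relF j ?F [a,b] * ?T a b) = 0" .
    then have "c j i * (\<Sum>a\<in>E. \<Sum>b\<in>E. relF j ?F [a,b] * ?T a b) = 0" by simp
    then show ?thesis unfolding rretro_def by (simp add: sum_distrib_left mult_ac)
  qed
  have "(\<Sum>a\<in>E. \<Sum>b\<in>E. g [a,b] * ?T a b)
     = (\<Sum>a\<in>E. \<Sum>b\<in>E. \<Sum>p\<in>retro_pairs. g [fst p, snd p] * (rretro (fst p) (snd p) [a,b] * ?T a b))"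
  proof (intro sum.cong refl)
    fix a b assume "a \<in> E" "b \<in> E"
    then have "g [a,b] * ?T a b = (\<Sum>p\<in>retro_pairs. g [fst p, snd p] * rretro (fst p) (snd p) [a,b]) * ?T a b"
      using rels_expand[OF g] by simp
    then show "g [a,b] * ?T a b = (\<Sum>p\<in>retro_pairs. g [fst p, snd p] * (rretro (fst p) (snd p) [a,b] * ?T a b))"
      by (simp add: sum_distrib_right mult.assoc)
  qed
  also have "\<dots> = (\<Sum>p\<in>retro_pairs. \<Sum>a\<in>E. \<Sum>b\<in>E. g [fst p, snd p] * (rretro (fst p) (snd p) [a,b] * ?T a b))"
    by (simp only: sum.swap[of _ _ retro_pairs] sum.swap[of _ E retro_pairs])
  also have "\<dots> = (\<Sum>p\<in>retro_pairs. g [fst p, snd p] * (\<Sum>a\<in>E. \<Sum>b\<in>E. rretro (fst p) (snd p) [a,b] * ?T a b))"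
    by (simp add: sum_distrib_left)
  also have "\<dots> = 0" using rel by (intro sum.neutral) auto
  finally show ?thesis .
qed

section \<open>Independence of sorted words modulo J\<close>

abbreviation J :: "'k ncpoly set" where "J \<equiv> ideal_gen E rels"

lemma deval_J:
  assumes "f \<in> J" shows "deval (\<lambda>w. psis (rev w) \<phi> []) f = 0"
proof (rule deval_ideal_gen[OF _ _ assms])
  fix u v g assume g: "g \<in> rels"
  \<comment> \<open>In the transposed picture the right context v acts on the functional first, then
    the relation, and u last.\<close>
  let ?\<chi> = "psis (rev v) \<phi>"
  have "deval (\<lambda>w. psis (rev (u @ w @ v)) \<phi> []) g
      = (\<Sum>a\<in>E. \<Sum>b\<in>E. g [a,b] * psis (rev u) (psi a (psi b ?\<chi>)) [])"
    unfolding deval_rels[OF g] by (simp add: psis_append)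
  also have "\<dots> = psis (rev u) (\<lambda>w. \<Sum>a\<in>E. \<Sum>b\<in>E. g [a,b] * psi a (psi b ?\<chi>) w) []"
    by (simp add: psis_sum psis_scale)
  also have "\<dots> = 0" by (simp add: rels_psi_zero[OF g] psis_zero)
  finally show "deval (\<lambda>w. psis (rev (u @ w @ v)) \<phi> []) g = 0" .
qed (rule rels_ncp)

lemma J_std_zero:
  assumes f: "f \<in> J" and std: "\<And>w. f w \<noteq> 0 \<Longrightarrow> sorted (map blk w)" shows "f = 0"
proof
  fix u
  have fin: "finite {w. f w \<noteq> 0}" using ideal_gen_ncp[OF rels_ncp f] unfolding ncp_def by blast
  \<comment> \<open>This functional detects the coefficient of u; words of the module are
    reversed.\<close>
  let ?\<phi> = "\<lambda>w :: nat list. if w = rev u then 1 else (0::'k)"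
  have "0 = deval (\<lambda>w. psis (rev w) ?\<phi> []) f" using deval_J[OF f] by simp
  also have "\<dots> = (\<Sum>w | f w \<noteq> 0. if w = u then f w else 0)"
    unfolding deval_def
  proof (intro sum.cong refl)
    fix w assume "w \<in> {w. f w \<noteq> 0}"
    then have "sorted (map blk w)" using std by blast
    then have "sorted_wrt (\<lambda>a b. blk a \<ge> blk b) (rev w)"
      by (simp add: sorted_wrt_map sorted_wrt_rev)
    then show "f w * psis (rev w) ?\<phi> [] = (if w = u then f w else 0)" by (simp add: psis_sorted)
  qed
  also have "\<dots> = f u" using fin by simp
  finally show "f u = 0 u" by simp
qed

end

section \<open>The monomial order and the standard words\<close>

lemma divides_refl_append: "divides u (a @ u @ b)"
  unfolding divides_def by blast

lemma divides_same_length: "divides u w \<Longrightarrow> length u = length w \<Longrightarrow> u = w"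
  unfolding divides_def by auto

interpretation ncpoly_space: vector_space "smult :: 'k::field \<Rightarrow> 'k ncpoly \<Rightarrow> 'k ncpoly"
  by unfold_locales (auto simp: fun_eq_iff algebra_simps)

text \<open>Evaluation at the words of W serves as a coordinate system. It is applied to monomials
  and to the differences between a word and its normal form.\<close>

lemma dim_eq_card_coordinates:
  fixes V :: "'k::field ncpoly set"
  assumes W: "finite W" and B: "\<And>w. w \<in> W \<Longrightarrow> B w \<in> V"
    and coord: "\<And>v w. v \<in> W \<Longrightarrow> w \<in> W \<Longrightarrow> B w v = (if v = w then 1 else 0)"
    and span: "\<And>f. f \<in> V \<Longrightarrow> f = (\<Sum>w\<in>W. smult (f w) (B w))"
  shows "vector_space.dim (smult :: 'k \<Rightarrow> 'k ncpoly \<Rightarrow> 'k ncpoly) V = card W"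
proof (rule ncpoly_space.dim_unique)
  have inj: "inj_on B W"
  proof (rule inj_onI)
    fix v w assume "v \<in> W" "w \<in> W" "B v = B w"
    then show "v = w" using coord[of v v] coord[of v w] by (auto split: if_splits)
  qed
  show "B ` W \<subseteq> V" using B by blast
  show "V \<subseteq> ncpoly_space.span (B ` W)"
  proof
    fix f assume "f \<in> V"
    then have "f = (\<Sum>w\<in>W. smult (f w) (B w))" by (rule span)
    also have "\<dots> \<in> ncpoly_space.span (B ` W)"
      by (intro ncpoly_space.span_sum ncpoly_space.span_scale ncpoly_space.span_base) auto
    finally show "f \<in> ncpoly_space.span (B ` W)" .
  qed
  show "\<not> ncpoly_space.dependent (B ` W)"
  proof
    assume "ncpoly_space.dependent (B ` W)"
    then obtain u v where u: "v \<in> W" "u (B v) \<noteq> 0" "(\<Sum>b\<in>B ` W. smult (u b) b) = 0"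
      using ncpoly_space.dependent_finite[of "B ` W"] W by auto
    then have "(\<Sum>w\<in>W. smult (u (B w)) (B w)) v = 0" using inj by (simp add: sum.reindex)
    moreover have "(\<Sum>w\<in>W. smult (u (B w)) (B w)) v = (\<Sum>w\<in>W. if w = v then u (B v) else 0)"
      unfolding sum_fun_apply using coord u(1) by (intro sum.cong refl) auto
    ultimately show False using W u by simp
  qed
  show "card (B ` W) = card W" by (rule card_image[OF inj])
qed

lemma homog_dim:
  assumes "finite E"
  shows "vector_space.dim (smult :: 'k::field \<Rightarrow> 'k ncpoly \<Rightarrow> 'k ncpoly) {f. ncp E f \<and> homog d f}
    = card (words E d)"
proof (rule dim_eq_card_coordinates)
  show fin: "finite (words E d)" unfolding words_def using finite_lists_length_eq[OF assms] by simp
  show "(mono w :: 'k ncpoly) \<in> {f. ncp E f \<and> homog d f}" if "w \<in> words E d" for w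
    using that ncp_mono[of w E, where 'k = 'k]
    unfolding words_def homog_def by (auto simp: mono_apply split: if_splits)
  show "mono w v = (if v = w then 1 else 0)" for v w by (rule mono_apply)
  show "f = (\<Sum>w\<in>words E d. smult (f w) (mono w))"
    if "f \<in> {f. ncp E f \<and> homog d f}" for f :: "'k ncpoly"
    by (rule mono_decomp[OF fin]) (use that in \<open>auto simp: ncp_def homog_def words_def\<close>)
qed

context blocked_matroid
begin

text \<open>\<open>r - blk a\<close> reverses the blocks inside the natural numbers, so the relation
  stays well-founded; labels break ties to make it total.\<close>

definition letter_less :: "(nat \<times> nat) set" where
  "letter_less = inv_image (less_than <*lex*> less_than) (\<lambda>a. (r - blk a, a))"

text \<open>Degree-lexicographic order read from the right, lower blocks counting as larger letters.\<close>

definition prec :: "nat list \<Rightarrow> nat list \<Rightarrow> bool" where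
  "prec u v \<longleftrightarrow> (rev u, rev v) \<in> lenlex letter_less"

lemma letter_less_iff: "(a,b) \<in> letter_less \<longleftrightarrow> blk b < blk a \<or> blk a = blk b \<and> a < b"
  unfolding letter_less_def using blk_le_r[of a] blk_le_r[of b] by auto

lemma irrefl_letter_less: "irrefl letter_less"
  unfolding irrefl_def letter_less_iff by auto

lemma trans_letter_less: "trans letter_less"
  unfolding trans_def letter_less_iff by auto

lemma prec_irrefl: "\<not> prec u u"
  unfolding prec_def by (rule lenlex_irreflexive) (simp add: letter_less_iff)

lemma prec_trans: "prec u v \<Longrightarrow> prec v w \<Longrightarrow> prec u w"
  unfolding prec_def by (rule lenlex_trans[OF _ _ trans_letter_less])

lemma prec_asym: "prec u v \<Longrightarrow> \<not> prec v u"
  using prec_trans prec_irrefl by blast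

lemma prec_total: "u \<noteq> v \<Longrightarrow> prec u v \<or> prec v u"
proof -
  assume uv: "u \<noteq> v"
  have "total letter_less" unfolding total_on_def letter_less_iff by auto
  then have "total (lenlex letter_less)" by (rule total_lenlex)
  then show ?thesis unfolding prec_def total_on_def using uv by (metis UNIV_I rev_rev_ident)
qed

lemma prec_append: "prec u v \<Longrightarrow> prec (a @ u @ b) (a @ v @ b)"
proof -
  assume "prec u v"
  then have "(rev b @ rev u, rev b @ rev v) \<in> lenlex letter_less"
    unfolding prec_def using lenlex_append2[OF irrefl_letter_less] by blast
  then have "((rev b @ rev u) @ rev a, (rev b @ rev v) @ rev a) \<in> lenlex letter_less"
    by (rule lenlex_append1) simp
  then show ?thesis unfolding prec_def by simp
qed

lemma wf_prec: "wf {(u,v). prec u v}"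
proof -
  have "wf letter_less" unfolding letter_less_def by (intro wf_inv_image wf_lex_prod wf_less_than)
  then have "wf (inv_image (lenlex letter_less) rev)" by (intro wf_inv_image wf_lenlex)
  moreover have "inv_image (lenlex letter_less) rev = {(u,v). prec u v}"
    unfolding inv_image_def prec_def by auto
  ultimately show ?thesis by simp
qed

lemma monomial_order_prec: "monomial_order E prec"
  unfolding monomial_order_def
proof (intro conjI ballI impI)
  show "wf {(u,v). u \<in> lists E \<and> v \<in> lists E \<and> prec u v}"
    by (rule wf_subset[OF wf_prec]) auto
qed (use prec_irrefl prec_trans prec_total prec_append in blast)+

lemma lm_eqI:
  assumes "f u \<noteq> 0" "\<And>v. f v \<noteq> 0 \<Longrightarrow> v \<noteq> u \<Longrightarrow> prec v u"
  shows "lm prec f = u"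
  unfolding lm_def
proof (rule the_equality)
  fix u' assume u': "f u' \<noteq> 0 \<and> (\<forall>v. f v \<noteq> 0 \<longrightarrow> v \<noteq> u' \<longrightarrow> prec v u')"
  show "u' = u"
  proof (rule ccontr)
    assume "u' \<noteq> u"
    then have "prec u' u" "prec u u'" using assms u' by auto
    then show False using prec_asym by blast
  qed
qed (use assms in blast)

lemma lm_props:
  fixes f :: "'k::field ncpoly"
  assumes f: "ncp E f" "f \<noteq> 0"
  shows "f (lm prec f) \<noteq> 0" "\<And>v. f v \<noteq> 0 \<Longrightarrow> v \<noteq> lm prec f \<Longrightarrow> prec v (lm prec f)"
proof -
  have max: "\<exists>u\<in>S. \<forall>v\<in>S. v \<noteq> u \<longrightarrow> prec v u" if "finite S" "S \<noteq> {}" for S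
    using that
  proof (induction S rule: finite_ne_induct)
    case (singleton x) then show ?case by simp
  next
    case (insert x S)
    then obtain u where u: "u \<in> S" "\<forall>v\<in>S. v \<noteq> u \<longrightarrow> prec v u" by blast
    show ?case
    proof (cases "prec x u")
      case True then show ?thesis using u by auto
    next
      case False
      then have "prec u x" using prec_total[of x u] u insert by auto
      then have "\<forall>v\<in>insert x S. v \<noteq> x \<longrightarrow> prec v x" using u prec_trans by (metis insert_iff)
      then show ?thesis by blast
    qed
  qed
  have "finite {w. f w \<noteq> 0}" using f unfolding ncp_def by blast
  moreover have "{w. f w \<noteq> 0} \<noteq> {}" using f(2) by (auto simp: fun_eq_iff)
  ultimately have "\<exists>u\<in>{w. f w \<noteq> 0}. \<forall>v\<in>{w. f w \<noteq> 0}. v \<noteq> u \<longrightarrow> prec v u" by (rule max)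
  then obtain u where u: "f u \<noteq> 0" "\<forall>v. f v \<noteq> 0 \<longrightarrow> v \<noteq> u \<longrightarrow> prec v u" by auto
  then have "lm prec f = u" by (intro lm_eqI) auto
  then show "f (lm prec f) \<noteq> 0" "\<And>v. f v \<noteq> 0 \<Longrightarrow> v \<noteq> lm prec f \<Longrightarrow> prec v (lm prec f)"
    using u by auto
qed

section \<open>Sorted words and their factorization by blocks\<close>

definition std :: "nat list set" where
  "std = {w \<in> lists E. sorted (map blk w)}"

lemma unsorted_factor:
  "\<not> sorted (map blk w) \<Longrightarrow> \<exists>a j i b. w = a @ [j,i] @ b \<and> blk i < blk j"
proof (induction w)
  case (Cons x w)
  show ?case
  proof (cases "sorted (map blk w)")
    case True
    then obtain y v where w: "w = y # v" using Cons.prems by (cases w) auto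
    have "blk y < blk x" using True Cons.prems unfolding w by auto
    then show ?thesis unfolding w by (intro exI[of _ "[]"] exI[of _ x] exI[of _ y] exI[of _ v]) simp
  next
    case False
    then obtain a j i b where "w = a @ [j,i] @ b" "blk i < blk j" using Cons.IH by blast
    then show ?thesis by (intro exI[of _ "x # a"] exI[of _ j] exI[of _ i] exI[of _ b]) simp
  qed
qed simp

lemma std_no_factor: "w \<in> std \<Longrightarrow> divides [j,i] w \<Longrightarrow> \<not> blk i < blk j"
  unfolding std_def divides_def by (auto simp: sorted_append)

definition stdq :: "nat \<Rightarrow> nat list set" where
  "stdq q = {w \<in> std. \<forall>x\<in>set w. blk x \<le> q}"

lemma stdq_r: "stdq r = std"
  unfolding stdq_def using blk_le_r by auto

lemma stdq_0: "stdq 0 = {[]}"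
proof -
  have "w = []" if "w \<in> stdq 0" for w
  proof (cases w)
    case (Cons x v)
    then have "x \<in> E" "blk x = 0" using that unfolding stdq_def std_def by auto
    then show ?thesis using blk_props by fastforce
  qed
  moreover have "[] \<in> stdq 0" unfolding stdq_def std_def by simp
  ultimately show ?thesis by blast
qed

abbreviation cat :: "nat list \<times> nat list \<Rightarrow> nat list" where "cat \<equiv> \<lambda>(u,v). u @ v"

text \<open>The cut can be read off the product: it is where the letters of blocks at most q
  end.\<close>

lemma stdq_Suc:
  assumes q: "q < r"
  shows "bij_betw cat (stdq q \<times> lists (Eb (Suc q))) (stdq (Suc q))"
proof (rule bij_betw_imageI)
  have E: "x \<in> Eb (Suc q) \<longleftrightarrow> x \<in> E \<and> blk x = Suc q" for x using Eb_iff[of "Suc q" x] q by auto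
  have tw: "takeWhile (\<lambda>x. blk x \<le> q) (u @ v) = u" if "u \<in> stdq q" "v \<in> lists (Eb (Suc q))" for u v
  proof -
    have "takeWhile (\<lambda>x. blk x \<le> q) v = []" using that(2) E by (cases v) auto
    moreover have "\<forall>x\<in>set u. blk x \<le> q" using that(1) unfolding stdq_def by blast
    ultimately show ?thesis by (simp add: takeWhile_append2)
  qed
  show "inj_on cat (stdq q \<times> lists (Eb (Suc q)))"
  proof (rule inj_onI)
    fix p p' assume p: "p \<in> stdq q \<times> lists (Eb (Suc q))" "p' \<in> stdq q \<times> lists (Eb (Suc q))"
      and eq: "cat p = cat p'"
    obtain u v u' v' where pp: "p = (u,v)" "p' = (u',v')" by (cases p; cases p')
    have "u @ v = u' @ v'" using eq pp by simp
    moreover have "u = u'" using tw[of u v] tw[of u' v'] p pp calculation by simp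
    ultimately show "p = p'" using pp by simp
  qed
  show "cat ` (stdq q \<times> lists (Eb (Suc q))) = stdq (Suc q)"
  proof
    show "cat ` (stdq q \<times> lists (Eb (Suc q))) \<subseteq> stdq (Suc q)"
    proof (rule image_subsetI)
      fix p assume "p \<in> stdq q \<times> lists (Eb (Suc q))"
      then obtain u v where p: "p = (u,v)" and u: "u \<in> stdq q" and v: "v \<in> lists (Eb (Suc q))"
        by (elim SigmaE)
      have bv: "blk x = Suc q" "x \<in> E" if "x \<in> set v" for x using v E that by auto
      have "sorted (map blk v)" using bv by (simp add: sorted_map sorted_wrt_iff_nth_less)
      then have "u @ v \<in> stdq (Suc q)"
        using u bv unfolding stdq_def std_def by (force simp: sorted_append)
      then show "cat p \<in> stdq (Suc q)" using p by simp
    qed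
    show "stdq (Suc q) \<subseteq> cat ` (stdq q \<times> lists (Eb (Suc q)))"
    proof
      fix w assume w: "w \<in> stdq (Suc q)"
      let ?u = "takeWhile (\<lambda>x. blk x \<le> q) w" and ?v = "dropWhile (\<lambda>x. blk x \<le> q) w"
      have wuv: "w = ?u @ ?v" by simp
      have s: "sorted (map blk (?u @ ?v))" using w unfolding stdq_def std_def by simp
      then have sv: "sorted (map blk ?v)" and su: "sorted (map blk ?u)"
        by (simp_all only: map_append sorted_append)
      have wE: "set w \<subseteq> E" "\<forall>x\<in>set w. blk x \<le> Suc q" using w unfolding stdq_def std_def by auto
      have "blk x = Suc q" if x: "x \<in> set ?v" for x
      proof -
        obtain y v where yv: "?v = y # v" using x by (cases ?v) auto
        then have "\<not> blk y \<le> q" using hd_dropWhile[of "\<lambda>x. blk x \<le> q" w] by auto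
        moreover have "blk y \<le> blk x" using sv x unfolding yv by auto
        moreover have "blk x \<le> Suc q" using wE x set_dropWhileD by metis
        ultimately show ?thesis by simp
      qed
      then have "?v \<in> lists (Eb (Suc q))" using E wE set_dropWhileD by (metis in_listsI subsetD)
      moreover have "x \<in> E \<and> blk x \<le> q" if "x \<in> set ?u" for x
        using set_takeWhileD[OF that] wE by auto
      then have "?u \<in> stdq q" using su unfolding stdq_def std_def by auto
      ultimately show "w \<in> cat ` (stdq q \<times> lists (Eb (Suc q)))"
        by (intro rev_image_eqI[of "(?u, ?v)"]) auto
    qed
  qed
qed

lemma block_products_Suc:
  "block_products (Suc q) Eb = cat ` (block_products q Eb \<times> lists (Eb (Suc q)))"
proof
  show "block_products (Suc q) Eb \<subseteq> cat ` (block_products q Eb \<times> lists (Eb (Suc q)))"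
  proof
    fix w assume "w \<in> block_products (Suc q) Eb"
    then obtain ms where ms: "w = concat ms" "length ms = Suc q" "\<forall>p<Suc q. ms ! p \<in> lists (Eb (Suc p))"
      unfolding block_products_def by blast
    then obtain ns v where ns: "ms = ns @ [v]" "length ns = q" by (auto simp: length_Suc_conv_rev)
    have "ns ! p \<in> lists (Eb (Suc p))" if "p < q" for p
      using ms(3)[rule_format, of p] that ns by (simp add: nth_append)
    then have "concat ns \<in> block_products q Eb" unfolding block_products_def using ns by blast
    moreover have "v \<in> lists (Eb (Suc q))"
      using ms(3)[rule_format, of q] ns by (simp add: nth_append)
    ultimately show "w \<in> cat ` (block_products q Eb \<times> lists (Eb (Suc q)))"
      using ms ns by (intro rev_image_eqI[of "(concat ns, v)"]) auto
  qed
  show "cat ` (block_products q Eb \<times> lists (Eb (Suc q))) \<subseteq> block_products (Suc q) Eb"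
  proof (rule image_subsetI)
    fix p assume "p \<in> block_products q Eb \<times> lists (Eb (Suc q))"
    then obtain u v where p: "p = (u,v)" and "u \<in> block_products q Eb" and v: "v \<in> lists (Eb (Suc q))"
      by (elim SigmaE)
    from \<open>u \<in> block_products q Eb\<close> obtain ns where ns: "u = concat ns" "length ns = q" "\<forall>p<q. ns ! p \<in> lists (Eb (Suc p))"
      unfolding block_products_def by blast
    have "(ns @ [v]) ! p \<in> lists (Eb (Suc p))" if "p < Suc q" for p
      using ns v that
      by (cases "p < q") (auto simp: nth_append less_Suc_eq simp del: in_lists_conv_set)
    then have "u @ v \<in> block_products (Suc q) Eb"
      unfolding block_products_def using ns by (intro CollectI exI[of _ "ns @ [v]"]) auto
    then show "cat p \<in> block_products (Suc q) Eb" using p by simp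
  qed
qed

lemma block_products_std: "block_products r Eb = std"
proof -
  have "q \<le> r \<Longrightarrow> block_products q Eb = stdq q" for q
  proof (induction q)
    case 0 show ?case by (simp add: stdq_0) (auto simp: block_products_def)
  next
    case (Suc q)
    then show ?case using bij_betw_imp_surj_on[OF stdq_Suc, of q] block_products_Suc[of q] by simp
  qed
  then show ?thesis using stdq_r by simp
qed

section \<open>Counting sorted words\<close>

definition std_count :: "nat \<Rightarrow> nat \<Rightarrow> nat" where
  "std_count q d = card {w \<in> stdq q. length w = d}"

lemma finite_stdq: "finite {w \<in> stdq q. length w = d}"
  by (rule finite_subset[OF _ finite_lists_length_eq[OF finite_E, of d]])
     (auto simp: stdq_def std_def)

lemma std_count_Suc:
  assumes q: "q < r"
  shows "std_count (Suc q) d = (\<Sum>k\<le>d. std_count q k * card (Eb (Suc q)) ^ (d - k))"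
proof -
  let ?L = "\<lambda>n. {v. set v \<subseteq> Eb (Suc q) \<and> length v = n}"
  let ?P = "SIGMA k:{..d}. {u \<in> stdq q. length u = k} \<times> ?L (d - k)"
  have "Eb (Suc q) \<subseteq> E" using Eb_iff[of "Suc q"] q by auto
  then have finEb: "finite (Eb (Suc q))" using finite_E finite_subset by blast
  have inj: "inj_on cat (stdq q \<times> lists (Eb (Suc q)))"
    and img: "cat ` (stdq q \<times> lists (Eb (Suc q))) = stdq (Suc q)"
    using stdq_Suc[OF q] unfolding bij_betw_def by auto
  have "bij_betw (\<lambda>(k,u,v). u @ v) ?P {w \<in> stdq (Suc q). length w = d}"
  proof (rule bij_betw_imageI)
    show "inj_on (\<lambda>(k,u,v). u @ v) ?P"
    proof (rule inj_onI)
      fix p p' assume p: "p \<in> ?P" "p' \<in> ?P" "(\<lambda>(k,u,v). u @ v) p = (\<lambda>(k,u,v). u @ v) p'"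
      obtain k u v k' u' v' where pp: "p = (k,u,v)" "p' = (k',u',v')" by (cases p; cases p') auto
      have "(u,v) = (u',v')" using inj_onD[OF inj, of "(u,v)" "(u',v')"] p pp by auto
      then show "p = p'" using p pp by auto
    qed
    show "(\<lambda>(k,u,v). u @ v) ` ?P = {w \<in> stdq (Suc q). length w = d}"
    proof
      show "(\<lambda>(k,u,v). u @ v) ` ?P \<subseteq> {w \<in> stdq (Suc q). length w = d}"
      proof
        fix w assume "w \<in> (\<lambda>(k,u,v). u @ v) ` ?P"
        then obtain k u v where w: "w = u @ v" "k \<le> d" "u \<in> stdq q" "length u = k" "set v \<subseteq> Eb (Suc q)" "length v = d - k"
          by auto
        then have "w \<in> cat ` (stdq q \<times> lists (Eb (Suc q)))"
          by (intro rev_image_eqI[of "(u,v)"]) auto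
        then show "w \<in> {w \<in> stdq (Suc q). length w = d}" using img w by simp
      qed
      show "{w \<in> stdq (Suc q). length w = d} \<subseteq> (\<lambda>(k,u,v). u @ v) ` ?P"
      proof
        fix w assume w: "w \<in> {w \<in> stdq (Suc q). length w = d}"
        then have "w \<in> cat ` (stdq q \<times> lists (Eb (Suc q)))" using img by simp
        then obtain u v where "w = u @ v" "u \<in> stdq q" "v \<in> lists (Eb (Suc q))"
          by (elim imageE SigmaE) simp
        then show "w \<in> (\<lambda>(k,u,v). u @ v) ` ?P" using w
          by (intro rev_image_eqI[of "(length u,u,v)"]) auto
      qed
    qed
  qed
  then have "std_count (Suc q) d = card ?P"
    unfolding std_count_def by (simp add: bij_betw_same_card)
  also have "\<dots> = (\<Sum>k\<le>d. card ({u \<in> stdq q. length u = k} \<times> ?L (d - k)))"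
    by (rule card_SigmaI) (use finite_stdq finite_lists_length_eq[OF finEb] in auto)
  also have "\<dots> = (\<Sum>k\<le>d. std_count q k * card (Eb (Suc q)) ^ (d - k))"
    unfolding std_count_def card_cartesian_product card_lists_length_eq[OF finEb] ..
  finally show ?thesis .
qed

text \<open>As an equation with product 1, the induction cancels one geometric series per
  block.\<close>

lemma std_count_fps:
  "q \<le> r \<Longrightarrow> Abs_fps (\<lambda>d. rat_of_nat (std_count q d)) * (\<Prod>p\<in>{1..q}. 1 - of_nat (card (Eb p)) * fps_X) = 1"
proof (induction q)
  case 0
  have "{w \<in> stdq 0. length w = d} = (if d = 0 then {[]} else {})" for d by (auto simp: stdq_0)
  then have "std_count 0 d = (if d = 0 then 1 else 0)" for d unfolding std_count_def by simp
  then have "Abs_fps (\<lambda>d. rat_of_nat (std_count 0 d)) = 1" by (simp add: fps_eq_iff)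
  then show ?case by simp
next
  case (Suc q)
  let ?e = "card (Eb (Suc q))"
  have geo: "Abs_fps (\<lambda>d. rat_of_nat ?e ^ d) * (1 - of_nat ?e * fps_X) = 1"
  proof (rule fps_ext)
    fix n
    have "fps_nth (Abs_fps (\<lambda>d. rat_of_nat ?e ^ d) * (1 - of_nat ?e * fps_X)) n
      = rat_of_nat ?e ^ n - rat_of_nat ?e * fps_nth (Abs_fps (\<lambda>d. rat_of_nat ?e ^ d) * fps_X) n"
      by (simp add: algebra_simps fps_of_nat[symmetric] mult.assoc[of "fps_const _"])
    also have "\<dots> = fps_nth 1 n" by (cases n) (auto simp: fps_X_mult_right_nth)
    finally show "fps_nth (Abs_fps (\<lambda>d. rat_of_nat ?e ^ d) * (1 - of_nat ?e * fps_X)) n = fps_nth 1 n" .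
  qed
  have "Abs_fps (\<lambda>d. rat_of_nat (std_count (Suc q) d))
    = Abs_fps (\<lambda>d. rat_of_nat (std_count q d)) * Abs_fps (\<lambda>d. rat_of_nat ?e ^ d)"
    using std_count_Suc[of q] Suc.prems by (intro fps_ext) (simp add: fps_mult_nth atLeast0AtMost)
  then have eq: "Abs_fps (\<lambda>d. rat_of_nat (std_count (Suc q) d)) * (\<Prod>p\<in>{1..Suc q}. 1 - of_nat (card (Eb p)) * fps_X)
    = (Abs_fps (\<lambda>d. rat_of_nat (std_count q d)) * (\<Prod>p\<in>{1..q}. 1 - of_nat (card (Eb p)) * fps_X))
       * (Abs_fps (\<lambda>d. rat_of_nat ?e ^ d) * (1 - of_nat ?e * fps_X))"
    by (simp add: prod.atLeast_Suc_atMost_Suc_shift prod.nat_ivl_Suc' mult_ac)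
  show ?case unfolding eq geo using Suc by simp
qed

lemma card_words_std: "card {w \<in> words E d. w \<in> std} = std_count r d"
proof -
  have "{w \<in> words E d. w \<in> std} = {w \<in> stdq r. length w = d}"
    unfolding stdq_r words_def std_def by auto
  then show ?thesis unfolding std_count_def by simp
qed

end

section \<open>Normal forms and Groebner bases\<close>

context twisted_matroid
begin

lemma J_ncp: "f \<in> J \<Longrightarrow> ncp E f"
  using ideal_gen_ncp rels_ncp by blast

text \<open>All words other than ji end in the block of j, and i, coming from a lower block, is a
  larger last letter.\<close>

lemma relF_leading:
  assumes p: "(j,i) \<in> retro_pairs" and w: "relF j (line j i) w \<noteq> 0"
  shows "set w \<subseteq> E" "length w = 2" "w \<noteq> [j,i] \<Longrightarrow> prec w [j,i]"
proof -
  have e: "i \<in> E" "j \<in> E" "blk i < blk j" using p unfolding retro_pairs_def by auto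
  obtain k where k: "k \<in> line j i - {j}" "w = [j,k] \<or> w = [k,j]" using relF_support[OF w] by blast
  have "k \<in> E" using k line_subset[OF e(2,1)] by blast
  then show "set w \<subseteq> E" "length w = 2" using k e by auto
  assume n: "w \<noteq> [j,i]"
  have "blk k = blk j" if "k \<noteq> i" using retro_line[OF e, of k] k that by blast
  then show "prec w [j,i]" using k n e
    unfolding prec_def by (cases "k = i") (auto simp: Cons_lenlex_iff letter_less_iff)
qed

lemma relF_lead_coeff:
  assumes "(j,i) \<in> retro_pairs" shows "relF j (line j i) [j,i] = c j i"
proof -
  have e: "i \<in> E" "j \<in> E" "j \<noteq> i" using assms unfolding retro_pairs_def by auto
  then show ?thesis using relF_apply[OF line_subset[OF e(2,1)] e(3)] unfolding line_def by simp
qed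

lemma c_nonzero: "(j,i) \<in> retro_pairs \<Longrightarrow> c j i \<noteq> 0"
  using c_square[of j i] unfolding retro_pairs_def by (cases "j = i") auto

lemma rretro_support: "rretro j i w \<noteq> 0 \<Longrightarrow> relF j (line j i) w \<noteq> 0"
  unfolding rretro_def by auto

lemma rretro_lead_coeff: "(j,i) \<in> retro_pairs \<Longrightarrow> rretro j i [j,i] = 1"
  by (simp add: rretro_retro)

lemma lm_relF:
  assumes "(j,i) \<in> retro_pairs" shows "lm prec (relF j (line j i)) = [j,i]"
  by (rule lm_eqI) (use assms relF_lead_coeff c_nonzero relF_leading(3) in auto)

lemma lm_rretro:
  assumes "(j,i) \<in> retro_pairs" shows "lm prec (rretro j i) = [j,i]"
  by (rule lm_eqI) (use assms rretro_lead_coeff rretro_support relF_leading(3) in auto)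

text \<open>The bound by w and the clause for sorted w ensure that reduction preserves the
  coefficient at a sorted leading word. Equal lengths make \<open>mono w - \<rho>\<close>
  homogeneous, for the dimension count.\<close>

definition is_nf :: "nat list \<Rightarrow> 'k ncpoly \<Rightarrow> bool" where
  "is_nf w \<rho> \<longleftrightarrow> mono w - \<rho> \<in> J \<and> (\<forall>v. \<rho> v \<noteq> 0 \<longrightarrow> v \<in> std \<and> length v = length w \<and> (v = w \<or> prec v w))
     \<and> (w \<in> std \<longrightarrow> \<rho> = mono w)"

text \<open>At a descent ji of w, the relation of (j,i) replaces ji by smaller words. They stay
  smaller in the context a, b and have normal forms by well-founded induction.\<close>

lemma nf_exists: "w \<in> lists E \<Longrightarrow> \<exists>\<rho>. is_nf w \<rho>"
proof (induction w rule: wf_induct_rule[OF wf_prec])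
  case (1 w)
  show ?case
  proof (cases "w \<in> std")
    case True
    then have "is_nf w (mono w)"
      unfolding is_nf_def
      using ideal_gen.zero[of E rels] by (auto simp: mono_apply split: if_splits)
    then show ?thesis by blast
  next
    case False
    then have "\<not> sorted (map blk w)" using 1(2) unfolding std_def by blast
    then obtain a j i b where w: "w = a @ [j,i] @ b" "blk i < blk j" using unsorted_factor by blast
    then have p: "(j,i) \<in> retro_pairs" using 1(2) unfolding retro_pairs_def by auto
    have ab: "set a \<subseteq> E" "set b \<subseteq> E" using 1(2) w by auto
    let ?g = "rretro j i"
    let ?S = "{x. ?g x \<noteq> 0}"
    have finS: "finite ?S" using rels_ncp[OF rretro_rels[OF p]] unfolding ncp_def by blast
    have S: "set x \<subseteq> E" "length x = 2" "x \<noteq> [j,i] \<Longrightarrow> prec x [j,i]" if "x \<in> ?S" for x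
      using relF_leading[OF p] rretro_support that by auto
    define u where "u x = a @ x @ b" for x
    have "\<exists>\<rho>. is_nf (u x) \<rho>" if x: "x \<in> ?S - {[j,i]}" for x
    proof (rule 1(1))
      show "(u x, w) \<in> {(u,v). prec u v}"
        using prec_append[OF S(3)[of x], of a b] x unfolding u_def w(1) by simp
      show "u x \<in> lists E" using S(1)[of x] x ab unfolding u_def by auto
    qed
    then obtain nf where nf: "\<And>x. x \<in> ?S - {[j,i]} \<Longrightarrow> is_nf (u x) (nf x)" by metis
    define \<rho> where "\<rho> = (\<Sum>x\<in>?S - {[j,i]}. smult (- ?g x) (nf x))"
    define h where "h = ncmult (ncmult (mono a) ?g) (mono b)"
    have hJ: "h \<in> J" unfolding h_def
      by (intro ideal_gen.mult ideal_gen.gen rretro_rels[OF p] ncp_mono ab)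
    have "h = (\<Sum>x\<in>?S. smult (?g x) (mono (u x)))"
    proof -
      have "?g = (\<Sum>x\<in>?S. smult (?g x) (mono x))" by (rule mono_decomp[OF finS]) blast
      then have "h = ncmult (ncmult (mono a) (\<Sum>x\<in>?S. smult (?g x) (mono x))) (mono b)"
        unfolding h_def by metis
      then show ?thesis
        unfolding u_def
        by (simp only: ncmult_sum_left ncmult_sum_right ncmult_smult_left ncmult_smult_right ncmult_mono append.assoc)
    qed
    also have "\<dots> = smult (?g [j,i]) (mono (u [j,i])) + (\<Sum>x\<in>?S - {[j,i]}. smult (?g x) (mono (u x)))"
      by (rule sum.remove[OF finS]) (simp add: rretro_lead_coeff[OF p])
    finally have h: "h v = mono w v + (\<Sum>x\<in>?S - {[j,i]}. ?g x * mono (u x) v)" for v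
      by (simp add: rretro_lead_coeff[OF p] u_def w(1) sum_fun_apply)
    have "mono w - \<rho> = h - (\<Sum>x\<in>?S - {[j,i]}. smult (?g x) (mono (u x) - nf x))"
      by (rule ext) (simp add: h \<rho>_def sum_fun_apply algebra_simps sum_subtractf sum_negf)
    moreover have "mono (u x) - nf x \<in> J" if "x \<in> ?S - {[j,i]}" for x
      using nf[OF that] unfolding is_nf_def by blast
    then have "(\<Sum>x\<in>?S - {[j,i]}. smult (?g x) (mono (u x) - nf x)) \<in> J"
      by (intro ideal_gen_sum ideal_gen_smult)
    then have "h - (\<Sum>x\<in>?S - {[j,i]}. smult (?g x) (mono (u x) - nf x)) \<in> J"
      by (rule ideal_gen_diff[OF hJ])
    ultimately have "mono w - \<rho> \<in> J" by simp
    moreover have "v \<in> std \<and> length v = length w \<and> (v = w \<or> prec v w)" if "\<rho> v \<noteq> 0" for v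
    proof -
      obtain x where x: "x \<in> ?S - {[j,i]}" "- ?g x * nf x v \<noteq> 0"
        using \<open>\<rho> v \<noteq> 0\<close> unfolding \<rho>_def sum_fun_apply smult_apply
        by (rule sum.not_neutral_contains_not_neutral)
      then have "nf x v \<noteq> 0" by auto
      then have "v \<in> std" "length v = length (u x)" "v = u x \<or> prec v (u x)"
        using nf[OF x(1)] unfolding is_nf_def by auto
      moreover have "prec (u x) w"
        using prec_append[OF S(3)[of x], of a b] x unfolding u_def w(1) by simp
      moreover have "length (u x) = length w" using S(2)[of x] x unfolding u_def w(1) by auto
      ultimately show ?thesis using prec_trans by auto
    qed
    ultimately have "is_nf w \<rho>" using False unfolding is_nf_def by blast
    then show ?thesis by blast
  qed
qed

definition nf :: "nat list \<Rightarrow> 'k ncpoly" where "nf w = (SOME \<rho>. is_nf w \<rho>)"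

lemma is_nf_nf: "w \<in> lists E \<Longrightarrow> is_nf w (nf w)"
  unfolding nf_def using nf_exists by (rule someI_ex)

definition reduce :: "'k ncpoly \<Rightarrow> 'k ncpoly" where
  "reduce f = (\<Sum>w | f w \<noteq> 0. smult (f w) (nf w))"

lemma reduce_J:
  assumes f: "ncp E f" shows "f - reduce f \<in> J"
proof -
  have fin: "finite {w. f w \<noteq> 0}" using f unfolding ncp_def by blast
  have "f = (\<Sum>w | f w \<noteq> 0. smult (f w) (mono w))" by (rule mono_decomp[OF fin]) blast
  moreover have "(\<Sum>w | f w \<noteq> 0. smult (f w) (mono w - nf w))
      = (\<Sum>w | f w \<noteq> 0. smult (f w) (mono w)) - reduce f"
    by (rule ext) (simp add: reduce_def sum_fun_apply algebra_simps sum_subtractf)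
  ultimately have "f - reduce f = (\<Sum>w | f w \<noteq> 0. smult (f w) (mono w - nf w))" by metis
  moreover have "mono w - nf w \<in> J" if "f w \<noteq> 0" for w
    using is_nf_nf[of w] f that unfolding is_nf_def ncp_def by auto
  then have "(\<Sum>w | f w \<noteq> 0. smult (f w) (mono w - nf w)) \<in> J"
    by (intro ideal_gen_sum ideal_gen_smult) auto
  ultimately show ?thesis by simp
qed

lemma reduce_support:
  assumes f: "ncp E f" and v: "reduce f v \<noteq> 0"
  shows "v \<in> std \<and> (\<exists>w. f w \<noteq> 0 \<and> nf w v \<noteq> 0)"
proof -
  obtain w where "w \<in> {w. f w \<noteq> 0}" "f w * nf w v \<noteq> 0"
    using v unfolding reduce_def sum_fun_apply smult_apply
    by (rule sum.not_neutral_contains_not_neutral)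
  then have w: "f w \<noteq> 0" "nf w v \<noteq> 0" by auto
  then have "w \<in> lists E" using f unfolding ncp_def by auto
  then show ?thesis using is_nf_nf[of w] w unfolding is_nf_def by blast
qed

lemma J_std_zero': "f \<in> J \<Longrightarrow> (\<And>w. f w \<noteq> 0 \<Longrightarrow> w \<in> std) \<Longrightarrow> f = 0"
  by (rule J_std_zero) (auto simp: std_def)

text \<open>If the leading word were sorted, the reduction of f would be an element of J supported
  on sorted words, hence zero; but it has the coefficient of f at the leading word, as smaller words
  reduce to smaller words. So the leading word has a descent.\<close>

lemma lm_J:
  assumes f: "f \<in> J" "f \<noteq> 0"
  shows "lm prec f \<in> lists E" "\<exists>(j,i)\<in>retro_pairs. divides [j,i] (lm prec f)"
proof -
  note n = J_ncp[OF f(1)]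
  let ?w = "lm prec f"
  note w = lm_props[OF n f(2)]
  show wE: "?w \<in> lists E" using w(1) n unfolding ncp_def by auto
  have "?w \<notin> std"
  proof
    assume s: "?w \<in> std"
    have "f - (f - reduce f) \<in> J" by (intro ideal_gen_diff f(1) reduce_J n)
    moreover have "f - (f - reduce f) = reduce f" by (rule ext) simp
    ultimately have "reduce f \<in> J" by simp
    then have "reduce f = 0" by (rule J_std_zero') (use reduce_support[OF n] in blast)
    moreover have "reduce f ?w = (\<Sum>v | f v \<noteq> 0. if v = ?w then f ?w else 0)"
      unfolding reduce_def sum_fun_apply smult_apply
    proof (intro sum.cong refl)
      fix v assume "v \<in> {v. f v \<noteq> 0}"
      then have v: "f v \<noteq> 0" by simp
      then have vE: "v \<in> lists E" using n unfolding ncp_def by auto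
      show "f v * nf v ?w = (if v = ?w then f ?w else 0)"
      proof (cases "v = ?w")
        case True
        then show ?thesis using is_nf_nf[OF vE] s unfolding is_nf_def by simp
      next
        case False
        then have "prec v ?w" using w(2) v by blast
        then have "nf v ?w = 0" using is_nf_nf[OF vE] False prec_asym unfolding is_nf_def by metis
        then show ?thesis using False by simp
      qed
    qed
    moreover have "finite {v. f v \<noteq> 0}" using n unfolding ncp_def by blast
    ultimately show False using w(1) by simp
  qed
  then have "\<not> sorted (map blk ?w)" using wE unfolding std_def by blast
  then obtain a j i b where e: "?w = a @ [j,i] @ b" "blk i < blk j" using unsorted_factor by blast
  then have "(j,i) \<in> retro_pairs" using wE unfolding retro_pairs_def by auto
  moreover have "divides [j,i] ?w" unfolding e(1) by (rule divides_refl_append)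
  ultimately show "\<exists>(j,i)\<in>retro_pairs. divides [j,i] ?w" by blast
qed

lemma retrograde_pairs: "retrograde r Eb j i \<longleftrightarrow> (j,i) \<in> retro_pairs"
  unfolding retro_pairs_def retrograde_iff by simp

lemma rretro_J: "(j,i) \<in> retro_pairs \<Longrightarrow> rretro j i \<in> J"
  by (intro ideal_gen.gen rretro_rels)

lemma rretro_nonzero: "(j,i) \<in> retro_pairs \<Longrightarrow> rretro j i \<noteq> 0"
  using rretro_lead_coeff[of j i] by auto

text \<open>Among these are, up to the unit \<open>c j i\<close>, the relations of all retrograde
  pairs, whose leading words already suffice.\<close>

lemma groebner_relF:
  "groebner_basis prec {relF j F | j F. flat E \<C> F \<and> mrank \<C> F = 2 \<and> j \<in> F} J"
  unfolding groebner_basis_def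
proof (intro conjI subsetI ballI impI)
  fix g assume "g \<in> {relF j F | j F. flat E \<C> F \<and> mrank \<C> F = 2 \<and> j \<in> F}"
  then obtain j F where g: "g = relF j F" and F: "flat E \<C> F" "mrank \<C> F = 2" "j \<in> F" by blast
  have FE: "F \<subseteq> E" using F(1) unfolding flat_def by blast
  \<comment> \<open>Rank two forces a second point, so F is the line through it and j.\<close>
  have "\<exists>i\<in>F. i \<noteq> j"
  proof (rule ccontr)
    assume "\<not> (\<exists>i\<in>F. i \<noteq> j)"
    then have "F = {j}" using F(3) by blast
    have "2 \<in> card ` {I. I \<subseteq> F \<and> indep \<C> I}"
      using F(2) Max_in[OF finite_card_image_indep[OF FE]] matroid_indep_empty[OF matroid]
      unfolding mrank_def by fastforce
    then obtain I where "I \<subseteq> {j}" "card I = 2" unfolding \<open>F = {j}\<close> by auto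
    then show False using card_mono[of "{j}" I] by simp
  qed
  then obtain i where i: "i \<in> F" "i \<noteq> j" by blast
  have "F = line j i" by (rule rank_two_flat_eq_line[OF F i(1)]) (use i in simp)
  then show "g \<in> J" unfolding g using i F(3) FE by (intro ideal_gen.gen relF_rels[of F j i]) auto
next
  fix f assume f: "f \<in> J" "f \<noteq> 0"
  obtain j i where ji: "(j,i) \<in> retro_pairs" "divides [j,i] (lm prec f)"
    using lm_J(2)[OF f] by blast
  have e: "i \<in> E" "j \<in> E" "j \<noteq> i" using ji(1) unfolding retro_pairs_def by auto
  have "relF j (line j i) \<noteq> 0" using relF_lead_coeff[OF ji(1)] c_nonzero[OF ji(1)] by auto
  moreover have "relF j (line j i) \<in> {relF j F | j F. flat E \<C> F \<and> mrank \<C> F = 2 \<and> j \<in> F}"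
    using flat_line[OF e(2,1,3)] mrank_line[OF e(2,1,3)] unfolding line_def by blast
  ultimately show "\<exists>g\<in>{relF j F | j F. flat E \<C> F \<and> mrank \<C> F = 2 \<and> j \<in> F}. g \<noteq> 0 \<and> divides (lm prec g) (lm prec f)"
    using lm_relF[OF ji(1)] ji(2) by (intro bexI[of _ "relF j (line j i)"]) simp_all
qed

text \<open>Between words of length two divisibility is equality, and by \<open>rretro_retro\<close>
  no relation contains the leading word of another.\<close>

lemma reduced_groebner_rretro:
  "reduced_groebner_basis prec {rretro j i | j i. retrograde r Eb j i} J"
  unfolding reduced_groebner_basis_def groebner_basis_def retrograde_pairs
proof (intro conjI subsetI ballI impI allI)
  let ?G = "{rretro j i | j i. (j,i) \<in> retro_pairs}"
  fix g assume "g \<in> ?G"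
  then obtain j i where g: "g = rretro j i" "(j,i) \<in> retro_pairs" by blast
  show "g \<in> J" "g \<noteq> 0" "g (lm prec g) = 1"
    using g rretro_J rretro_nonzero lm_rretro rretro_lead_coeff by auto
  fix g' w assume "g' \<in> ?G" and ne: "g' \<noteq> g" and w: "g w \<noteq> 0"
  then obtain j' i' where g': "g' = rretro j' i'" "(j',i') \<in> retro_pairs" by blast
  show "\<not> divides (lm prec g') w"
  proof
    assume d: "divides (lm prec g') w"
    have "length w = 2" using relF_leading(2)[OF g(2)] rretro_support w g by blast
    then have "w = [j',i']" using divides_same_length[OF d] lm_rretro[OF g'(2)] g' by simp
    then have "j' = j \<and> i' = i" using w rretro_retro[OF g(2) g'(2)] g(1) by (auto split: if_splits)
    then show False using ne g g' by simp
  qed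
next
  let ?G = "{rretro j i | j i. (j,i) \<in> retro_pairs}"
  fix f assume f: "f \<in> J" "f \<noteq> 0"
  obtain j i where ji: "(j,i) \<in> retro_pairs" "divides [j,i] (lm prec f)"
    using lm_J(2)[OF f] by blast
  then show "\<exists>g\<in>?G. g \<noteq> 0 \<and> divides (lm prec g) (lm prec f)"
    using rretro_nonzero lm_rretro by (intro bexI[of _ "rretro j i"]) auto
qed

lemma initial_ideal_J:
  "initial_ideal E prec J = ideal_gen E {mono [j,i] | j i. retrograde r Eb j i}"
  (is "_ = ideal_gen E ?M")
proof -
  have mono_ideal: "ideal_gen E A \<subseteq> ideal_gen E B" if "A \<subseteq> ideal_gen E B" for A B :: "'k ncpoly set"
  proof
    fix x assume "x \<in> ideal_gen E A"
    then show "x \<in> ideal_gen E B"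
    proof induction
      case (gen g) then show ?case using that by blast
    next
      case zero show ?case by (rule ideal_gen.zero)
    next
      case (add f h) then show ?case by (intro ideal_gen.add)
    next
      case (mult f a b) then show ?case by (intro ideal_gen.mult)
    qed
  qed
  have "mono (lm prec f) \<in> ideal_gen E ?M" if f: "f \<in> J" "f \<noteq> 0" for f
  proof -
    obtain j i where ji: "(j,i) \<in> retro_pairs" "divides [j,i] (lm prec f)"
      using lm_J(2)[OF f] by blast
    then obtain a b where w: "lm prec f = a @ [j,i] @ b" unfolding divides_def by blast
    have ab: "set a \<subseteq> E" "set b \<subseteq> E" using lm_J(1)[OF f] w by auto
    have "mono [j,i] \<in> ?M" using ji(1) retrograde_pairs by blast
    then have "ncmult (ncmult (mono a) (mono [j,i])) (mono b) \<in> ideal_gen E ?M"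
      by (intro ideal_gen.mult ideal_gen.gen ncp_mono ab)
    then show ?thesis unfolding w ncmult_mono by simp
  qed
  moreover have "mono [j,i] \<in> {mono (lm prec f) | f. f \<in> J \<and> f \<noteq> 0}"
    if "(j,i) \<in> retro_pairs" for j i
    using rretro_J[OF that] rretro_nonzero[OF that] lm_rretro[OF that] by force
  then have "?M \<subseteq> {mono (lm prec f) | f. f \<in> J \<and> f \<noteq> 0}" using retrograde_pairs by blast
  then have "?M \<subseteq> ideal_gen E {mono (lm prec f) | f. f \<in> J \<and> f \<noteq> 0}"
    using ideal_gen.gen by blast
  ultimately show ?thesis unfolding initial_ideal_def
    by (intro equalityI mono_ideal) auto
qed

lemma standard_monomials_J: "standard_monomials E prec J = std"
proof
  show "standard_monomials E prec J \<subseteq> std"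
  proof
    fix w assume w: "w \<in> standard_monomials E prec J"
    show "w \<in> std"
    proof (rule ccontr)
      assume "w \<notin> std"
      then have "\<not> sorted (map blk w)" using w unfolding std_def standard_monomials_def by blast
      then obtain a j i b where e: "w = a @ [j,i] @ b" "blk i < blk j"
        using unsorted_factor by blast
      then have p: "(j,i) \<in> retro_pairs"
        using w unfolding standard_monomials_def retro_pairs_def by auto
      have "divides (lm prec (rretro j i)) w"
        unfolding lm_rretro[OF p] e(1) by (rule divides_refl_append)
      then show False
        using w rretro_J[OF p] rretro_nonzero[OF p] unfolding standard_monomials_def by blast
    qed
  qed
  show "std \<subseteq> standard_monomials E prec J"
  proof
    fix w assume w: "w \<in> std"
    have False if f: "f \<in> J" "f \<noteq> 0" and d: "divides (lm prec f) w" for f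
    proof -
      obtain j i where ji: "(j,i) \<in> retro_pairs" "divides [j,i] (lm prec f)"
        using lm_J(2)[OF f] by blast
      then have "divides [j,i] w" using d unfolding divides_def by (metis append.assoc)
      then show False using std_no_factor[OF w] ji(1) unfolding retro_pairs_def by blast
    qed
    then show "w \<in> standard_monomials E prec J"
      using w unfolding standard_monomials_def std_def by blast
  qed
qed

lemma quotient_basis_J: "quotient_basis E J std"
  unfolding quotient_basis_def
proof (intro conjI allI impI)
  fix f :: "'k ncpoly" assume f: "ncp E f"
  let ?T = "{w. reduce f w \<noteq> 0}"
  have "ncp E (f - (f - reduce f))" using ncp_diff[OF f J_ncp[OF reduce_J[OF f]]] .
  moreover have "f - (f - reduce f) = reduce f" by (rule ext) simp
  ultimately have "ncp E (reduce f)" by simp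
  then have fin: "finite ?T" unfolding ncp_def by blast
  have "reduce f = (\<Sum>w\<in>?T. smult (reduce f w) (mono w))" by (rule mono_decomp[OF fin]) blast
  then have "f - (\<Sum>w\<in>?T. smult (reduce f w) (mono w)) \<in> J" using reduce_J[OF f] by metis
  moreover have "?T \<subseteq> std" using reduce_support[OF f] by blast
  ultimately show "\<exists>T a. T \<subseteq> std \<and> finite T \<and> f - (\<Sum>w\<in>T. smult (a w) (mono w)) \<in> J"
    using fin by blast
next
  fix T and a :: "nat list \<Rightarrow> 'k"
  assume T: "T \<subseteq> std \<and> finite T \<and> (\<Sum>w\<in>T. smult (a w) (mono w)) \<in> J"
  let ?f = "\<Sum>w\<in>T. smult (a w) (mono w)"
  have val: "?f v = (if v \<in> T then a v else 0)" for v
  proof -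
    have "?f v = (\<Sum>w\<in>T. if w = v then a v else 0)"
      unfolding sum_fun_apply by (intro sum.cong refl) (auto simp: mono_apply)
    then show ?thesis using T by simp
  qed
  have "?f = 0"
  proof (rule J_std_zero')
    show "?f \<in> J" using T by blast
    fix w assume "?f w \<noteq> 0"
    then show "w \<in> std" using val[of w] T by (auto split: if_splits)
  qed
  show "\<forall>w\<in>T. a w = 0"
  proof
    fix w assume "w \<in> T"
    then show "a w = 0" using val[of w] \<open>?f = 0\<close> by simp
  qed
qed

text \<open>In degree d the ideal has the basis \<open>mono w - nf w\<close> with w unsorted, so the
  sorted words of length d count the quotient.\<close>

lemma hilb_coeff_J: "hilb_coeff E J d = std_count r d"
proof -
  let ?W = "{w \<in> words E d. w \<notin> std}"
  have finw: "finite (words E d)"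
    unfolding words_def using finite_lists_length_eq[OF finite_E] by simp
  have WE: "w \<in> lists E" "length w = d"
    if "w \<in> words E d" for w using that unfolding words_def by auto
  have "vector_space.dim (smult :: 'k \<Rightarrow> 'k ncpoly \<Rightarrow> 'k ncpoly) {f \<in> J. ncp E f \<and> homog d f} = card ?W"
  proof (rule dim_eq_card_coordinates)
    show "finite ?W" using finw by simp
    show coord: "(mono w - nf w) v = (if v = w then 1 else 0)" if "v \<in> ?W" "w \<in> ?W" for v w
      using that is_nf_nf[OF WE(1), of w] unfolding is_nf_def by (auto simp: mono_apply)
    show "mono w - nf w \<in> {f \<in> J. ncp E f \<and> homog d f}" if w: "w \<in> ?W" for w
    proof -
      have J: "mono w - nf w \<in> J" using w is_nf_nf[OF WE(1), of w] unfolding is_nf_def by blast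
      moreover have "homog d (mono w - nf w)"
        unfolding homog_def
      proof (intro allI impI)
        fix v assume "(mono w - nf w) v \<noteq> 0"
        then have "v = w \<or> nf w v \<noteq> 0" by (auto simp: mono_apply split: if_splits)
        then show "length v = d" using w WE(2) is_nf_nf[OF WE(1), of w] unfolding is_nf_def by auto
      qed
      ultimately show ?thesis using J_ncp[OF J] by blast
    qed
    show "f = (\<Sum>w\<in>?W. smult (f w) (mono w - nf w))" if f: "f \<in> {f \<in> J. ncp E f \<and> homog d f}" for f
    proof -
      let ?g = "\<Sum>w\<in>?W. smult (f w) (mono w - nf w)"
      have "mono w - nf w \<in> J"
        if "w \<in> ?W" for w using that is_nf_nf[OF WE(1), of w] unfolding is_nf_def by blast
      then have "?g \<in> J" by (intro ideal_gen_sum ideal_gen_smult)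
      then have "f - ?g \<in> J" using f by (intro ideal_gen_diff) auto
      \<comment> \<open>The difference lies in J, and its coefficients at unsorted words cancel
        because normal forms contain only sorted words.\<close>
      then have "f - ?g = 0"
      proof (rule J_std_zero')
        fix v assume nz: "(f - ?g) v \<noteq> 0"
        show "v \<in> std"
        proof (rule ccontr)
          assume vn: "v \<notin> std"
          have gv: "?g v = (\<Sum>w\<in>?W. if w = v then f v else 0)"
            unfolding sum_fun_apply
          proof (intro sum.cong refl)
            fix w assume w: "w \<in> ?W"
            then have "nf w v = 0" using is_nf_nf[OF WE(1), of w] vn unfolding is_nf_def by blast
            then show "smult (f w) (mono w - nf w) v = (if w = v then f v else 0)"
              by (simp add: mono_apply)
          qed
          have "f v = ?g v"
          proof (cases "v \<in> ?W")
            case True then show ?thesis using gv finw by simp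
          next
            case False
            then have "f v = 0" using f vn unfolding words_def ncp_def homog_def by blast
            then show ?thesis using gv False finw by simp
          qed
          then show False using nz by simp
        qed
      qed
      then show ?thesis by simp
    qed
  qed
  moreover have "card (words E d) = card ?W + card {w \<in> words E d. w \<in> std}"
  proof -
    have "words E d = ?W \<union> {w \<in> words E d. w \<in> std}" by blast
    then have "card (words E d) = card (?W \<union> {w \<in> words E d. w \<in> std})" by simp
    also have "\<dots> = card ?W + card {w \<in> words E d. w \<in> std}"
      by (rule card_Un_disjoint) (use finw in auto)
    finally show ?thesis .
  qed
  ultimately show ?thesis
    unfolding hilb_coeff_def homog_dim[OF finite_E] card_words_std[symmetric] by simp
qed

lemma hilb_series_J: "hilb_series E J = 1 / (\<Prod>p\<in>{1..r}. 1 - of_nat (card (Eb p)) * fps_X)"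
proof -
  let ?P = "\<Prod>p\<in>{1..r}. 1 - of_nat (card (Eb p)) * fps_X :: rat fps"
  have 1: "hilb_series E J * ?P = 1"
    using std_count_fps[of r] unfolding hilb_series_def hilb_coeff_J by simp
  have "?P \<noteq> 0"
  proof
    assume "?P = 0"
    then have "hilb_series E J * ?P = 0" by (simp only: mult_zero_right)
    then show False using 1 by (metis zero_neq_one)
  qed
  then show ?thesis using 1 by (metis nonzero_mult_div_cancel_right)
qed

end

section \<open>Quadratic duals and the Orlik-Solomon algebra\<close>

lemma pairing_mono: "finite E \<Longrightarrow> pairing E g (mono u) = (if u \<in> words E 2 then g u else 0)"
proof -
  assume fin: "finite E"
  have "finite (words E 2)" unfolding words_def using finite_lists_length_eq[OF fin] by simp
  moreover have "pairing E g (mono u) = (\<Sum>w\<in>words E 2. if w = u then g u else 0)"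
    unfolding pairing_def by (intro sum.cong refl) (auto simp: mono_apply)
  ultimately show ?thesis by simp
qed

lemma pairing_add: "pairing E g (f + h) = pairing E g f + pairing E g h"
  unfolding pairing_def by (simp add: algebra_simps sum.distrib)

lemma pairing_diff: "pairing E g (f - h) = pairing E g f - pairing E g h"
  unfolding pairing_def by (simp add: algebra_simps sum_subtractf)

lemma pairing_smult: "pairing E g (smult a f) = a * pairing E g f"
  unfolding pairing_def by (simp add: sum_distrib_left mult.left_commute)

text \<open>On an element without terms below degree two, the factors act up to degree two through
  their constant terms. Hence the quadratic part of the ideal is spanned by that of its
  generators.\<close>

lemma ncmult_low_degree:
  fixes a b f :: "'k::field ncpoly"
  assumes f: "\<And>w. length w < 2 \<Longrightarrow> f w = 0" and w: "length w \<le> 2"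
  shows "ncmult (ncmult a f) b w = a [] * f w * b []"
proof -
  have af: "ncmult a f u = (if length u < 2 then 0 else a [] * f u)" if u: "length u \<le> 2" for u
  proof -
    have "ncmult a f u = (\<Sum>i\<le>length u. if i = 0 then a [] * f u else 0)"
      unfolding ncmult_def using f u by (intro sum.cong refl) auto
    then show ?thesis using f by simp
  qed
  have "ncmult (ncmult a f) b w = (\<Sum>i\<le>length w. if i = length w then ncmult a f w * b [] else 0)"
    unfolding ncmult_def[of _ b] using af w by (intro sum.cong refl) (auto simp: af)
  also have "\<dots> = a [] * f w * b []" using af[OF w] f by simp
  finally show ?thesis .
qed

text \<open>The induction also carries the vanishing below degree two, which
  \<open>ncmult_low_degree\<close> requires.\<close>

lemma pairing_ideal_gen:
  fixes G :: "'k::field ncpoly set"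
  assumes low: "\<And>h w. h \<in> G \<Longrightarrow> length w < 2 \<Longrightarrow> h w = 0"
    and G: "\<And>h. h \<in> G \<Longrightarrow> pairing E g h = 0" and f: "f \<in> ideal_gen E G"
  shows "pairing E g f = 0"
proof -
  have "(\<forall>w. length w < 2 \<longrightarrow> f w = 0) \<and> pairing E g f = 0"
    using f
  proof induction
    case zero show ?case by (simp add: pairing_def)
  next
    case (gen h) then show ?case using low G by blast
  next
    case (add f h)
    then have "pairing E g (f + h) = 0" by (simp only: pairing_add) simp
    moreover have "\<forall>w. length w < 2 \<longrightarrow> (f + h) w = 0" using add by simp
    ultimately show ?case by blast
  next
    case (mult f a b)
    then have f: "f w = 0" if "length w < 2" for w using that by blast
    have "pairing E g (ncmult (ncmult a f) b) = pairing E g (smult (a [] * b []) f)"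
      unfolding pairing_def
      by (intro sum.cong refl) (simp add: words_def ncmult_low_degree[OF f])
    then have "pairing E g (ncmult (ncmult a f) b) = 0" using mult by (simp add: pairing_smult)
    moreover have "ncmult (ncmult a f) b w = 0" if "length w < 2" for w
      using ncmult_low_degree[of f w a b, OF f] f that by simp
    ultimately show ?case by blast
  qed
  then show ?thesis by blast
qed

text \<open>Generators of degree above two pair to zero, since the pairing sees only words of length
  two; so the quadratic generators decide orthogonality to the whole ideal.\<close>

lemma koszul_dual_ideal_eq:
  fixes G K :: "'k::field ncpoly set"
  assumes hom: "\<And>h. h \<in> G \<Longrightarrow> \<exists>d\<ge>2. homog d h"
    and K: "\<And>g. g \<in> K \<longleftrightarrow> ncp E g \<and> homog 2 g \<and> (\<forall>h\<in>G. homog 2 h \<longrightarrow> pairing E g h = 0)"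
  shows "koszul_dual_ideal E (ideal_gen E G) = ideal_gen E K"
proof -
  have low: "h w = 0" if "h \<in> G" "length w < 2" for h w
    using hom[OF that(1)] that(2) unfolding homog_def by force
  have "pairing E g f = 0"
    if g: "\<forall>h\<in>G. homog 2 h \<longrightarrow> pairing E g h = 0" and f: "f \<in> ideal_gen E G" for g f
  proof (rule pairing_ideal_gen[where G = G])
    show "h w = 0" if "h \<in> G" "length w < 2" for h w using low that .
    show "f \<in> ideal_gen E G" by (rule f)
    fix h assume h: "h \<in> G"
    obtain d where d: "homog d h" using hom[OF h] by blast
    show "pairing E g h = 0"
    proof (cases "d = 2")
      case False
      then show ?thesis using d unfolding pairing_def homog_def
        by (intro sum.neutral) (auto simp: words_def)
    qed (use g h d in blast)
  qed
  then have "{g. ncp E g \<and> homog 2 g \<and> (\<forall>f\<in>ideal_gen E G. homog 2 f \<longrightarrow> pairing E g f = 0)} = K"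
    using K ideal_gen.gen by blast
  then show ?thesis unfolding koszul_dual_ideal_def by simp
qed

section \<open>Boundaries of circuits in increasing order\<close>

lemma sorted_list_of_set_3: "x < y \<Longrightarrow> y < z \<Longrightarrow> sorted_list_of_set {x,y,z} = [x,y,z::nat]"
  using sorted_list_of_set.idem_if_sorted_distinct[of "[x,y,z]"] by simp

lemma sorted_list_of_set_2: "x < y \<Longrightarrow> sorted_list_of_set {x,y} = [x,y::nat]"
  using sorted_list_of_set.idem_if_sorted_distinct[of "[x,y]"] by simp

lemma os_bd_3:
  assumes "x < y" "y < z"
  shows "(os_bd {x,y,z} :: 'k::field ncpoly) = mono [y,z] - mono [x,z] + mono [x,y]"
proof -
  have "card {x,y,z} = 3" using assms by simp
  then show ?thesis
    using assms unfolding os_bd_def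
    by (intro ext) (simp add: sorted_list_of_set_3 remove_nth_def numeral_3_eq_3 numeral_2_eq_2 sum_fun_apply)
qed

lemma vg_bd_3:
  assumes "x < y" "y < z" and P: "P \<union> N = {x,y,z}"
  shows "(vg_bd P N :: 'k::field ncpoly) = smult (if x \<in> P then 1 else -1) (mono [y,z])
    + smult (if y \<in> P then 1 else -1) (mono [x,z]) + smult (if z \<in> P then 1 else -1) (mono [x,y])"
proof -
  have d: "{x,y,z} - {x} = {y,z}" "{x,y,z} - {y} = {x,z}" "{x,y,z} - {z} = {x,y}"
    using assms by auto
  show ?thesis
    using assms(1,2) unfolding vg_bd_def P
    by (simp add: d sorted_list_of_set_2 add.assoc)
qed

lemma homog_os_bd: "finite C \<Longrightarrow> homog (card C - 1) (os_bd C :: 'k::field ncpoly)"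
  unfolding homog_def
proof (intro allI impI)
  fix w assume fin: "finite C" and w: "(os_bd C :: 'k ncpoly) w \<noteq> 0"
  obtain j where "j \<in> {..<card C}" "smult ((-1) ^ j) (mono (remove_nth j (sorted_list_of_set C))) w \<noteq> (0::'k)"
    using w unfolding os_bd_def sum_fun_apply by (rule sum.not_neutral_contains_not_neutral)
  then show "length w = card C - 1"
    using fin by (auto simp: mono_apply remove_nth_def split: if_splits)
qed

lemma homog_vg_bd: "finite (P \<union> N) \<Longrightarrow> homog (card (P \<union> N) - 1) (vg_bd P N :: 'k::field ncpoly)"
  unfolding homog_def
proof (intro allI impI)
  fix w assume fin: "finite (P \<union> N)" and w: "(vg_bd P N :: 'k ncpoly) w \<noteq> 0"
  obtain x where "x \<in> P \<union> N" "smult (if x \<in> P then 1 else -1) (mono (sorted_list_of_set ((P \<union> N) - {x}))) w \<noteq> (0::'k)"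
    using w unfolding vg_bd_def sum_fun_apply by (rule sum.not_neutral_contains_not_neutral)
  moreover from this have "w = sorted_list_of_set ((P \<union> N) - {x})"
    by (auto simp: mono_apply split: if_splits)
  ultimately show "length w = card (P \<union> N) - 1" using fin by simp
qed

lemma three_sorted:
  fixes C :: "nat set"
  assumes "card C = 3" obtains x y z where "C = {x,y,z}" "x < y" "y < z"
proof -
  obtain a b d where C: "C = {a,b,d}" "a \<noteq> b" "a \<noteq> d" "b \<noteq> d" using assms by (auto simp: card_3_iff)
  consider "a < b" "b < d" | "a < d" "d < b" | "b < a" "a < d" | "b < d" "d < a" | "d < a" "a < b" | "d < b" "b < a"
    using C(2-4) by linarith
  then show ?thesis
    by cases (use C(1) that in \<open>metis insert_commute\<close>)+
qed

text \<open>R enters only through retrograde pairs, so \<open>r_retro\<close> and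
  \<open>rpm_retro\<close> may be exchanged for \<open>rretro\<close> where their join is a
  line.\<close>

definition dual_groebner :: "nat set \<Rightarrow> nat \<Rightarrow> (nat \<Rightarrow> nat set) \<Rightarrow> 'k::field ncpoly set \<Rightarrow>
    (nat \<Rightarrow> nat \<Rightarrow> 'k ncpoly) \<Rightarrow> 'k ncpoly set \<Rightarrow> bool" where
  "dual_groebner E r Eb G R J \<longleftrightarrow> (\<exists>prec. monomial_order E prec
    \<and> groebner_basis prec G J
    \<and> reduced_groebner_basis prec {R j i | j i. retrograde r Eb j i} J
    \<and> (\<forall>j i. retrograde r Eb j i \<longrightarrow> lm prec (R j i) = [j,i])
    \<and> initial_ideal E prec J = ideal_gen E {mono [j,i] | j i. retrograde r Eb j i}
    \<and> standard_monomials E prec J = block_products r Eb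
    \<and> quotient_basis E J (standard_monomials E prec J)
    \<and> hilb_series E J = 1 / (\<Prod>p\<in>{1..r}. 1 - of_nat (card (Eb p)) * fps_X))"

lemma dual_groebner_cong:
  assumes "\<And>j i. retrograde r Eb j i \<Longrightarrow> R j i = R' j i"
  shows "dual_groebner E r Eb G R J \<longleftrightarrow> dual_groebner E r Eb G R' J"
proof -
  have "{R j i | j i. retrograde r Eb j i} = {R' j i | j i. retrograde r Eb j i}"
    using assms by metis
  then show ?thesis unfolding dual_groebner_def using assms by simp
qed

context twisted_matroid
begin

text \<open>Boundaries are written for increasing triples. As c a b * g [a,b] is alternating, any
  other order of the triple gives the same equation up to sign.\<close>

lemma rels_sortedI:
  assumes g: "ncp E g" "homog 2 g" "\<And>a. a \<in> E \<Longrightarrow> g [a,a] = 0"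
    and anti: "\<And>a b. a \<in> E \<Longrightarrow> b \<in> E \<Longrightarrow> g [b,a] = - (s * g [a,b])"
    and tri: "\<And>a b d. {a,b,d} \<in> \<C> \<Longrightarrow> a < b \<Longrightarrow> b < d \<Longrightarrow> c a b * g [a,b] + c b d * g [b,d] + c d a * g [d,a] = 0"
  shows "g \<in> rels"
proof (rule relsI[OF g anti])
  fix a b d assume t: "{a,b,d} \<in> \<C>"
  note E = tri_in_E[OF t] and dis = tri_distinct[OF t]
  have h: "c y x * g [y,x] = - (c x y * g [x,y])" if "x \<in> E" "y \<in> E" "x \<noteq> y" for x y
    using c_swap[OF that] anti[OF that(1,2)] by (simp add: mult_ac)
  have "card {a,b,d} = 3" using dis by simp
  then obtain x y z where C: "{a,b,d} = {x,y,z}" "x < y" "y < z" by (rule three_sorted)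
  then have "c x y * g [x,y] + c y z * g [y,z] + c z x * g [z,x] = 0" using tri[of x y z] t by simp
  moreover have "a \<in> {x,y,z}" "b \<in> {x,y,z}" "d \<in> {x,y,z}" using C(1) by blast+
  then have "(a,b,d) \<in> {(x,y,z),(x,z,y),(y,x,z),(y,z,x),(z,x,y),(z,y,x)}" using dis by auto
  ultimately show "c a b * g [a,b] + c b d * g [b,d] + c d a * g [d,a] = 0"
    using h[OF E(1,2) dis(1)] h[OF E(1,3) dis(2)] h[OF E(2,3) dis(3)]
    by (auto simp: algebra_simps)
qed

lemma words_pair: "a \<in> E \<Longrightarrow> b \<in> E \<Longrightarrow> [a,b] \<in> words E 2"
  unfolding words_def by simp

text \<open>Here bd C h says that h is a boundary relation of the circuit C; only the relations of
  three-element circuits are quadratic.\<close>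

lemma koszul_dual_ideal_rels:
  assumes ex: "\<And>C. C \<in> \<C> \<Longrightarrow> \<exists>h. bd C h"
    and hom: "\<And>C h. C \<in> \<C> \<Longrightarrow> bd C h \<Longrightarrow> homog (card C - 1) h"
    and tri: "\<And>x y z h g. {x,y,z} \<in> \<C> \<Longrightarrow> x < y \<Longrightarrow> y < z \<Longrightarrow> bd {x,y,z} h \<Longrightarrow>
      g [z,x] = - (s * g [x,z]) \<Longrightarrow>
      pairing E g h = 0 \<longleftrightarrow> c x y * g [x,y] + c y z * g [y,z] + c z x * g [z,x] = 0"
  defines "G \<equiv> {mono [i,j] + smult s (mono [j,i]) | i j. i \<in> E \<and> j \<in> E} \<union> {mono [i,i] | i. i \<in> E}
     \<union> {h. \<exists>C\<in>\<C>. bd C h}"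
  shows "koszul_dual_ideal E (ideal_gen E G) = J"
proof -
  have hom2: "homog 2 (mono [i,j] + smult s (mono [j,i]))" "homog 2 (mono [i,j] :: 'k ncpoly)" for i j
    unfolding homog_def by (auto simp: mono_apply split: if_splits)
  have pair: "pairing E g (mono [i,j] + smult s (mono [j,i])) = g [i,j] + s * g [j,i]"
    "pairing E g (mono [i,j]) = g [i,j]" if "i \<in> E" "j \<in> E" for i j g
    unfolding pairing_add pairing_smult
    using that by (simp_all add: pairing_mono finite_E words_pair)
  show ?thesis
  proof (rule koszul_dual_ideal_eq)
    fix h assume "h \<in> G"
    then consider i j where "h = mono [i,j] + smult s (mono [j,i])" | i where "h = mono [i,i]"
      | C where "C \<in> \<C>" "bd C h"
      unfolding G_def by blast
    then show "\<exists>d\<ge>2. homog d h"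
    proof cases
      case 3 then show ?thesis
        using hom[of C h] card_circuit[of C] by (intro exI[of _ "card C - 1"]) auto
    qed (use hom2 in blast)+
  next
    fix g :: "'k ncpoly"
    show "g \<in> rels \<longleftrightarrow> ncp E g \<and> homog 2 g \<and> (\<forall>h\<in>G. homog 2 h \<longrightarrow> pairing E g h = 0)"
    proof
      assume g: "g \<in> rels"
      have "pairing E g h = 0" if "h \<in> G" for h
      proof -
        consider i j where "i \<in> E" "j \<in> E" "h = mono [i,j] + smult s (mono [j,i])"
          | i where "i \<in> E" "h = mono [i,i]" | C where "C \<in> \<C>" "bd C h"
          using \<open>h \<in> G\<close> unfolding G_def by blast
        then show ?thesis
        proof cases
          case 1 then show ?thesis using pair(1)[OF 1(1,2)] relsD(4)[OF g 1(1,2)] by simp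
        next
          case 2 then show ?thesis using pair(2)[OF 2(1,1)] relsD(3)[OF g] by simp
        next
          case 3
          show ?thesis
          proof (cases "card C = 3")
            case True
            then obtain x y z where C: "C = {x,y,z}" "x < y" "y < z" by (rule three_sorted)
            note t = 3[unfolded C(1)]
            show ?thesis
              using tri[OF t(1) C(2,3) t(2), of g] relsD(5)[OF g t(1)] relsD(4)[OF g] tri_in_E[OF t(1)]
              by blast
          next
            case False
            then have "card C - 1 \<noteq> 2" using card_circuit[OF 3(1)] by linarith
            then have "h w = 0" if "w \<in> words E 2" for w
              using hom[OF 3] that unfolding homog_def words_def by force
            then show ?thesis unfolding pairing_def by simp
          qed
        qed
      qed
      then show "ncp E g \<and> homog 2 g \<and> (\<forall>h\<in>G. homog 2 h \<longrightarrow> pairing E g h = 0)"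
        using relsD(1,2)[OF g] by blast
    next
      assume g: "ncp E g \<and> homog 2 g \<and> (\<forall>h\<in>G. homog 2 h \<longrightarrow> pairing E g h = 0)"
      have pz: "pairing E g h = 0" if "h \<in> G" "homog 2 h" for h using g that by blast
      have anti: "g [b,a] = - (s * g [a,b])" if "a \<in> E" "b \<in> E" for a b
      proof -
        have "mono [b,a] + smult s (mono [a,b]) \<in> G" using that unfolding G_def by blast
        then have "g [b,a] + s * g [a,b] = 0" using pz hom2(1) pair(1)[OF that(2,1)] by metis
        then show ?thesis by (metis add_eq_0_iff2)
      qed
      show "g \<in> rels"
      proof (rule rels_sortedI)
        show "ncp E g" "homog 2 g" using g by auto
        show "g [b,a] = - (s * g [a,b])" if "a \<in> E" "b \<in> E" for a b using anti[OF that] .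
        show "g [a,a] = 0" if "a \<in> E" for a
        proof -
          have "mono [a,a] \<in> G" using that unfolding G_def by blast
          then show ?thesis using pz hom2(2) pair(2)[OF that that] by metis
        qed
        fix x y z assume t: "{x,y,z} \<in> \<C>" and o: "x < y" "y < z"
        obtain h where h: "bd {x,y,z} h" using ex[OF t] by blast
        have "card {x,y,z} - 1 = 2" using tri_distinct[OF t] by simp
        then have "homog 2 h" using hom[OF t h] by metis
        moreover have "h \<in> G" using t h unfolding G_def by blast
        ultimately show "c x y * g [x,y] + c y z * g [y,z] + c z x * g [z,x] = 0"
          using tri[OF t o h] pz anti tri_in_E[OF t] by blast
      qed
    qed
  qed
qed

lemma relF_rretro_sum:
  assumes "(j,i) \<in> retro_pairs"
  shows "rretro j i = mono [j,i] - smult s (mono [i,j])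
    + smult (c j i) (\<Sum>k\<in>line j i - {i,j}. smult (c j k) (mono [j,k] - smult s (mono [k,j])))"
proof -
  have e: "i \<in> E" "j \<in> E" "j \<noteq> i" using assms unfolding retro_pairs_def by auto
  let ?t = "\<lambda>k. smult (c j k) (mono [j,k] - smult s (mono [k,j]))"
  have fin: "finite (line j i - {j})" using line_subset[OF e(2,1)] finite_E finite_subset by blast
  have "i \<in> line j i - {j}" using e unfolding line_def by auto
  then have "relF j (line j i) = ?t i + (\<Sum>k\<in>line j i - {j} - {i}. ?t k)"
    unfolding relF_def using fin by (intro sum.remove)
  moreover have "line j i - {j} - {i} = line j i - {i,j}" by blast
  ultimately have eq: "relF j (line j i) = ?t i + (\<Sum>k\<in>line j i - {i,j}. ?t k)" by simp
  show ?thesis unfolding rretro_def eq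
    using c_square[OF e(2,1,3)] by (intro ext) (simp add: distrib_left flip: mult.assoc)
qed

lemma dual_groebner_rels:
  "dual_groebner E r Eb {relF j F | j F. flat E \<C> F \<and> mrank \<C> F = 2 \<and> j \<in> F} rretro J"
  unfolding dual_groebner_def
  using monomial_order_prec groebner_relF reduced_groebner_rretro lm_rretro retrograde_pairs
    initial_ideal_J standard_monomials_J block_products_std quotient_basis_J hilb_series_J
  by (intro exI[of _ prec]) simp

end

context blocked_matroid
begin

lemma twisted_matroid_trivial: "twisted_matroid E \<C> r Eb (1::'k::field) (\<lambda>_ _. 1)"
  by unfold_locales auto

lemma os_results:
  defines "J \<equiv> koszul_dual_ideal E (ideal_gen E (OS_gens E \<C>)) :: 'k::field ncpoly set"
  shows "dual_groebner E r Eb {rF j F | j F. flat E \<C> F \<and> mrank \<C> F = 2 \<and> j \<in> F}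
    (r_retro E \<C>) J"
proof -
  interpret T: twisted_matroid E \<C> r Eb "1::'k" "\<lambda>_ _. 1" by (rule twisted_matroid_trivial)
  have J: "J = ideal_gen E T.rels"
  proof -
    have "koszul_dual_ideal E (ideal_gen E ({mono [i,j] + smult 1 (mono [j,i]) | i j. i \<in> E \<and> j \<in> E}
        \<union> {mono [i,i] | i. i \<in> E} \<union> {h. \<exists>C\<in>\<C>. h = os_bd C})) = ideal_gen E T.rels"
    proof (rule T.koszul_dual_ideal_rels)
      show "homog (card C - 1) h" if "C \<in> \<C>" "h = os_bd C" for C and h :: "'k ncpoly"
        using homog_os_bd[OF finite_circuit[OF that(1)]] that(2) by simp
      fix x y z and h g :: "'k ncpoly"
      assume t: "{x,y,z} \<in> \<C>" and o: "x < y" "y < z" and h: "h = os_bd {x,y,z}"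
        and a: "g [z,x] = - (1 * g [x,z])"
      have p: "pairing E g h = g [y,z] - g [x,z] + g [x,y]"
        unfolding h os_bd_3[OF o] pairing_add pairing_diff
        using tri_in_E[OF t] by (simp add: pairing_mono finite_E T.words_pair)
      show "pairing E g h = 0 \<longleftrightarrow> 1 * g [x,y] + 1 * g [y,z] + 1 * g [z,x] = 0"
        unfolding p a by (simp add: algebra_simps)
    qed blast
    moreover have "smult 1 f = f" for f :: "'k ncpoly" by (rule ext) simp
    ultimately show ?thesis unfolding J_def OS_gens_def by (simp add: Bex_def conj_commute)
  qed
  have F: "rF j F = T.relF j F" for j F
    unfolding rF_def T.relF_def by (rule ext) (simp add: sum_fun_apply)
  have R: "r_retro E \<C> j i = T.rretro j i" if "retrograde r Eb j i" for j i
  proof -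
    have p: "(j,i) \<in> T.retro_pairs" using that T.retrograde_pairs by blast
    then have e: "i \<in> E" "j \<in> E" "j \<noteq> i" unfolding T.retro_pairs_def by auto
    show ?thesis unfolding r_retro_def Let_def fjoin_eq_line[OF e(2,1,3)] T.relF_rretro_sum[OF p]
      by (rule ext) (simp add: sum_fun_apply)
  qed
  show ?thesis
    using T.dual_groebner_rels dual_groebner_cong[of r Eb "r_retro E \<C>" T.rretro, OF R]
    unfolding J F by blast
qed

end

section \<open>Signed circuits and chirotopes\<close>

lemma oriented_matroidD:
  assumes "oriented_matroid E \<O>"
  shows om_finite: "finite E"
    and om_subset: "(P,N) \<in> \<O> \<Longrightarrow> P \<subseteq> E \<and> N \<subseteq> E \<and> P \<inter> N = {}"
    and om_nonempty: "({},{}) \<notin> \<O>"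
    and om_neg: "(P,N) \<in> \<O> \<Longrightarrow> (N,P) \<in> \<O>"
    and om_incomparable: "(P,N) \<in> \<O> \<Longrightarrow> (P',N') \<in> \<O> \<Longrightarrow> P \<union> N \<subseteq> P' \<union> N' \<Longrightarrow>
      (P,N) = (P',N') \<or> (P,N) = (N',P')"
    and om_elim: "(P,N) \<in> \<O> \<Longrightarrow> (P',N') \<in> \<O> \<Longrightarrow> (P,N) \<noteq> (N',P') \<Longrightarrow> e \<in> P \<Longrightarrow> e \<in> N' \<Longrightarrow>
      \<exists>(Q,R)\<in>\<O>. Q \<subseteq> (P \<union> P') - {e} \<and> R \<subseteq> (N \<union> N') - {e}"
proof -
  note om = assms[unfolded oriented_matroid_def]
  show "finite E" "({},{}) \<notin> \<O>" using om by simp_all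
  show "P \<subseteq> E \<and> N \<subseteq> E \<and> P \<inter> N = {}" if "(P,N) \<in> \<O>" using om that by fast
  show "(N,P) \<in> \<O>" if "(P,N) \<in> \<O>" using om that by fast
  show "(P,N) = (P',N') \<or> (P,N) = (N',P')"
    if "(P,N) \<in> \<O>" "(P',N') \<in> \<O>" "P \<union> N \<subseteq> P' \<union> N'"
    using om[THEN conjunct2, THEN conjunct2, THEN conjunct2, THEN conjunct2, THEN conjunct1] that
    by fast
  show "\<exists>(Q,R)\<in>\<O>. Q \<subseteq> (P \<union> P') - {e} \<and> R \<subseteq> (N \<union> N') - {e}"
    if "(P,N) \<in> \<O>" "(P',N') \<in> \<O>" "(P,N) \<noteq> (N',P')" "e \<in> P" "e \<in> N'"
    using om[THEN conjunct2, THEN conjunct2, THEN conjunct2, THEN conjunct2, THEN conjunct2,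
        THEN bspec, OF that(1), simplified, THEN bspec, OF that(2)] that(3-5) by simp
qed

lemma underlyingI: "(P,N) \<in> \<O> \<Longrightarrow> P \<union> N \<in> underlying \<O>"
  unfolding underlying_def by blast

lemma underlyingE:
  assumes "C \<in> underlying \<O>" obtains P N where "C = P \<union> N" "(P,N) \<in> \<O>"
  using assms unfolding underlying_def by blast

lemma signed_circuit_with_positive:
  assumes om: "oriented_matroid E \<O>" and C: "C \<in> underlying \<O>" and e: "e \<in> C"
  obtains P N where "C = P \<union> N" "(P,N) \<in> \<O>" "e \<in> P"
proof -
  obtain P N where PN: "C = P \<union> N" "(P,N) \<in> \<O>" using C by (rule underlyingE)
  show ?thesis
  proof (cases "e \<in> P")
    case True then show ?thesis using that PN by blast
  next
    case False then show ?thesis using that[of N P] PN om_neg[OF om PN(2)] e by blast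
  qed
qed

text \<open>Signed elimination applies once the signings are chosen with e positive in one circuit
  and negative in the other.\<close>

lemma underlying_matroid:
  assumes om: "oriented_matroid E \<O>" shows "matroid E (underlying \<O>)"
  unfolding matroid_def
proof (intro conjI ballI allI impI)
  show "finite E" by (rule om_finite[OF om])
  show "C \<subseteq> E" if "C \<in> underlying \<O>" for C
    using that by (rule underlyingE) (use om_subset[OF om] in blast)
  show "{} \<notin> underlying \<O>"
  proof
    assume "{} \<in> underlying \<O>"
    then obtain P N where PN: "{} = P \<union> N" "(P,N) \<in> \<O>" by (rule underlyingE)
    then show False using om_nonempty[OF om] by simp
  qed
  fix C1 C2 assume C: "C1 \<in> underlying \<O>" "C2 \<in> underlying \<O>"
  show "C1 = C2" if sub: "C1 \<subseteq> C2"
  proof -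
    obtain P N where 1: "C1 = P \<union> N" "(P,N) \<in> \<O>" using C(1) by (rule underlyingE)
    obtain P' N' where 2: "C2 = P' \<union> N'" "(P',N') \<in> \<O>" using C(2) by (rule underlyingE)
    show ?thesis using om_incomparable[OF om 1(2) 2(2)] sub unfolding 1(1) 2(1) by auto
  qed
  fix e assume e: "C1 \<noteq> C2 \<and> e \<in> C1 \<inter> C2"
  obtain P N where 1: "C1 = P \<union> N" "(P,N) \<in> \<O>" "e \<in> P"
    using signed_circuit_with_positive[OF om C(1)] e by blast
  obtain P' N' where 2: "C2 = P' \<union> N'" "(P',N') \<in> \<O>" "e \<in> P'"
    using signed_circuit_with_positive[OF om C(2)] e by blast
  have "(P,N) \<noteq> (P',N')" using 1 2 e by auto
  then obtain Q R where "(Q,R) \<in> \<O>" "Q \<subseteq> (P \<union> N') - {e}" "R \<subseteq> (N \<union> P') - {e}"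
    using om_elim[OF om 1(2) om_neg[OF om 2(2)], of e] 1(3) 2(3) by blast
  then show "\<exists>C3\<in>underlying \<O>. C3 \<subseteq> C1 \<union> C2 - {e}"
    using underlyingI 1(1) 2(1) by (intro bexI[of _ "Q \<union> R"]) auto
qed

section \<open>Chirotopes of lines and signs of circuits\<close>

lemma vec_dep_circuit:
  assumes fin: "finite F" and dep: "vec_dep F v l"
  shows "\<exists>(P,N)\<in>vec_circuits F v. P \<union> N \<subseteq> {k\<in>F. l k \<noteq> 0}"
proof -
  let ?S = "\<lambda>m. {k\<in>F. m k \<noteq> (0::real)}"
  let ?Q = "\<lambda>m. vec_dep F v m \<and> ?S m \<subseteq> ?S l"
  have "?Q l" using dep by simp
  then have "\<exists>m. ?Q m \<and> (\<forall>m'. ?Q m' \<longrightarrow> card (?S m) \<le> card (?S m'))"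
    by (rule ex_has_least_nat[where P = ?Q and m = "\<lambda>m. card (?S m)"])
  then obtain m where m: "?Q m" and min: "\<forall>m'. ?Q m' \<longrightarrow> card (?S m) \<le> card (?S m')"
    by (elim exE conjE) simp
  have "?S m' = ?S m" if "vec_dep F v m' \<and> ?S m' \<subseteq> ?S m" for m'
  proof (rule card_seteq)
    show "finite (?S m)" using fin by simp
    show "?S m' \<subseteq> ?S m" using that by simp
    have "?Q m'" using that m by (meson subset_trans)
    then show "card (?S m) \<le> card (?S m')" using min by simp
  qed
  then have "({k\<in>F. m k > 0}, {k\<in>F. m k < 0}) \<in> vec_circuits F v"
    unfolding vec_circuits_def using m by (intro CollectI exI[of _ m]) simp
  moreover have "{k\<in>F. m k > 0} \<union> {k\<in>F. m k < 0} \<subseteq> ?S l" using m by auto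
  ultimately show ?thesis by blast
qed

lemma det_zero_vec_dep:
  assumes fin: "finite F" and ab: "a \<in> F" "b \<in> F" "a \<noteq> b"
    and det: "fst (v a) * snd (v b) - snd (v a) * fst (v b) = 0"
  shows "\<exists>l. vec_dep F v l \<and> {k\<in>F. l k \<noteq> 0} \<subseteq> {a,b}"
proof -
  obtain x y :: real where xy: "x * fst (v a) + y * fst (v b) = 0" "x * snd (v a) + y * snd (v b) = 0" "x \<noteq> 0 \<or> y \<noteq> 0"
  proof -
    consider "fst (v a) \<noteq> 0" | "snd (v a) \<noteq> 0" | "fst (v a) = 0" "snd (v a) = 0" by blast
    then show ?thesis
    proof cases
      case 1 then show ?thesis
        using that[of "fst (v b)" "- fst (v a)"] det by (simp add: algebra_simps)
    next
      case 2 then show ?thesis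
        using that[of "snd (v b)" "- snd (v a)"] det by (simp add: algebra_simps)
    next
      case 3 then show ?thesis using that[of 1 0] by simp
    qed
  qed
  let ?l = "\<lambda>k. if k = a then x else if k = b then y else 0"
  have sum: "(\<Sum>k\<in>F. ?l k * h k) = x * h a + y * h b" for h :: "nat \<Rightarrow> real"
  proof -
    have "(\<Sum>k\<in>F. ?l k * h k) = (\<Sum>k\<in>F. (if k = a then x * h a else 0) + (if k = b then y * h b else 0))"
      using ab by (intro sum.cong refl) auto
    also have "\<dots> = x * h a + y * h b" unfolding sum.distrib using fin ab by simp
    finally show ?thesis .
  qed
  have "vec_dep F v ?l" unfolding vec_dep_def sum using xy ab by auto
  moreover have "{k\<in>F. ?l k \<noteq> 0} \<subseteq> {a,b}" by auto
  ultimately show ?thesis by blast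
qed

locale blocked_oriented_matroid =
  blocked_matroid E "underlying \<O>" r Eb
  for E :: "nat set" and \<O> :: "(nat set \<times> nat set) set" and r :: nat and Eb :: "nat \<Rightarrow> nat set" +
  fixes chi :: "nat set \<Rightarrow> nat \<Rightarrow> nat \<Rightarrow> int"
  assumes om: "oriented_matroid E \<O>"
    and chi: "flat E (underlying \<O>) F \<Longrightarrow> mrank (underlying \<O>) F = 2 \<Longrightarrow> chirotope_of \<O> F (chi F)"
begin

abbreviation \<M> :: "nat set set" where "\<M> \<equiv> underlying \<O>"

definition sg :: "nat set \<Rightarrow> nat \<Rightarrow> int" where "sg P x = (if x \<in> P then 1 else -1)"

text \<open>A vanishing determinant would give a dependency on {a,b}, hence a circuit with at most
  two elements, against simplicity.\<close>

lemma chi_unit: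
  assumes F: "flat E \<M> F" "mrank \<M> F = 2" and ab: "a \<in> F" "b \<in> F" "a \<noteq> b"
  shows "chi F a b * chi F a b = 1" "chi F b a = - chi F a b"
proof -
  obtain v where v: "vec_circuits F v = restr_om \<O> F"
    "\<forall>j\<in>F. \<forall>k\<in>F. real_of_int (chi F j k) = sgn (fst (v j) * snd (v k) - snd (v j) * fst (v k))"
    using chi[OF F] unfolding chirotope_of_def by blast
  have fin: "finite F" using F(1) finite_E finite_subset unfolding flat_def by blast
  let ?d = "fst (v a) * snd (v b) - snd (v a) * fst (v b)"
  have "?d \<noteq> 0"
  proof
    assume "?d = 0"
    then obtain l where l: "vec_dep F v l" "{k\<in>F. l k \<noteq> 0} \<subseteq> {a,b}"
      using det_zero_vec_dep[OF fin ab] by blast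
    then obtain P N where PN: "(P,N) \<in> vec_circuits F v" "P \<union> N \<subseteq> {a,b}"
      using vec_dep_circuit[OF fin l(1)] by blast
    then have "(P,N) \<in> \<O>" unfolding v(1) restr_om_def by blast
    then show False using no_small_circuit[OF underlyingI PN(2)] by blast
  qed
  have c: "real_of_int (chi F a b) = sgn ?d" using v(2) ab by blast
  have "real_of_int (chi F b a) = sgn (- ?d)" using v(2) ab by (simp add: algebra_simps)
  then have "real_of_int (chi F b a) = real_of_int (- chi F a b)"
    using c by (simp only: sgn_minus of_int_minus)
  then show "chi F b a = - chi F a b" by (simp only: of_int_eq_iff)
  have "real_of_int (chi F a b * chi F a b) = real_of_int 1"
    using c \<open>?d \<noteq> 0\<close> by (cases "?d > 0") (simp_all add: sgn_if)
  then show "chi F a b * chi F a b = 1" by (simp only: of_int_eq_iff)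
qed

text \<open>Pairing the linear dependency of a circuit with the vector of a recovers the signs of the
  other two elements from the chirotope.\<close>

lemma circuit_signs:
  assumes F: "flat E \<M> F" "mrank \<M> F = 2"
    and PN: "(P,N) \<in> \<O>" "P \<union> N = {a,b,d}" and abd: "{a,b,d} \<subseteq> F"
  shows "sg P b * sg P d = - (chi F a b * chi F a d)"
proof -
  obtain v where v: "vec_circuits F v = restr_om \<O> F"
    "\<forall>j\<in>F. \<forall>k\<in>F. real_of_int (chi F j k) = sgn (fst (v j) * snd (v k) - snd (v j) * fst (v k))"
    using chi[OF F] unfolding chirotope_of_def by blast
  have fin: "finite F" using F(1) finite_E finite_subset unfolding flat_def by blast
  have dis: "a \<noteq> b" "a \<noteq> d" "b \<noteq> d" using tri_distinct[of a b d] underlyingI[OF PN(1)] PN(2) by auto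
  let ?det = "\<lambda>x y. fst (v x) * snd (v y) - snd (v x) * fst (v y)"
  have "(P,N) \<in> vec_circuits F v" using v(1) PN abd unfolding restr_om_def by auto
  then obtain l where l: "P = {k\<in>F. l k > 0}" "N = {k\<in>F. l k < 0}" "vec_dep F v l"
    unfolding vec_circuits_def by blast
  have l0: "l k = 0" if "k \<in> F - {a,b,d}" for k
  proof (rule ccontr)
    assume "l k \<noteq> 0"
    then have "k \<in> P \<union> N" unfolding l using that by auto
    then show False using PN(2) that by blast
  qed
  have sum: "(\<Sum>k\<in>F. l k * h k) = l a * h a + l b * h b + l d * h d" for h :: "nat \<Rightarrow> real"
  proof -
    have "(\<Sum>k\<in>F. l k * h k) = (\<Sum>k\<in>{a,b,d}. l k * h k)"
      using fin abd l0 by (intro sum.mono_neutral_right) auto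
    then show ?thesis using dis by simp
  qed
  have "l a * fst (v a) + l b * fst (v b) + l d * fst (v d) = 0"
    "l a * snd (v a) + l b * snd (v b) + l d * snd (v d) = 0"
    using l(3) unfolding vec_dep_def sum by auto
  then have "fst (v a) * (l a * snd (v a) + l b * snd (v b) + l d * snd (v d))
      - snd (v a) * (l a * fst (v a) + l b * fst (v b) + l d * fst (v d)) = 0" by simp
  then have lin: "l b * ?det a b = - (l d * ?det a d)" by (simp add: algebra_simps)
  have sgl: "real_of_int (sg P k) = sgn (l k)" if "k \<in> {a,b,d}" for k
  proof (cases "k \<in> P")
    case True then show ?thesis unfolding sg_def l(1) by simp
  next
    case False
    then have "k \<in> N" using that PN(2) by blast
    then show ?thesis using False unfolding sg_def l by simp
  qed
  have chis: "real_of_int (chi F a b) = sgn (?det a b)" "real_of_int (chi F a d) = sgn (?det a d)"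
    using v(2) abd by auto
  have "real_of_int (sg P b * chi F a b) = sgn (l b * ?det a b)"
    using sgl[of b] chis by (simp add: sgn_mult)
  also have "\<dots> = real_of_int (- (sg P d * chi F a d))"
    unfolding lin using sgl[of d] chis by (simp add: sgn_mult sgn_minus)
  finally have e: "sg P b * chi F a b = - (sg P d * chi F a d)" by (simp only: of_int_eq_iff)
  have "a \<in> F" "b \<in> F" "d \<in> F" using abd by auto
  then have u: "chi F a b * chi F a b = 1" using chi_unit[OF F] dis by blast
  have "sg P d * sg P d = 1" unfolding sg_def by simp
  have "sg P b * sg P d = sg P b * (chi F a b * chi F a b) * sg P d" using u by simp
  also have "\<dots> = (sg P b * chi F a b) * (chi F a b * sg P d)" by (simp only: mult.assoc)
  also have "\<dots> = - ((sg P d * sg P d) * (chi F a b * chi F a d))" unfolding e by (simp add: mult_ac)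
  finally show ?thesis using \<open>sg P d * sg P d = 1\<close> by simp
qed

lemma line_flat:
  assumes "{a,b,d} \<in> \<M>"
  shows "flat E \<M> (line a b)" "mrank \<M> (line a b) = 2" "{a,b,d} \<subseteq> line a b"
    "line a d = line a b"
proof -
  have ab: "a \<in> E" "b \<in> E" "a \<noteq> b" using tri_in_E[OF assms] tri_distinct[OF assms] by auto
  show "flat E \<M> (line a b)" "mrank \<M> (line a b) = 2"
    using flat_line[OF ab] mrank_line[OF ab] by auto
  show sub: "{a,b,d} \<subseteq> line a b" using assms unfolding line_def by blast
  show "line a d = line a b" using line_eq[of a a b d] sub tri_distinct[OF assms] by auto
qed

text \<open>If three of the four points were collinear, Z would be dragged along and the triangle X,
  Y, Z would collapse to a line. So a circuit among them uses all four.\<close>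

lemma circuit_quadrilateral:
  assumes t: "{P,Y,Z} \<in> \<M>" "{Q,Z,X} \<in> \<M>" "{P,Q,R} \<in> \<M>"
    and n: "{X,Y,Z} \<notin> \<M>" and XY: "X \<noteq> Y" and C: "C \<in> \<M>" "C \<subseteq> {P,Y,Q,X}"
  shows "C = {P,Y,Q,X}"
proof -
  note d = tri_distinct[OF t(1)] tri_distinct[OF t(2)] tri_distinct[OF t(3)]
  have 1: "{P,Y,X} \<notin> \<M>"
    using tri_trans[of Y P X Z] t(1) n d by (auto simp: insert_commute)
  have 2: "{Q,X,Y} \<notin> \<M>"
    using tri_trans[of X Q Y Z] t(2) n d by (auto simp: insert_commute)
  have 3: "{P,Q,Y} \<notin> \<M>"
  proof
    assume "{P,Q,Y} \<in> \<M>"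
    then have "{Y,Q,Z} \<in> \<M>" using tri_trans[of Y P Q Z] t(1) d by (auto simp: insert_commute)
    then have "{Z,X,Y} \<in> \<M>" using tri_trans[of Z Q X Y] t(2) XY by (auto simp: insert_commute)
    then show False using n by (simp add: insert_commute)
  qed
  have 4: "{P,Q,X} \<notin> \<M>"
  proof
    assume "{P,Q,X} \<in> \<M>"
    then have "{X,P,Z} \<in> \<M>" using tri_trans[of X Q P Z] t(2) d by (auto simp: insert_commute)
    then have "{Z,X,Y} \<in> \<M>" using tri_trans[of Z P X Y] t(1) XY by (auto simp: insert_commute)
    then show False using n by (simp add: insert_commute)
  qed
  have sub: "C = T" if "C \<subseteq> T" "T = {a,b,d}" for T a b d using circuit_eq_tri[OF C(1)] that by blast
  show ?thesis
  proof (rule ccontr)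
    assume "C \<noteq> {P,Y,Q,X}"
    then consider "C \<subseteq> {P,Y,X}" | "C \<subseteq> {Q,X,Y}" | "C \<subseteq> {P,Q,Y}" | "C \<subseteq> {P,Q,X}" using C(2) by blast
    then show False
    proof cases
      case 1 then show False using circuit_eq_tri[OF C(1) 1] C(1) \<open>{P,Y,X} \<notin> \<M>\<close> by simp
    next
      case 2 then show False using circuit_eq_tri[OF C(1) 2] C(1) \<open>{Q,X,Y} \<notin> \<M>\<close> by simp
    next
      case 3 then show False using circuit_eq_tri[OF C(1) 3] C(1) \<open>{P,Q,Y} \<notin> \<M>\<close> by simp
    next
      case 4 then show False using circuit_eq_tri[OF C(1) 4] C(1) \<open>{P,Q,X} \<notin> \<M>\<close> by simp
    qed
  qed
qed

text \<open>Signed Menelaus configuration: the quadrilateral P, Y, Q, X carries a unique signed circuit up to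
  negation, obtained by eliminating Z as well as by eliminating R.\<close>

lemma chi_menelaus:
  assumes t: "{P,Y,Z} \<in> \<M>" "{Q,Z,X} \<in> \<M>" "{R,X,Y} \<in> \<M>" "{P,Q,R} \<in> \<M>"
    and n: "{X,Y,Z} \<notin> \<M>"
  defines "c \<equiv> \<lambda>a b. chi (line a b) a b"
  shows "c P Y * c P Z * (c Q Z * c Q X) * (c R X * c R Y) = 1"
proof -
  note d = tri_distinct[OF t(1)] tri_distinct[OF t(2)] tri_distinct[OF t(3)] tri_distinct[OF t(4)]
  have PX: "P \<noteq> X" "Q \<noteq> Y" using t n by (auto simp: insert_commute)
  \<comment> \<open>Z is positive in the first circuit and negative in the negated second one, which
    permits signed elimination of Z; the same holds for R in the last two circuits.\<close>
  obtain P1 N1 where 1: "{P,Y,Z} = P1 \<union> N1" "(P1,N1) \<in> \<O>" "Z \<in> P1"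
    using signed_circuit_with_positive[OF om t(1)] by blast
  obtain N2 P2 where 2: "{Q,Z,X} = N2 \<union> P2" "(N2,P2) \<in> \<O>" "Z \<in> N2"
    using signed_circuit_with_positive[OF om t(2)] by blast
  obtain P3 N3 where 3: "{R,X,Y} = P3 \<union> N3" "(P3,N3) \<in> \<O>" "R \<in> P3"
    using signed_circuit_with_positive[OF om t(3)] by blast
  obtain N4 P4 where 4: "{P,Q,R} = N4 \<union> P4" "(N4,P4) \<in> \<O>" "R \<in> N4"
    using signed_circuit_with_positive[OF om t(4)] by blast
  note neg2 = om_neg[OF om 2(2)] and neg4 = om_neg[OF om 4(2)]
  note disj = om_subset[OF om 1(2)] om_subset[OF om 2(2)] om_subset[OF om 3(2)] om_subset[OF om 4(2)]
  have "P \<in> P1 \<union> N1" "P \<notin> N2 \<union> P2" using 1(1) 2(1)[symmetric] d PX by auto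
  then have "(P1,N1) \<noteq> (N2,P2)" by auto
  then obtain S T where ST: "(S,T) \<in> \<O>" "S \<subseteq> (P1 \<union> P2) - {Z}" "T \<subseteq> (N1 \<union> N2) - {Z}"
    using om_elim[OF om 1(2) neg2, of Z] 1(3) 2(3) by blast
  have "X \<in> P3 \<union> N3" "X \<notin> N4 \<union> P4" using 3(1) 4(1)[symmetric] d PX by auto
  then have "(P3,N3) \<noteq> (N4,P4)" by auto
  then obtain S' T' where ST': "(S',T') \<in> \<O>" "S' \<subseteq> (P3 \<union> P4) - {R}" "T' \<subseteq> (N3 \<union> N4) - {R}"
    using om_elim[OF om 3(2) neg4, of R] 3(3) 4(3) by blast
  have "S \<union> T \<subseteq> {P,Y,Q,X}" using ST(2,3) 1(1) 2(1) by blast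
  then have full: "S \<union> T = {P,Y,Q,X}"
    using circuit_quadrilateral[OF t(1,2,4) n d(9) underlyingI[OF ST(1)]] by blast
  have "S' \<union> T' \<subseteq> {P,Y,Q,X}" using ST'(2,3) 3(1) 4(1) by blast
  then have full': "S' \<union> T' = {P,Y,Q,X}"
    using circuit_quadrilateral[OF t(1,2,4) n d(9) underlyingI[OF ST'(1)]] by blast
  have same: "(S,T) = (S',T') \<or> (S,T) = (T',S')"
    using om_incomparable[OF om ST(1) ST'(1)] full full' by simp
  have dST: "S \<inter> T = {}" "S' \<inter> T' = {}" using om_subset[OF om] ST(1) ST'(1) by blast+
  \<comment> \<open>A point lying in only one of the two combined circuits keeps its sign in the
    eliminated one.\<close>
  have mem: "z \<in> U \<longleftrightarrow> z \<in> P'"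
    if "z \<in> U \<union> V" "z \<in> P' \<union> N'" "z \<notin> P'' \<union> N''" "P' \<inter> N' = {}"
      and "U \<subseteq> P' \<union> P'' - A" "V \<subseteq> N' \<union> N'' - A"
    for z :: nat and U V P' N' P'' N'' A
    using that by blast
  have Y: "Y \<in> S \<longleftrightarrow> Y \<in> P1"
    by (rule mem[OF _ _ _ _ ST(2,3)]) (use full 1(1) 2(1)[symmetric] d PX disj in auto)
  have X: "X \<in> S \<longleftrightarrow> X \<in> P2"
    by (rule mem[of X S T P2 N2 P1 N1 "{Z}"])
       (use ST(2,3) full 2(1) 1(1)[symmetric] d PX disj in auto)
  have Y': "Y \<in> S' \<longleftrightarrow> Y \<in> P3"
    by (rule mem[OF _ _ _ _ ST'(2,3)]) (use full' 3(1) 4(1)[symmetric] d PX disj in auto)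
  have X': "X \<in> S' \<longleftrightarrow> X \<in> P3"
    by (rule mem[OF _ _ _ _ ST'(2,3)]) (use full' 3(1) 4(1)[symmetric] d PX disj in auto)
  have "X \<in> S \<union> T" "Y \<in> S \<union> T" using full by auto
  \<comment> \<open>The circuit on P, Y, Q, X is unique up to negation, so both eliminations agree
    on whether X and Y have equal signs.\<close>
  then have key: "(X \<in> P2 \<longleftrightarrow> Y \<in> P1) \<longleftrightarrow> (X \<in> P3 \<longleftrightarrow> Y \<in> P3)"
    using same X Y X' Y' dST by auto
  have Z2: "Z \<notin> P2" using 2(3) disj(2) by blast
  have line1: "line P Z = line P Y" "line Q X = line Q Z" "line R Y = line R X"
    using line_flat(4)[OF t(1)] line_flat(4)[OF t(2)] line_flat(4)[OF t(3)] by auto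
  have s1: "c P Y * c P Z = - (sg P1 Y * sg P1 Z)"
    using circuit_signs[OF line_flat(1,2)[OF t(1)] 1(2) 1(1)[symmetric] line_flat(3)[OF t(1)]]
    unfolding c_def line1 by simp
  have s2: "c Q Z * c Q X = - (sg P2 Z * sg P2 X)"
    using circuit_signs[OF line_flat(1,2)[OF t(2)] neg2 _ line_flat(3)[OF t(2)]] 2(1)
    unfolding c_def line1 by (simp add: Un_commute)
  have s3: "c R X * c R Y = - (sg P3 X * sg P3 Y)"
    using circuit_signs[OF line_flat(1,2)[OF t(3)] 3(2) 3(1)[symmetric] line_flat(3)[OF t(3)]]
    unfolding c_def line1 by simp
  show ?thesis unfolding s1 s2 s3 unfolding sg_def using key 1(3) Z2 by (auto split: if_splits)
qed

text \<open>The homomorphism \<open>of_int\<close> carries the sign identities into the field in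
  every characteristic.\<close>

definition cf :: "nat \<Rightarrow> nat \<Rightarrow> 'k::field" where
  "cf a b = of_int (chi (line a b) a b)"

lemma twisted_matroid_chi: "twisted_matroid E \<M> r Eb (- 1 :: 'k::field) cf"
proof unfold_locales
  show "(- 1) * (- 1) = (1 :: 'k)" by simp
  show "cf a b * cf a b = (1::'k)" if "a \<in> E" "b \<in> E" "a \<noteq> b" for a b
  proof -
    have "chi (line a b) a b * chi (line a b) a b = 1"
      by (rule chi_unit(1)[OF flat_line[OF that] mrank_line[OF that]]) (use that in \<open>auto simp: line_def\<close>)
    then show ?thesis unfolding cf_def by (metis of_int_1 of_int_mult)
  qed
  show "cf b a = - 1 * (cf a b :: 'k)" if "a \<in> E" "b \<in> E" "a \<noteq> b" for a b
  proof -
    have "chi (line a b) b a = - chi (line a b) a b"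
      by (rule chi_unit(2)[OF flat_line[OF that] mrank_line[OF that]]) (use that in \<open>auto simp: line_def\<close>)
    then show ?thesis unfolding cf_def line_commute[of b a] by simp
  qed
  show "cf P Y * cf P Z * (cf Q Z * cf Q X) * (cf R X * cf R Y) = (1::'k)"
    if "{P,Y,Z} \<in> \<M>" "{Q,Z,X} \<in> \<M>" "{R,X,Y} \<in> \<M>" "{P,Q,R} \<in> \<M>"
      "{X,Y,Z} \<notin> \<M>" for P Q R X Y Z
    using chi_menelaus[OF that] unfolding cf_def by (metis of_int_1 of_int_mult)
qed

end

section \<open>The Varchenko-Gelfand algebra\<close>

context blocked_oriented_matroid
begin

lemma vg_results:
  defines "J \<equiv> koszul_dual_ideal E (ideal_gen E (VG_gens E \<O>)) :: 'k::field ncpoly set"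
  shows "dual_groebner E r Eb {rpmF (chi F) j F | j F. flat E \<M> F \<and> mrank \<M> F = 2 \<and> j \<in> F}
    (rpm_retro E \<M> chi) J"
proof -
  interpret T: twisted_matroid E "\<M>" r Eb "- 1 :: 'k" cf by (rule twisted_matroid_chi)
  \<comment> \<open>Relations for s = -1 are symmetric, so [x,z] may stand for [z,x]. The pairing
    with the boundary and the cocycle condition differ by the unit
    \<open>?e x * cf y z\<close>.\<close>
  have vg: "pairing E g (vg_bd P N) = 0 \<longleftrightarrow> cf z x * g [x,z] + cf y z * g [y,z] + cf x y * g [x,y] = 0"
    if PN: "(P,N) \<in> \<O>" "P \<union> N = {x,y,z}" and o: "x < y" "y < z"
    for P N x y z and g :: "'k ncpoly"
  proof -
    have t: "{x,y,z} \<in> \<M>" using underlyingI[OF PN(1)] PN(2) by simp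
    note E = tri_in_E[OF t] and dis = tri_distinct[OF t]
    let ?F = "line x y"
    note F = line_flat(1,2)[OF t]
    have sub: "{x,y,z} \<subseteq> ?F" by (rule line_flat(3)[OF t])
    have L: "line a b = ?F" if "a \<in> {x,y,z}" "b \<in> {x,y,z}" "a \<noteq> b" for a b
      using line_eq[of a x y b] that sub dis by blast
    have cf: "cf a b = (of_int (chi ?F a b) :: 'k)" if "a \<in> {x,y,z}" "b \<in> {x,y,z}" "a \<noteq> b" for a b
      using L[OF that] unfolding cf_def by simp
    have eps: "of_int (sg P b) * of_int (sg P d) = - (cf a b * cf a d :: 'k)"
      if "{a,b,d} = {x,y,z}" "a \<noteq> b" "a \<noteq> d" for a b d
    proof -
      have "sg P b * sg P d = - (chi ?F a b * chi ?F a d)"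
        by (rule circuit_signs[OF F PN(1)]) (use that PN(2) sub in auto)
      then have "(of_int (sg P b * sg P d) :: 'k) = of_int (- (chi ?F a b * chi ?F a d))" by simp
      moreover have "a \<in> {x,y,z}" "b \<in> {x,y,z}" "d \<in> {x,y,z}" using that(1) by blast+
      ultimately show ?thesis using cf[of a b] cf[of a d] that(2,3) by simp
    qed
    let ?e = "\<lambda>k. of_int (sg P k) :: 'k"
    have p: "pairing E g (vg_bd P N) = ?e x * g [y,z] + ?e y * g [x,z] + ?e z * g [x,y]"
    proof -
      have "(if k \<in> P then 1 else -1) = ?e k" for k unfolding sg_def by simp
      then show ?thesis unfolding vg_bd_3[OF o PN(2)] pairing_add pairing_smult
        using E by (simp add: pairing_mono finite_E T.words_pair)
    qed
    have ee: "?e x * ?e x = 1" unfolding sg_def by simp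
    have yz: "cf y z * cf y z = (1::'k)" using T.c_square E dis by blast
    have e1: "?e x * ?e y = cf z x * cf y z"
      using eps[of z x y] T.c_swap[of y z] E dis by (auto simp: insert_commute)
    have e2: "?e x * ?e z = cf x y * cf y z"
      using eps[of y x z] T.c_swap[of x y] E dis by (auto simp: insert_commute)
    have "(?e x * cf y z) * pairing E g (vg_bd P N)
      = cf y z * (?e x * ?e x) * g [y,z] + cf y z * (?e x * ?e y) * g [x,z] + cf y z * (?e x * ?e z) * g [x,y]"
      unfolding p by (simp add: algebra_simps)
    also have "\<dots> = cf y z * g [y,z] + cf z x * (cf y z * cf y z) * g [x,z] + cf x y * (cf y z * cf y z) * g [x,y]"
      unfolding ee e1 e2 by (simp add: mult_ac)
    also have "\<dots> = cf z x * g [x,z] + cf y z * g [y,z] + cf x y * g [x,y]" unfolding yz by simp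
    finally have eq: "(?e x * cf y z) * pairing E g (vg_bd P N) = cf z x * g [x,z] + cf y z * g [y,z] + cf x y * g [x,y]" .
    have "?e x * cf y z \<noteq> 0" using ee yz by auto
    then show ?thesis unfolding eq[symmetric] by simp
  qed
  have J: "J = ideal_gen E T.rels"
  proof -
    let ?bd = "\<lambda>C h. \<exists>P N. (P,N) \<in> \<O> \<and> C = P \<union> N \<and> h = vg_bd P N"
    have "koszul_dual_ideal E (ideal_gen E ({mono [i,j] + smult (- 1) (mono [j,i]) | i j. i \<in> E \<and> j \<in> E}
        \<union> {mono [i,i] | i. i \<in> E} \<union> {h. \<exists>C\<in>\<M>. ?bd C h})) = ideal_gen E T.rels"
    proof (rule T.koszul_dual_ideal_rels)
      show "\<exists>h. ?bd C h" if "C \<in> \<M>" for C using that unfolding underlying_def by blast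
      show "homog (card C - 1) h" if "C \<in> \<M>" "?bd C h" for C and h :: "'k ncpoly"
        using homog_vg_bd[where 'k = 'k] finite_circuit[OF that(1)] that(2) by blast
      fix x y z and h g :: "'k ncpoly"
      assume t: "{x,y,z} \<in> \<M>" and o: "x < y" "y < z" and h: "?bd {x,y,z} h"
        and a: "g [z,x] = - (- 1 * g [x,z])"
      obtain P N where "(P,N) \<in> \<O>" "P \<union> N = {x,y,z}" "h = vg_bd P N" using h by auto
      then show "pairing E g h = 0 \<longleftrightarrow> cf x y * g [x,y] + cf y z * g [y,z] + cf z x * g [z,x] = 0"
        using vg[of P N x y z g] o a by (simp add: algebra_simps)
    qed
    moreover have "f + smult (- 1) h = f - h" for f h :: "'k ncpoly" by (rule ext) simp
    moreover have "{h :: 'k ncpoly. \<exists>C\<in>\<M>. ?bd C h} = {vg_bd P N | P N. (P,N) \<in> \<O>}"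
      using underlyingI by blast
    ultimately show ?thesis unfolding J_def VG_gens_def by (simp only:)
  qed
  have F: "rpmF (chi F) j F = T.relF j F"
    if F: "flat E \<M> F" "mrank \<M> F = 2" "j \<in> F" for j F
    unfolding rpmF_def T.relF_def
  proof (intro sum.cong refl)
    fix k assume "k \<in> F - {j}"
    then have "F = line j k" by (intro rank_two_flat_eq_line[OF F]) auto
    then show "smult (of_int (chi F j k)) (mono [j,k] + mono [k,j])
        = (smult (cf j k) (mono [j,k] - smult (- 1) (mono [k,j])) :: 'k ncpoly)"
      unfolding cf_def by (intro ext) simp
  qed
  have Fs: "{rpmF (chi F) j F | j F. flat E \<M> F \<and> mrank \<M> F = 2 \<and> j \<in> F}
    = {T.relF j F | j F. flat E \<M> F \<and> mrank \<M> F = 2 \<and> j \<in> F}"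
    by (rule Collect_cong, intro iff_exI) (use F in auto)
  have R: "rpm_retro E \<M> chi j i = T.rretro j i" if "retrograde r Eb j i" for j i
  proof -
    have p: "(j,i) \<in> T.retro_pairs" using that T.retrograde_pairs by blast
    then have e: "i \<in> E" "j \<in> E" "j \<noteq> i" unfolding T.retro_pairs_def by auto
    let ?F = "line j i"
    have ci: "of_int (chi ?F j i) = (cf j i :: 'k)" unfolding cf_def ..
    have "smult (of_int (chi ?F j k)) (mono [j,k] + mono [k,j])
        = (smult (cf j k) (mono [j,k] - smult (- 1) (mono [k,j])) :: 'k ncpoly)" if "k \<in> ?F - {i,j}" for k
    proof -
      have "line j k = ?F" by (rule line_eq) (use that e in \<open>auto simp: line_def\<close>)
      then show ?thesis unfolding cf_def by (intro ext) simp
    qed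
    then have "(\<Sum>k\<in>?F - {i,j}. smult (of_int (chi ?F j k)) (mono [j,k] + mono [k,j]))
      = (\<Sum>k\<in>?F - {i,j}. smult (cf j k) (mono [j,k] - smult (- 1) (mono [k,j])) :: 'k ncpoly)"
      by (rule sum.cong[OF refl])
    then show ?thesis
      unfolding rpm_retro_def Let_def fjoin_eq_line[OF e(2,1,3)] T.relF_rretro_sum[OF p] ci
      by (simp only:) (intro ext, simp)
  qed
  show ?thesis
    using T.dual_groebner_rels dual_groebner_cong[of r Eb "rpm_retro E \<M> chi" T.rretro, OF R]
    unfolding J Fs by blast
qed

end

theorem theorem5p18:
  fixes n r :: nat and Eb :: "nat \<Rightarrow> nat set"
  shows
  "(\<forall>\<C>. matroid {1..n} \<C> \<and> simple_matroid \<C> \<and> supersolvable {1..n} \<C> \<and> mrank \<C> {1..n} = r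
       \<and> ordered_partition {1..n} r Eb \<and> good_partition \<C> r Eb \<longrightarrow>
     (let J = (koszul_dual_ideal {1..n} (ideal_gen {1..n} (OS_gens {1..n} \<C>)) :: 'k::field ncpoly set) in
      \<exists>prec. monomial_order {1..n} prec
        \<and> groebner_basis prec {rF j F | j F. flat {1..n} \<C> F \<and> mrank \<C> F = 2 \<and> j \<in> F} J
        \<and> reduced_groebner_basis prec {r_retro {1..n} \<C> j i | j i. retrograde r Eb j i} J
        \<and> (\<forall>j i. retrograde r Eb j i \<longrightarrow> lm prec (r_retro {1..n} \<C> j i :: 'k ncpoly) = [j,i])
        \<and> initial_ideal {1..n} prec J = ideal_gen {1..n} {mono [j,i] | j i. retrograde r Eb j i}
        \<and> standard_monomials {1..n} prec J = block_products r Eb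
        \<and> quotient_basis {1..n} J (standard_monomials {1..n} prec J)
        \<and> hilb_series {1..n} J = 1 / (\<Prod>p\<in>{1..r}. 1 - of_nat (card (Eb p)) * fps_X)))
   \<and>
   (\<forall>\<O> chi. oriented_matroid {1..n} \<O> \<and> simple_matroid (underlying \<O>)
       \<and> supersolvable {1..n} (underlying \<O>) \<and> mrank (underlying \<O>) {1..n} = r
       \<and> ordered_partition {1..n} r Eb \<and> good_partition (underlying \<O>) r Eb
       \<and> (\<forall>F. flat {1..n} (underlying \<O>) F \<and> mrank (underlying \<O>) F = 2 \<longrightarrow> chirotope_of \<O> F (chi F))
     \<longrightarrow>
     (let J = (koszul_dual_ideal {1..n} (ideal_gen {1..n} (VG_gens {1..n} \<O>)) :: 'k ncpoly set) in
      \<exists>prec. monomial_order {1..n} prec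
        \<and> groebner_basis prec {rpmF (chi F) j F | j F. flat {1..n} (underlying \<O>) F
                                   \<and> mrank (underlying \<O>) F = 2 \<and> j \<in> F} J
        \<and> reduced_groebner_basis prec {rpm_retro {1..n} (underlying \<O>) chi j i | j i. retrograde r Eb j i} J
        \<and> (\<forall>j i. retrograde r Eb j i \<longrightarrow> lm prec (rpm_retro {1..n} (underlying \<O>) chi j i :: 'k ncpoly) = [j,i])
        \<and> initial_ideal {1..n} prec J = ideal_gen {1..n} {mono [j,i] | j i. retrograde r Eb j i}
        \<and> standard_monomials {1..n} prec J = block_products r Eb
        \<and> quotient_basis {1..n} J (standard_monomials {1..n} prec J)
        \<and> hilb_series {1..n} J = 1 / (\<Prod>p\<in>{1..r}. 1 - of_nat (card (Eb p)) * fps_X)))"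
proof (intro conjI allI impI, goal_cases)
  case (1 \<C>)
  then interpret blocked_matroid "{1..n}" \<C> r Eb by unfold_locales blast+
  show ?case using os_results unfolding Let_def dual_groebner_def .
next
  case (2 \<O> chi)
  then have "matroid {1..n} (underlying \<O>)" using underlying_matroid by blast
  then interpret blocked_oriented_matroid "{1..n}" \<O> r Eb chi
    using 2 by unfold_locales blast+
  show ?case using vg_results unfolding Let_def dual_groebner_def .
qed

end
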